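(* Over $\mathsf{RCA}_0$, $\mathsf{AHT}$ implies $\mathsf{SRT}^2$, the Stable Ramsey's Theorem for pairs and arbitrary finite colorings; that is, $\mathsf{RCA}_0 \vdash \mathsf{AHT} \rightarrow \mathsf{SRT}^2$.
   Context: $\mathsf{RCA}_0$ is the usual base system of reverse mathematics in second-order arithmetic; $\mathbf{N}$ denotes its first-order universe, and all principles below are statements in the language of second-order arithmetic. A map into $k$ means a map into $\{0,\dots,k-1\}$. $[\mathbf{N}]^2$ is the set of pairs $(x,y)$ of elements of $\mathbf{N}$ with $x<y$. For a positive integer $n=2^{t_1}+\dots+2^{t_p}$ with $t_1<\dots<t_p$, put $\lambda(n)=t_1$ and $\mu(n)=t_p$. A set $X$ of positive integers satisfies the Apartness Condition if for all $x,x'\in X$ with $x<x'$ we have $\mu(x)<\lambda(x')$. For an infinite set $H=\{h_1<h_2<h_3<\dots\}$, $AS(H)$ denotes the set of all finite sums of distinct adjacent elements of $H$, i.e. all sums $h_i+h_{i+1}+\dots+h_j$ with $i\le j$ (including single elements, $i=j$). $\mathsf{AHT}_k$ (Adjacent Hindman's Theorem for $k$ colors): for every $c:\mathbf{N}\to k$ there exists an infinite set $H$ of positive integers satisfying the Apartness Condition such that all elements of $AS(H)$ have the same $c$-color. $\mathsf{AHT}$ denotes the single sentence $\forall k\,\mathsf{AHT}_k$. A coloring $f:[\mathbf{N}]^2\to k$ is stable if for every $x$ the limit $\lim_{s\to\infty} f(x,s)$ exists, i.e. there are $d<k$ and $t>x$ with $f(x,s)=d$ for all $s\ge t$. $\mathsf{SRT}^2_k$: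 for every stable $f:[\mathbf{N}]^2\to k$ there is an infinite set $J\subseteq\mathbf{N}$ and a color $d<k$ such that $f(x,y)=d$ for all $x<y$ in $J$. $\mathsf{SRT}^2$ denotes the single sentence $\forall k\,\mathsf{SRT}^2_k$. *)

theory Defs
  imports Main
begin

section \<open>The language of second-order arithmetic\<close>

text \<open>
  Number variables and set variables are de Bruijn indices, counted separately for the two sorts.
  Equality is primitive for numbers only. Logic is classical, with the remaining connectives
  and quantifiers defined from falsum, implication and the two universal quantifiers.
\<close>

datatype tm = Var nat | Zero | One | Plus tm tm | Times tm tm

datatype fm =
    Eq tm tm
  | Less tm tm
  | Mem tm nat
  | Bot
  | Imp fm fm
  | AllN fm
  | AllS fm

definition Neg :: "fm \<Rightarrow> fm" where "Neg \<phi> = Imp \<phi> Bot"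
definition And :: "fm \<Rightarrow> fm \<Rightarrow> fm" where "And \<phi> \<psi> = Neg (Imp \<phi> (Neg \<psi>))"
definition Or :: "fm \<Rightarrow> fm \<Rightarrow> fm" where "Or \<phi> \<psi> = Imp (Neg \<phi>) \<psi>"
definition Iff :: "fm \<Rightarrow> fm \<Rightarrow> fm" where "Iff \<phi> \<psi> = And (Imp \<phi> \<psi>) (Imp \<psi> \<phi>)"
definition ExN :: "fm \<Rightarrow> fm" where "ExN \<phi> = Neg (AllN (Neg \<phi>))"
definition ExS :: "fm \<Rightarrow> fm" where "ExS \<phi> = Neg (AllS (Neg \<phi>))"

text \<open>Simultaneous substitution of terms for number variables and set variables for set variables.\<close>

primrec subst_tm :: "(nat \<Rightarrow> tm) \<Rightarrow> tm \<Rightarrow> tm" where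
  "subst_tm \<sigma> (Var n) = \<sigma> n"
| "subst_tm \<sigma> Zero = Zero"
| "subst_tm \<sigma> One = One"
| "subst_tm \<sigma> (Plus s t) = Plus (subst_tm \<sigma> s) (subst_tm \<sigma> t)"
| "subst_tm \<sigma> (Times s t) = Times (subst_tm \<sigma> s) (subst_tm \<sigma> t)"

definition shift_tm :: "tm \<Rightarrow> tm" where
  "shift_tm = subst_tm (\<lambda>n. Var (Suc n))"

primrec subst :: "(nat \<Rightarrow> tm) \<Rightarrow> (nat \<Rightarrow> nat) \<Rightarrow> fm \<Rightarrow> fm" where
  "subst \<sigma> \<rho> (Eq s t) = Eq (subst_tm \<sigma> s) (subst_tm \<sigma> t)"
| "subst \<sigma> \<rho> (Less s t) = Less (subst_tm \<sigma> s) (subst_tm \<sigma> t)"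
| "subst \<sigma> \<rho> (Mem t X) = Mem (subst_tm \<sigma> t) (\<rho> X)"
| "subst \<sigma> \<rho> Bot = Bot"
| "subst \<sigma> \<rho> (Imp \<phi> \<psi>) = Imp (subst \<sigma> \<rho> \<phi>) (subst \<sigma> \<rho> \<psi>)"
| "subst \<sigma> \<rho> (AllN \<phi>) = AllN (subst (case_nat (Var 0) (\<lambda>n. shift_tm (\<sigma> n))) \<rho> \<phi>)"
| "subst \<sigma> \<rho> (AllS \<phi>) = AllS (subst \<sigma> (case_nat 0 (\<lambda>n. Suc (\<rho> n))) \<phi>)"

definition shiftN :: "fm \<Rightarrow> fm" where "shiftN = subst (\<lambda>n. Var (Suc n)) (\<lambda>X. X)"
definition shiftS :: "fm \<Rightarrow> fm" where "shiftS = subst Var Suc"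
definition instN :: "tm \<Rightarrow> fm \<Rightarrow> fm" where "instN t = subst (case_nat t Var) (\<lambda>X. X)"
definition instS :: "nat \<Rightarrow> fm \<Rightarrow> fm" where "instS X = subst Var (case_nat X (\<lambda>Y. Y))"

primrec closed_tm :: "nat \<Rightarrow> tm \<Rightarrow> bool" where
  "closed_tm m (Var n) \<longleftrightarrow> n < m"
| "closed_tm m Zero \<longleftrightarrow> True"
| "closed_tm m One \<longleftrightarrow> True"
| "closed_tm m (Plus s t) \<longleftrightarrow> closed_tm m s \<and> closed_tm m t"
| "closed_tm m (Times s t) \<longleftrightarrow> closed_tm m s \<and> closed_tm m t"

text \<open>All free number variables are below \<open>m\<close> and all free set variables are below \<open>n\<close>.\<close>

primrec closed_fm :: "nat \<Rightarrow> nat \<Rightarrow> fm \<Rightarrow> bool" where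
  "closed_fm m n (Eq s t) \<longleftrightarrow> closed_tm m s \<and> closed_tm m t"
| "closed_fm m n (Less s t) \<longleftrightarrow> closed_tm m s \<and> closed_tm m t"
| "closed_fm m n (Mem t X) \<longleftrightarrow> closed_tm m t \<and> X < n"
| "closed_fm m n Bot \<longleftrightarrow> True"
| "closed_fm m n (Imp \<phi> \<psi>) \<longleftrightarrow> closed_fm m n \<phi> \<and> closed_fm m n \<psi>"
| "closed_fm m n (AllN \<phi>) \<longleftrightarrow> closed_fm (Suc m) n \<phi>"
| "closed_fm m n (AllS \<phi>) \<longleftrightarrow> closed_fm m (Suc n) \<phi>"

definition sentence :: "fm \<Rightarrow> bool" where "sentence = closed_fm 0 0"


section \<open>Provability\<close>

text \<open>
  Classical two-sorted natural deduction. Shifting the hypotheses in the introduction rules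
  for the quantifiers expresses the eigenvariable condition.
\<close>

inductive provable :: "fm set \<Rightarrow> fm \<Rightarrow> bool" (infix "\<turnstile>" 50) where
  Assm: "\<phi> \<in> \<Gamma> \<Longrightarrow> \<Gamma> \<turnstile> \<phi>"
| ImpI: "insert \<phi> \<Gamma> \<turnstile> \<psi> \<Longrightarrow> \<Gamma> \<turnstile> Imp \<phi> \<psi>"
| ImpE: "\<Gamma> \<turnstile> Imp \<phi> \<psi> \<Longrightarrow> \<Gamma> \<turnstile> \<phi> \<Longrightarrow> \<Gamma> \<turnstile> \<psi>"
| Contr: "insert (Neg \<phi>) \<Gamma> \<turnstile> Bot \<Longrightarrow> \<Gamma> \<turnstile> \<phi>"
| AllNI: "shiftN ` \<Gamma> \<turnstile> \<phi> \<Longrightarrow> \<Gamma> \<turnstile> AllN \<phi>"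
| AllNE: "\<Gamma> \<turnstile> AllN \<phi> \<Longrightarrow> \<Gamma> \<turnstile> instN t \<phi>"
| AllSI: "shiftS ` \<Gamma> \<turnstile> \<phi> \<Longrightarrow> \<Gamma> \<turnstile> AllS \<phi>"
| AllSE: "\<Gamma> \<turnstile> AllS \<phi> \<Longrightarrow> \<Gamma> \<turnstile> instS X \<phi>"
| EqRefl: "\<Gamma> \<turnstile> Eq t t"
| EqSubst: "\<Gamma> \<turnstile> Eq s t \<Longrightarrow> \<Gamma> \<turnstile> instN s \<phi> \<Longrightarrow> \<Gamma> \<turnstile> instN t \<phi>"


section \<open>Formulas with named bound variables\<close>

text \<open>
  To write concrete formulas with bound variables named by lambda abstraction, terms,
  set variables and formulas are presented as functions of the number of enclosing quantifiers of
  each sort (numbers first, then sets). A variable bound by the quantifier under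
  \<open>d\<close> quantifiers of its sort has index \<open>e - Suc d\<close> at a place under \<open>e\<close> of them. A
  sentence is obtained by applying such a presentation to \<open>0 0\<close>.
\<close>

type_synonym nterm = "nat \<Rightarrow> tm"
type_synonym sterm = "nat \<Rightarrow> nat"
type_synonym form = "nat \<Rightarrow> nat \<Rightarrow> fm"

definition nt_zero :: nterm ("\<^bold>0") where "\<^bold>0 = (\<lambda>d. Zero)"
definition nt_one :: nterm ("\<^bold>1") where "\<^bold>1 = (\<lambda>d. One)"
definition nt_plus :: "nterm \<Rightarrow> nterm \<Rightarrow> nterm" (infixl "\<^bold>+" 65) where
  "s \<^bold>+ t = (\<lambda>d. Plus (s d) (t d))"
definition nt_times :: "nterm \<Rightarrow> nterm \<Rightarrow> nterm" (infixl "\<^bold>*" 70) where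
  "s \<^bold>* t = (\<lambda>d. Times (s d) (t d))"

definition at_eq :: "nterm \<Rightarrow> nterm \<Rightarrow> form" (infix "\<^bold>=" 50) where
  "(s \<^bold>= t) = (\<lambda>d e. Eq (s d) (t d))"
definition at_less :: "nterm \<Rightarrow> nterm \<Rightarrow> form" (infix "\<^bold><" 50) where
  "(s \<^bold>< t) = (\<lambda>d e. Less (s d) (t d))"
definition at_mem :: "nterm \<Rightarrow> sterm \<Rightarrow> form" (infix "\<^bold>\<in>" 50) where
  "(t \<^bold>\<in> X) = (\<lambda>d e. Mem (t d) (X e))"

definition form_neg :: "form \<Rightarrow> form" ("\<^bold>\<not> _" [40] 40) where
  "(\<^bold>\<not> p) = (\<lambda>d e. Neg (p d e))"
definition form_conj :: "form \<Rightarrow> form \<Rightarrow> form" (infixr "\<^bold>\<and>" 35) where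
  "(p \<^bold>\<and> q) = (\<lambda>d e. And (p d e) (q d e))"
definition form_disj :: "form \<Rightarrow> form \<Rightarrow> form" (infixr "\<^bold>\<or>" 30) where
  "(p \<^bold>\<or> q) = (\<lambda>d e. Or (p d e) (q d e))"
definition form_imp :: "form \<Rightarrow> form \<Rightarrow> form" (infixr "\<^bold>\<longrightarrow>" 25) where
  "(p \<^bold>\<longrightarrow> q) = (\<lambda>d e. Imp (p d e) (q d e))"
definition form_iff :: "form \<Rightarrow> form \<Rightarrow> form" (infixr "\<^bold>\<longleftrightarrow>" 25) where
  "(p \<^bold>\<longleftrightarrow> q) = (\<lambda>d e. Iff (p d e) (q d e))"

definition all_num :: "(nterm \<Rightarrow> form) \<Rightarrow> form" (binder "\<^bold>\<forall>" 10) where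
  "all_num P = (\<lambda>d e. AllN (P (\<lambda>d'. Var (d' - Suc d)) (Suc d) e))"
definition ex_num :: "(nterm \<Rightarrow> form) \<Rightarrow> form" (binder "\<^bold>\<exists>" 10) where
  "ex_num P = (\<lambda>d e. ExN (P (\<lambda>d'. Var (d' - Suc d)) (Suc d) e))"
definition all_set :: "(sterm \<Rightarrow> form) \<Rightarrow> form" (binder "\<^bold>\<forall>\<^sub>S" 10) where
  "all_set P = (\<lambda>d e. AllS (P (\<lambda>e'. e' - Suc e) d (Suc e)))"
definition ex_set :: "(sterm \<Rightarrow> form) \<Rightarrow> form" (binder "\<^bold>\<exists>\<^sub>S" 10) where
  "ex_set P = (\<lambda>d e. ExS (P (\<lambda>e'. e' - Suc e) d (Suc e)))"


section \<open>The axioms of \<open>RCA\<^sub>0\<close>\<close>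

definition basic_axioms :: "form set" where
  "basic_axioms =
    {\<^bold>\<forall>n. \<^bold>\<not> n \<^bold>+ \<^bold>1 \<^bold>= \<^bold>0,
     \<^bold>\<forall>m. \<^bold>\<forall>n. m \<^bold>+ \<^bold>1 \<^bold>= n \<^bold>+ \<^bold>1 \<^bold>\<longrightarrow> m \<^bold>= n,
     \<^bold>\<forall>m. m \<^bold>+ \<^bold>0 \<^bold>= m,
     \<^bold>\<forall>m. \<^bold>\<forall>n. m \<^bold>+ (n \<^bold>+ \<^bold>1) \<^bold>= (m \<^bold>+ n) \<^bold>+ \<^bold>1,
     \<^bold>\<forall>m. m \<^bold>* \<^bold>0 \<^bold>= \<^bold>0,
     \<^bold>\<forall>m. \<^bold>\<forall>n. m \<^bold>* (n \<^bold>+ \<^bold>1) \<^bold>= m \<^bold>* n \<^bold>+ m,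
     \<^bold>\<forall>m. \<^bold>\<not> m \<^bold>< \<^bold>0,
     \<^bold>\<forall>m. \<^bold>\<forall>n. m \<^bold>< n \<^bold>+ \<^bold>1 \<^bold>\<longleftrightarrow> m \<^bold>< n \<^bold>\<or> m \<^bold>= n}"

text \<open>The bound of a bounded quantifier does not contain the quantified variable, hence the shift.\<close>

inductive Delta0 :: "fm \<Rightarrow> bool" where
  "Delta0 (Eq s t)"
| "Delta0 (Less s t)"
| "Delta0 (Mem t X)"
| "Delta0 Bot"
| "Delta0 \<phi> \<Longrightarrow> Delta0 \<psi> \<Longrightarrow> Delta0 (Imp \<phi> \<psi>)"
| "Delta0 \<phi> \<Longrightarrow> Delta0 (AllN (Imp (Less (Var 0) (shift_tm t)) \<phi>))"
| "Delta0 \<phi> \<Longrightarrow> Delta0 (ExN (And (Less (Var 0) (shift_tm t)) \<phi>))"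

definition Sigma1 :: "fm \<Rightarrow> bool" where "Sigma1 \<phi> \<longleftrightarrow> (\<exists>\<theta>. Delta0 \<theta> \<and> \<phi> = ExN \<theta>)"
definition Pi1 :: "fm \<Rightarrow> bool" where "Pi1 \<phi> \<longleftrightarrow> (\<exists>\<theta>. Delta0 \<theta> \<and> \<phi> = AllN \<theta>)"

text \<open>In the two schemes \<open>n\<close> is the number variable \<open>0\<close>; the other free variables are parameters.\<close>

definition induction_axiom :: "fm \<Rightarrow> fm" where
  "induction_axiom \<phi> =
    Imp (And (instN Zero \<phi>)
             (AllN (Imp \<phi> (subst (case_nat (Plus (Var 0) One) (\<lambda>n. Var (Suc n))) (\<lambda>X. X) \<phi>))))
        (AllN \<phi>)"

definition comprehension_axiom :: "fm \<Rightarrow> fm \<Rightarrow> fm" where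
  "comprehension_axiom \<phi> \<psi> =
    Imp (AllN (Iff \<phi> \<psi>)) (ExS (AllN (Iff (Mem (Var 0) 0) (shiftS \<phi>))))"

definition universal_closures :: "fm \<Rightarrow> fm set" where
  "universal_closures \<phi> = {\<psi>. sentence \<psi> \<and> (\<exists>m n. \<psi> = (AllN ^^ m) ((AllS ^^ n) \<phi>))}"

definition RCA0 :: "fm set" where
  "RCA0 =
    (\<lambda>p. p 0 0) ` basic_axioms \<union>
    (\<Union>\<phi> \<in> Collect Sigma1. universal_closures (induction_axiom \<phi>)) \<union>
    (\<Union>\<phi> \<in> Collect Sigma1. \<Union>\<psi> \<in> Collect Pi1. universal_closures (comprehension_axiom \<phi> \<psi>))"


section \<open>Coding\<close>

definition leq :: "nterm \<Rightarrow> nterm \<Rightarrow> form" (infix "\<^bold>\<le>" 50) where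
  "(s \<^bold>\<le> t) = (s \<^bold>< t \<^bold>\<or> s \<^bold>= t)"

definition ex1_num :: "(nterm \<Rightarrow> form) \<Rightarrow> form" (binder "\<^bold>\<exists>!" 10) where
  "ex1_num P = (\<^bold>\<exists>y. P y \<^bold>\<and> (\<^bold>\<forall>z. P z \<^bold>\<longrightarrow> z \<^bold>= y))"

definition pair :: "nterm \<Rightarrow> nterm \<Rightarrow> nterm" where
  "pair x y = (x \<^bold>+ y) \<^bold>* (x \<^bold>+ y) \<^bold>+ x"

text \<open>\<open>F\<close> is (the graph of) a function from \<open>A\<close> to \<open>B\<close>, and \<open>F\<close> takes the value \<open>y\<close> at \<open>x\<close>.\<close>

definition is_fun :: "sterm \<Rightarrow> (nterm \<Rightarrow> form) \<Rightarrow> (nterm \<Rightarrow> form) \<Rightarrow> form" where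
  "is_fun F A B =
    ((\<^bold>\<forall>w. w \<^bold>\<in> F \<^bold>\<longrightarrow> (\<^bold>\<exists>x. \<^bold>\<exists>y. w \<^bold>= pair x y \<^bold>\<and> A x \<^bold>\<and> B y)) \<^bold>\<and>
     (\<^bold>\<forall>x. A x \<^bold>\<longrightarrow> (\<^bold>\<exists>!y. pair x y \<^bold>\<in> F)))"

definition val :: "sterm \<Rightarrow> nterm \<Rightarrow> nterm \<Rightarrow> form" where
  "val F x y = (pair x y \<^bold>\<in> F)"

definition nats :: "nterm \<Rightarrow> form" where "nats x = (x \<^bold>= x)"
definition below :: "nterm \<Rightarrow> nterm \<Rightarrow> form" where "below k x = (x \<^bold>< k)"
definition pairs :: "nterm \<Rightarrow> form" where
  "pairs w = (\<^bold>\<exists>x. \<^bold>\<exists>y. x \<^bold>< y \<^bold>\<and> w \<^bold>= pair x y)"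

definition infinite_set :: "sterm \<Rightarrow> form" where
  "infinite_set X = (\<^bold>\<forall>m. \<^bold>\<exists>n. m \<^bold>< n \<^bold>\<and> n \<^bold>\<in> X)"

text \<open>\<open>y = 2 ^ x\<close>, with exponentiation given by primitive recursion.\<close>

definition is_pow2 :: "nterm \<Rightarrow> nterm \<Rightarrow> form" where
  "is_pow2 x y =
    (\<^bold>\<exists>\<^sub>SP. is_fun P nats nats \<^bold>\<and> val P \<^bold>0 \<^bold>1 \<^bold>\<and>
      (\<^bold>\<forall>i. \<^bold>\<forall>z. val P i z \<^bold>\<longrightarrow> val P (i \<^bold>+ \<^bold>1) (z \<^bold>+ z)) \<^bold>\<and> val P x y)"

text \<open>\<open>y = g i + g (i + 1) + \<dots> + g (j - 1)\<close>, where \<open>i \<le> j\<close>; \<open>S\<close> lists the partial sums.\<close>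

definition is_sum :: "sterm \<Rightarrow> nterm \<Rightarrow> nterm \<Rightarrow> nterm \<Rightarrow> form" where
  "is_sum g i j y =
    (i \<^bold>\<le> j \<^bold>\<and>
     (\<^bold>\<exists>\<^sub>SS. is_fun S nats nats \<^bold>\<and> val S i \<^bold>0 \<^bold>\<and>
       (\<^bold>\<forall>l. \<^bold>\<forall>u. \<^bold>\<forall>v. i \<^bold>\<le> l \<^bold>\<and> l \<^bold>< j \<^bold>\<and> val S l u \<^bold>\<and> val g l v \<^bold>\<longrightarrow> val S (l \<^bold>+ \<^bold>1) (u \<^bold>+ v)) \<^bold>\<and>
       val S j y))"

text \<open>\<open>n = 2 ^ t 0 + \<dots> + 2 ^ t (p - 1)\<close> with \<open>t 0 < \<dots> < t (p - 1)\<close>.\<close>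

definition binary_expansion :: "nterm \<Rightarrow> nterm \<Rightarrow> sterm \<Rightarrow> form" where
  "binary_expansion n p t =
    (is_fun t nats nats \<^bold>\<and>
     (\<^bold>\<forall>i. \<^bold>\<forall>j. \<^bold>\<forall>a. \<^bold>\<forall>b. i \<^bold>< j \<^bold>\<and> j \<^bold>< p \<^bold>\<and> val t i a \<^bold>\<and> val t j b \<^bold>\<longrightarrow> a \<^bold>< b) \<^bold>\<and>
     (\<^bold>\<exists>\<^sub>Sg. is_fun g nats nats \<^bold>\<and>
       (\<^bold>\<forall>i. \<^bold>\<forall>a. \<^bold>\<forall>b. i \<^bold>< p \<^bold>\<and> val t i a \<^bold>\<and> val g i b \<^bold>\<longrightarrow> is_pow2 a b) \<^bold>\<and>
       is_sum g \<^bold>0 p n))"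

definition is_lambda :: "nterm \<Rightarrow> nterm \<Rightarrow> form" where
  "is_lambda n a = (\<^bold>\<exists>p. \<^bold>\<exists>\<^sub>St. binary_expansion n (p \<^bold>+ \<^bold>1) t \<^bold>\<and> val t \<^bold>0 a)"

definition is_mu :: "nterm \<Rightarrow> nterm \<Rightarrow> form" where
  "is_mu n b = (\<^bold>\<exists>p. \<^bold>\<exists>\<^sub>St. binary_expansion n (p \<^bold>+ \<^bold>1) t \<^bold>\<and> val t p b)"

definition apartness :: "sterm \<Rightarrow> form" where
  "apartness X =
    (\<^bold>\<forall>x. \<^bold>\<forall>x'. x \<^bold>\<in> X \<^bold>\<and> x' \<^bold>\<in> X \<^bold>\<and> x \<^bold>< x' \<^bold>\<longrightarrow>
      (\<^bold>\<exists>b. \<^bold>\<exists>a. is_mu x b \<^bold>\<and> is_lambda x' a \<^bold>\<and> b \<^bold>< a))"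

text \<open>\<open>h\<close> enumerates \<open>H\<close> in increasing order, starting from the index \<open>0\<close>.\<close>

definition enumerates :: "sterm \<Rightarrow> sterm \<Rightarrow> form" where
  "enumerates h H =
    (is_fun h nats nats \<^bold>\<and>
     (\<^bold>\<forall>i. \<^bold>\<forall>j. \<^bold>\<forall>a. \<^bold>\<forall>b. i \<^bold>< j \<^bold>\<and> val h i a \<^bold>\<and> val h j b \<^bold>\<longrightarrow> a \<^bold>< b) \<^bold>\<and>
     (\<^bold>\<forall>x. x \<^bold>\<in> H \<^bold>\<longleftrightarrow> (\<^bold>\<exists>i. val h i x)))"

definition in_AS :: "nterm \<Rightarrow> sterm \<Rightarrow> form" where
  "in_AS y H =
    (\<^bold>\<exists>\<^sub>Sh. enumerates h H \<^bold>\<and> (\<^bold>\<exists>i. \<^bold>\<exists>j. i \<^bold>\<le> j \<^bold>\<and> is_sum h i (j \<^bold>+ \<^bold>1) y))"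


section \<open>The principles\<close>

definition AHT_k :: "nterm \<Rightarrow> form" where
  "AHT_k k =
    (\<^bold>\<forall>\<^sub>Sc. is_fun c nats (below k) \<^bold>\<longrightarrow>
      (\<^bold>\<exists>\<^sub>SH. infinite_set H \<^bold>\<and> (\<^bold>\<forall>x. x \<^bold>\<in> H \<^bold>\<longrightarrow> \<^bold>0 \<^bold>< x) \<^bold>\<and> apartness H \<^bold>\<and>
        (\<^bold>\<exists>d. d \<^bold>< k \<^bold>\<and> (\<^bold>\<forall>y. in_AS y H \<^bold>\<longrightarrow> val c y d))))"

definition AHT :: fm where "AHT = (\<^bold>\<forall>k. AHT_k k) 0 0"

definition stable :: "sterm \<Rightarrow> nterm \<Rightarrow> form" where
  "stable f k =
    (\<^bold>\<forall>x. \<^bold>\<exists>d. d \<^bold>< k \<^bold>\<and> (\<^bold>\<exists>t. x \<^bold>< t \<^bold>\<and> (\<^bold>\<forall>s. t \<^bold>\<le> s \<^bold>\<longrightarrow> val f (pair x s) d)))"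

definition SRT2_k :: "nterm \<Rightarrow> form" where
  "SRT2_k k =
    (\<^bold>\<forall>\<^sub>Sf. is_fun f pairs (below k) \<^bold>\<and> stable f k \<^bold>\<longrightarrow>
      (\<^bold>\<exists>\<^sub>SJ. infinite_set J \<^bold>\<and>
        (\<^bold>\<exists>d. d \<^bold>< k \<^bold>\<and>
          (\<^bold>\<forall>x. \<^bold>\<forall>y. x \<^bold>\<in> J \<^bold>\<and> y \<^bold>\<in> J \<^bold>\<and> x \<^bold>< y \<^bold>\<longrightarrow> val f (pair x y) d))))"

definition SRT2 :: fm where "SRT2 = (\<^bold>\<forall>k. SRT2_k k) 0 0"

end

(*
  The deduction system is complete for Henkin models, so the theorem is proved by reasoning in an
  arbitrary, possibly nonstandard, model of RCA_0 that satisfies AHT.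

  Given f on pairs, colour n by f(lambda n, mu n). For elements h_0 < h_1 < ... of an apart set,
  lambda(h_i + ... + h_j) = lambda h_i and mu(h_i + ... + h_j) = mu h_j; hence AHT yields
  a_0 <= b_0 < a_1 <= b_1 < ... with f(a_i, b_j) = d for all i <= j, and by stability every a_i has
  limit colour d. Choosing a homogeneous subsequence of (a_i) requires, for each n, one bound beyond
  which all limits of the a_i <= n are attained. This instance of Sigma_2 bounding is not available in
  RCA_0; it follows from a second application of AHT, to a colouring of n that depends on lambda n only
  and hence gives the infinite pigeonhole principle.
*)

theory Submission
  imports Defs "HOL-Library.Countable"
begin

section \<open>Logic: completeness of the calculus for Henkin semantics\<close>

section \<open>Substitution\<close>

text \<open>Elements of the model may be nonstandard, so HOL recursion and HOL induction do not
  apply to them. Only Sigma_1 predicates admit induction and only Delta_1 predicates define sets;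
  hence every construction in the model is accompanied by a \<open>d1\<close> or \<open>dt\<close>
  fact, and even powers of two must wait for primitive recursion, which is extracted from Goedel's
  coding.

  The first use of AHT controls the pairs (a_i, b_j) and says nothing about (a_i, a_j), so no
  homogeneous set can be read off from it. Stability closes the gap: the b_j are unbounded, so the
  limit colour at a_i has to be d.

  In the second use the colours are the elements up to n, where n is an element of the model and may
  be nonstandard. This is where AHT enters as one sentence quantifying over all k inside the theory,
  and not as a scheme for standard k.\<close>

abbreviation liftN :: "(nat \<Rightarrow> tm) \<Rightarrow> nat \<Rightarrow> tm" where
  "liftN \<sigma> \<equiv> case_nat (Var 0) (\<lambda>n. shift_tm (\<sigma> n))"

abbreviation liftS :: "(nat \<Rightarrow> nat) \<Rightarrow> nat \<Rightarrow> nat" where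
  "liftS \<rho> \<equiv> case_nat 0 (\<lambda>n. Suc (\<rho> n))"

lemma subst_tm_subst_tm: "subst_tm \<sigma> (subst_tm \<tau> t) = subst_tm (\<lambda>n. subst_tm \<sigma> (\<tau> n)) t"
  by (induction t) auto

lemma subst_tm_Var [simp]: "subst_tm Var t = t"
  by (induction t) auto

lemma shift_tm_Var [simp]: "shift_tm (Var n) = Var (Suc n)"
  by (simp add: shift_tm_def)

lemma liftN_Var [simp]: "case_nat (Var 0) (\<lambda>n. Var (Suc n)) = Var"
  by (rule ext) (simp split: nat.split)

lemma liftS_id [simp]: "liftS (\<lambda>X. X) = (\<lambda>X. X)"
  by (rule ext) (simp split: nat.split)

lemma subst_Var [simp]: "subst Var (\<lambda>X. X) \<phi> = \<phi>"
  by (induction \<phi>) auto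

lemma subst_tm_liftN_shift: "subst_tm (liftN \<sigma>) (shift_tm t) = shift_tm (subst_tm \<sigma> t)"
  by (simp add: shift_tm_def subst_tm_subst_tm)

lemma subst_subst:
  "subst \<sigma> \<rho> (subst \<tau> \<pi> \<phi>) = subst (\<lambda>n. subst_tm \<sigma> (\<tau> n)) (\<lambda>X. \<rho> (\<pi> X)) \<phi>"
proof (induction \<phi> arbitrary: \<sigma> \<rho> \<tau> \<pi>)
  case (AllN \<phi>)
  have "(\<lambda>n. subst_tm (liftN \<sigma>) (liftN \<tau> n)) = liftN (\<lambda>n. subst_tm \<sigma> (\<tau> n))"
    by (rule ext) (simp add: subst_tm_liftN_shift split: nat.split)
  then show ?case by (simp add: AllN.IH)
next
  case (AllS \<phi>)
  have "(\<lambda>X. liftS \<rho> (liftS \<pi> X)) = liftS (\<lambda>X. \<rho> (\<pi> X))"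
    by (rule ext) (simp split: nat.split)
  then show ?case by (simp add: AllS.IH)
qed (simp_all add: subst_tm_subst_tm)

lemma subst_Neg [simp]: "subst \<sigma> \<rho> (Neg \<phi>) = Neg (subst \<sigma> \<rho> \<phi>)"
  by (simp add: Neg_def)

lemma subst_tm_inst_shift: "subst_tm (case_nat t \<sigma>) (shift_tm s) = subst_tm \<sigma> s"
  by (simp add: shift_tm_def subst_tm_subst_tm)

text \<open>Serves the quantifier case of \<open>truth\<close>: the value of the bound variable is
  given by a term there, and it is absorbed into the substitution that encodes the
  assignment.\<close>

lemma instN_subst_liftN: "instN t (subst (liftN \<sigma>) \<rho> \<phi>) = subst (case_nat t \<sigma>) \<rho> \<phi>"
proof -
  have "(\<lambda>n. subst_tm (case_nat t Var) (liftN \<sigma> n)) = case_nat t \<sigma>"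
    by (rule ext) (simp add: subst_tm_inst_shift split: nat.split)
  then show ?thesis by (simp add: instN_def subst_subst)
qed

lemma instS_subst_liftS: "instS X (subst \<sigma> (liftS \<rho>) \<phi>) = subst \<sigma> (case_nat X \<rho>) \<phi>"
proof -
  have "(\<lambda>n. case_nat X (\<lambda>Y. Y) (liftS \<rho> n)) = case_nat X \<rho>"
    by (rule ext) (simp split: nat.split)
  then show ?thesis by (simp add: instS_def subst_subst)
qed

lemma subst_instN:
  "subst \<sigma> \<rho> (instN t \<phi>) = instN (subst_tm \<sigma> t) (subst (liftN \<sigma>) \<rho> \<phi>)"
proof -
  have "(\<lambda>n. subst_tm \<sigma> (case_nat t Var n)) = case_nat (subst_tm \<sigma> t) \<sigma>"
    by (rule ext) (simp split: nat.split)
  then show ?thesis by (simp add: instN_subst_liftN) (simp add: instN_def subst_subst)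
qed

lemma subst_instS: "subst \<sigma> \<rho> (instS X \<phi>) = instS (\<rho> X) (subst \<sigma> (liftS \<rho>) \<phi>)"
proof -
  have "(\<lambda>n. \<rho> (case_nat X (\<lambda>Y. Y) n)) = case_nat (\<rho> X) \<rho>"
    by (rule ext) (simp split: nat.split)
  then show ?thesis by (simp add: instS_subst_liftS) (simp add: instS_def subst_subst)
qed

lemma subst_shiftN: "subst (liftN \<sigma>) \<rho> (shiftN \<phi>) = shiftN (subst \<sigma> \<rho> \<phi>)"
  by (simp add: shiftN_def subst_subst flip: shift_tm_def)

lemma subst_shiftS: "subst \<sigma> (liftS \<rho>) (shiftS \<phi>) = shiftS (subst \<sigma> \<rho> \<phi>)"
  by (simp add: shiftS_def subst_subst)

section \<open>Bounds on free variables\<close>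

lemma subst_tm_cong: "closed_tm m t \<Longrightarrow> (\<And>i. i < m \<Longrightarrow> \<sigma> i = \<tau> i) \<Longrightarrow> subst_tm \<sigma> t = subst_tm \<tau> t"
  by (induction t) auto

lemma subst_cong:
  "closed_fm m n \<phi> \<Longrightarrow> (\<And>i. i < m \<Longrightarrow> \<sigma> i = \<tau> i) \<Longrightarrow> (\<And>i. i < n \<Longrightarrow> \<rho> i = \<pi> i)
    \<Longrightarrow> subst \<sigma> \<rho> \<phi> = subst \<tau> \<pi> \<phi>"
proof (induction \<phi> arbitrary: m n \<sigma> \<tau> \<rho> \<pi>)
  case (Imp \<phi> \<psi>)
  then show ?case by (metis closed_fm.simps(5) subst.simps(5))
next
  case (AllN \<phi>)
  have "subst (liftN \<sigma>) \<rho> \<phi> = subst (liftN \<tau>) \<pi> \<phi>"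
    using AllN.prems by (intro AllN.IH[of "Suc m" n]) (auto split: nat.split)
  then show ?case by simp
next
  case (AllS \<phi>)
  have "subst \<sigma> (liftS \<rho>) \<phi> = subst \<tau> (liftS \<pi>) \<phi>"
    using AllS.prems by (intro AllS.IH[of m "Suc n"]) (auto split: nat.split)
  then show ?case by simp
qed (auto intro: subst_tm_cong)

lemma closed_tm_mono: "closed_tm m t \<Longrightarrow> m \<le> m' \<Longrightarrow> closed_tm m' t"
  by (induction t) auto

lemma closed_fm_mono: "closed_fm m n \<phi> \<Longrightarrow> m \<le> m' \<Longrightarrow> n \<le> n' \<Longrightarrow> closed_fm m' n' \<phi>"
proof (induction \<phi> arbitrary: m n m' n')
  case (Imp \<phi> \<psi>)
  then show ?case by (metis closed_fm.simps(5))
next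
  case (AllN \<phi>)
  then show ?case by (metis closed_fm.simps(6) Suc_le_mono)
next
  case (AllS \<phi>)
  then show ?case by (metis closed_fm.simps(7) Suc_le_mono)
qed (auto intro: closed_tm_mono)

lemma closed_tm_bound: "\<exists>m. closed_tm m t"
proof (induction t)
  case (Plus s t)
  then show ?case by (metis closed_tm.simps(4) closed_tm_mono nat_le_linear)
next
  case (Times s t)
  then show ?case by (metis closed_tm.simps(5) closed_tm_mono nat_le_linear)
qed auto

lemma closed_tm_bound2: "\<exists>m. closed_tm m s \<and> closed_tm m t"
  using closed_tm_bound[of "Plus s t"] by simp

lemma closed_fm_bound: "\<exists>m n. closed_fm m n \<phi>"
proof (induction \<phi>)
  case (Mem t X)
  then show ?case using closed_tm_bound[of t] by auto
next
  case (Imp \<phi> \<psi>)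
  then obtain m n m' n' where "closed_fm m n \<phi>" "closed_fm m' n' \<psi>" by blast
  then have "closed_fm (max m m') (max n n') (Imp \<phi> \<psi>)"
    by (auto intro: closed_fm_mono)
  then show ?case by blast
next
  case (AllN \<phi>)
  then obtain m n where "closed_fm m n \<phi>" by blast
  then have "closed_fm m n (AllN \<phi>)" by (auto intro: closed_fm_mono)
  then show ?case by blast
next
  case (AllS \<phi>)
  then obtain m n where "closed_fm m n \<phi>" by blast
  then have "closed_fm m n (AllS \<phi>)" by (auto intro: closed_fm_mono)
  then show ?case by blast
qed (auto simp: closed_tm_bound2)

section \<open>Structural properties of provability\<close>

lemma provable_weaken: "\<Gamma> \<turnstile> \<phi> \<Longrightarrow> \<Gamma> \<subseteq> \<Delta> \<Longrightarrow> \<Delta> \<turnstile> \<phi>"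
proof (induction arbitrary: \<Delta> rule: provable.induct)
  case (AllNI \<Gamma> \<phi>)
  then show ?case by (meson image_mono provable.AllNI)
next
  case (AllSI \<Gamma> \<phi>)
  then show ?case by (meson image_mono provable.AllSI)
qed (meson provable.intros insert_mono subsetD)+

lemma provable_subst: "\<Gamma> \<turnstile> \<phi> \<Longrightarrow> subst \<sigma> \<rho> ` \<Gamma> \<turnstile> subst \<sigma> \<rho> \<phi>"
proof (induction arbitrary: \<sigma> \<rho> rule: provable.induct)
  case (AllNI \<Gamma> \<phi>)
  have "subst (liftN \<sigma>) \<rho> ` shiftN ` \<Gamma> = shiftN ` subst \<sigma> \<rho> ` \<Gamma>"
    by (simp add: image_image subst_shiftN)
  then show ?case using AllNI.IH[of "liftN \<sigma>" \<rho>] by (simp add: provable.AllNI)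
next
  case (AllSI \<Gamma> \<phi>)
  have "subst \<sigma> (liftS \<rho>) ` shiftS ` \<Gamma> = shiftS ` subst \<sigma> \<rho> ` \<Gamma>"
    by (simp add: image_image subst_shiftS)
  then show ?case using AllSI.IH[of \<sigma> "liftS \<rho>"] by (simp add: provable.AllSI)
next
  case (AllNE \<Gamma> \<phi> t)
  then show ?case by (simp add: subst_instN provable.AllNE)
next
  case (AllSE \<Gamma> \<phi> X)
  then show ?case by (simp add: subst_instS provable.AllSE)
next
  case (EqSubst \<Gamma> s t \<phi>)
  then show ?case by (metis provable.EqSubst subst.simps(1) subst_instN)
next
  case (Contr \<phi> \<Gamma>)
  then show ?case by (simp add: provable.Contr)
next
  case (ImpI \<phi> \<Gamma> \<psi>)
  then show ?case by (simp add: provable.ImpI)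
next
  case (ImpE \<Gamma> \<phi> \<psi>)
  then show ?case by (metis provable.ImpE subst.simps(5))
qed (simp_all add: provable.Assm provable.EqRefl)

text \<open>Compactness, which keeps the union of the chain in \<open>henkin_extension\<close>
  consistent.\<close>

lemma provable_finite: "\<Gamma> \<turnstile> \<phi> \<Longrightarrow> \<exists>\<Delta> \<subseteq> \<Gamma>. finite \<Delta> \<and> \<Delta> \<turnstile> \<phi>"
proof (induction rule: provable.induct)
  case (Assm \<phi> \<Gamma>)
  then have "{\<phi>} \<subseteq> \<Gamma> \<and> finite {\<phi>} \<and> {\<phi>} \<turnstile> \<phi>" by (simp add: provable.Assm)
  then show ?case by blast
next
  case (ImpI \<phi> \<Gamma> \<psi>)
  then obtain \<Delta> where "\<Delta> \<subseteq> insert \<phi> \<Gamma>" "finite \<Delta>" "\<Delta> \<turnstile> \<psi>" by blast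
  then have "\<Delta> - {\<phi>} \<subseteq> \<Gamma> \<and> finite (\<Delta> - {\<phi>}) \<and> \<Delta> - {\<phi>} \<turnstile> Imp \<phi> \<psi>"
    using provable_weaken[of \<Delta> \<psi> "insert \<phi> (\<Delta> - {\<phi>})"] by (blast intro: provable.ImpI)
  then show ?case by blast
next
  case (Contr \<phi> \<Gamma>)
  then obtain \<Delta> where "\<Delta> \<subseteq> insert (Neg \<phi>) \<Gamma>" "finite \<Delta>" "\<Delta> \<turnstile> Bot" by blast
  then have "\<Delta> - {Neg \<phi>} \<subseteq> \<Gamma> \<and> finite (\<Delta> - {Neg \<phi>}) \<and> \<Delta> - {Neg \<phi>} \<turnstile> \<phi>"
    using provable_weaken[of \<Delta> Bot "insert (Neg \<phi>) (\<Delta> - {Neg \<phi>})"]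
    by (blast intro: provable.Contr)
  then show ?case by blast
next
  case (ImpE \<Gamma> \<phi> \<psi>)
  then obtain \<Delta> \<Delta>' where "\<Delta> \<subseteq> \<Gamma>" "finite \<Delta>" "\<Delta> \<turnstile> Imp \<phi> \<psi>" "\<Delta>' \<subseteq> \<Gamma>" "finite \<Delta>'" "\<Delta>' \<turnstile> \<phi>"
    by blast
  then have "\<Delta> \<union> \<Delta>' \<subseteq> \<Gamma> \<and> finite (\<Delta> \<union> \<Delta>') \<and> \<Delta> \<union> \<Delta>' \<turnstile> \<psi>"
    by (meson Un_least Un_upper1 Un_upper2 finite_UnI provable.ImpE provable_weaken)
  then show ?case by blast
next
  case (EqSubst \<Gamma> s t \<phi>)
  then obtain \<Delta> \<Delta>' where "\<Delta> \<subseteq> \<Gamma>" "finite \<Delta>" "\<Delta> \<turnstile> Eq s t" "\<Delta>' \<subseteq> \<Gamma>" "finite \<Delta>'" "\<Delta>' \<turnstile> instN s \<phi>"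
    by blast
  then have "\<Delta> \<union> \<Delta>' \<subseteq> \<Gamma> \<and> finite (\<Delta> \<union> \<Delta>') \<and> \<Delta> \<union> \<Delta>' \<turnstile> instN t \<phi>"
    by (meson Un_least Un_upper1 Un_upper2 finite_UnI provable.EqSubst provable_weaken)
  then show ?case by blast
next
  case (AllNI \<Gamma> \<phi>)
  then obtain \<Delta> where "\<Delta> \<subseteq> shiftN ` \<Gamma>" "finite \<Delta>" "\<Delta> \<turnstile> \<phi>" by blast
  then show ?case by (metis finite_subset_image provable.AllNI)
next
  case (AllSI \<Gamma> \<phi>)
  then obtain \<Delta> where "\<Delta> \<subseteq> shiftS ` \<Gamma>" "finite \<Delta>" "\<Delta> \<turnstile> \<phi>" by blast
  then show ?case by (metis finite_subset_image provable.AllSI)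
next
  case (EqRefl \<Gamma> t)
  then show ?case by (metis empty_subsetI finite.emptyI provable.EqRefl)
qed (meson provable.AllNE provable.AllSE)+

text \<open>Variable k is fresh for the hypotheses. Renaming it to 0 and every other variable to its
  successor acts on the hypotheses exactly as \<open>shiftN\<close> does, and it undoes the
  instantiation of \<open>\<psi>\<close>; the renamed derivation is a premise of
  \<open>AllNI\<close>.\<close>

lemma provable_generalizeN:
  assumes "\<And>\<gamma>. \<gamma> \<in> \<Gamma> \<Longrightarrow> closed_fm k l \<gamma>" and \<psi>: "closed_fm (Suc k) l \<psi>"
    and "\<Gamma> \<turnstile> instN (Var k) \<psi>"
  shows "\<Gamma> \<turnstile> AllN \<psi>"
proof -
  define \<sigma> where "\<sigma> i = (if i = k then Var 0 else Var (Suc i))" for i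
  have "subst \<sigma> (\<lambda>X. X) \<gamma> = shiftN \<gamma>" if "\<gamma> \<in> \<Gamma>" for \<gamma>
    unfolding shiftN_def using assms(1)[OF that] by (rule subst_cong) (auto simp: \<sigma>_def)
  then have "subst \<sigma> (\<lambda>X. X) ` \<Gamma> = shiftN ` \<Gamma>" by auto
  moreover have "subst \<sigma> (\<lambda>X. X) (instN (Var k) \<psi>) = subst Var (\<lambda>X. X) \<psi>"
    unfolding instN_def subst_subst using \<psi>
    by (rule subst_cong) (auto simp: \<sigma>_def split: nat.split)
  ultimately show ?thesis
    using provable_subst[OF assms(3), of \<sigma> "\<lambda>X. X"] by (simp add: provable.AllNI)
qed

lemma provable_generalizeS:
  assumes "\<And>\<gamma>. \<gamma> \<in> \<Gamma> \<Longrightarrow> closed_fm k l \<gamma>" and \<psi>: "closed_fm k (Suc l) \<psi>"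
    and "\<Gamma> \<turnstile> instS l \<psi>"
  shows "\<Gamma> \<turnstile> AllS \<psi>"
proof -
  define \<rho> where "\<rho> i = (if i = l then 0 else Suc i)" for i
  have "subst Var \<rho> \<gamma> = shiftS \<gamma>" if "\<gamma> \<in> \<Gamma>" for \<gamma>
    unfolding shiftS_def using assms(1)[OF that] by (rule subst_cong) (auto simp: \<rho>_def)
  then have "subst Var \<rho> ` \<Gamma> = shiftS ` \<Gamma>" by auto
  moreover have "subst Var \<rho> (instS l \<psi>) = subst Var (\<lambda>X. X) \<psi>"
    unfolding instS_def subst_subst using \<psi>
    by (rule subst_cong) (auto simp: \<rho>_def split: nat.split)
  ultimately show ?thesis
    using provable_subst[OF assms(3), of Var \<rho>] by (simp add: provable.AllSI)
qed

section \<open>Henkin theories\<close>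

text \<open>Countability of formulas allows them to be decided one after another; countability of
  terms later provides a name for every element of the model (\<open>number_of\<close>).\<close>

instance tm :: countable by countable_datatype
instance fm :: countable by countable_datatype

definition consistent :: "fm set \<Rightarrow> bool" where "consistent \<Gamma> \<longleftrightarrow> \<not> \<Gamma> \<turnstile> Bot"

text \<open>A refuted universal formula must have a counterexample among the terms or set variables
  of the language itself; no Henkin constants are added.\<close>

definition decides :: "fm set \<Rightarrow> fm \<Rightarrow> bool" where
  "decides \<Gamma> \<phi> \<longleftrightarrow> \<phi> \<in> \<Gamma> \<or> (Neg \<phi> \<in> \<Gamma> \<and>
    (\<forall>\<psi>. \<phi> = AllN \<psi> \<longrightarrow> (\<exists>t. Neg (instN t \<psi>) \<in> \<Gamma>)) \<and>
    (\<forall>\<psi>. \<phi> = AllS \<psi> \<longrightarrow> (\<exists>X. Neg (instS X \<psi>) \<in> \<Gamma>)))"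

definition henkin :: "fm set \<Rightarrow> bool" where
  "henkin \<Gamma> \<longleftrightarrow> consistent \<Gamma> \<and> (\<forall>\<phi>. decides \<Gamma> \<phi>)"

text \<open>Guarantees that a fresh variable is left to act as the next Henkin witness. It holds for
  each stage of the extension, not for its union.\<close>

definition bounded_vars :: "fm set \<Rightarrow> bool" where
  "bounded_vars \<Gamma> \<longleftrightarrow> (\<exists>m n. \<forall>\<phi> \<in> \<Gamma>. closed_fm m n \<phi>)"

lemma decides_mono: "decides \<Gamma> \<phi> \<Longrightarrow> \<Gamma> \<subseteq> \<Delta> \<Longrightarrow> decides \<Delta> \<phi>"
  unfolding decides_def by blast

lemma bounded_vars_insert:
  assumes "bounded_vars \<Gamma>" shows "bounded_vars (insert \<phi> \<Gamma>)"
proof -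
  obtain m n m' n' where "\<forall>\<psi> \<in> \<Gamma>. closed_fm m n \<psi>" "closed_fm m' n' \<phi>"
    using assms closed_fm_bound unfolding bounded_vars_def by blast
  then have "\<forall>\<psi> \<in> insert \<phi> \<Gamma>. closed_fm (max m m') (max n n') \<psi>"
    by (auto intro: closed_fm_mono)
  then show ?thesis unfolding bounded_vars_def by blast
qed

lemma consistent_insert_Neg: "\<not> \<Gamma> \<turnstile> \<phi> \<Longrightarrow> consistent (insert (Neg \<phi>) \<Gamma>)"
  unfolding consistent_def using provable.Contr by blast

text \<open>If \<open>\<phi>\<close> cannot be added, its negation can. For a universal
  \<open>\<phi>\<close> the negated instance at a fresh variable can be added too: otherwise that
  instance would be derivable, and generalizing it would derive \<open>\<phi>\<close>.\<close>

lemma decides_extension: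
  assumes "bounded_vars \<Gamma>" "consistent \<Gamma>"
  shows "\<exists>\<Delta>. \<Gamma> \<subseteq> \<Delta> \<and> bounded_vars \<Delta> \<and> consistent \<Delta> \<and> decides \<Delta> \<phi>"
proof (cases "consistent (insert \<phi> \<Gamma>)")
  case True
  then show ?thesis
    using assms by (intro exI[of _ "insert \<phi> \<Gamma>"]) (auto simp: bounded_vars_insert decides_def)
next
  case False
  let ?\<Gamma> = "insert (Neg \<phi>) \<Gamma>"
  have Neg: "\<Gamma> \<turnstile> Neg \<phi>"
    using False by (simp add: Neg_def consistent_def provable.ImpI)
  have unprovable: "\<not> ?\<Gamma> \<turnstile> \<phi>"
  proof
    assume "?\<Gamma> \<turnstile> \<phi>"
    then have "\<Gamma> \<turnstile> Imp (Neg \<phi>) \<phi>" by (rule provable.ImpI)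
    then show False
      using Neg assms(2) by (metis Neg_def consistent_def provable.ImpE)
  qed
  have cons: "consistent ?\<Gamma>"
    using unprovable provable.Contr[of \<phi> ?\<Gamma>] unfolding consistent_def by auto
  have bd: "bounded_vars ?\<Gamma>" using assms(1) by (rule bounded_vars_insert)
  obtain k l where kl: "\<forall>\<psi> \<in> ?\<Gamma>. closed_fm k l \<psi>" using bd unfolding bounded_vars_def by blast
  consider (N) \<psi> where "\<phi> = AllN \<psi>" | (S) \<psi> where "\<phi> = AllS \<psi>"
    | (other) "\<forall>\<psi>. \<phi> \<noteq> AllN \<psi> \<and> \<phi> \<noteq> AllS \<psi>" by blast
  then show ?thesis
  proof cases
    case N
    then have "closed_fm (Suc k) l \<psi>" using kl by (simp add: Neg_def)
    then have "\<not> ?\<Gamma> \<turnstile> instN (Var k) \<psi>"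
      using provable_generalizeN[of ?\<Gamma> k l \<psi>] kl unprovable N by blast
    then show ?thesis
      using bd N consistent_insert_Neg
      by (intro exI[of _ "insert (Neg (instN (Var k) \<psi>)) ?\<Gamma>"])
        (auto simp: decides_def bounded_vars_insert)
  next
    case S
    then have "closed_fm k (Suc l) \<psi>" using kl by (simp add: Neg_def)
    then have "\<not> ?\<Gamma> \<turnstile> instS l \<psi>"
      using provable_generalizeS[of ?\<Gamma> k l \<psi>] kl unprovable S by blast
    then show ?thesis
      using bd S consistent_insert_Neg
      by (intro exI[of _ "insert (Neg (instS l \<psi>)) ?\<Gamma>"])
        (auto simp: decides_def bounded_vars_insert)
  next
    case other
    then show ?thesis
      using bd cons by (intro exI[of _ ?\<Gamma>]) (auto simp: decides_def)
  qed
qed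

lemma henkin_extension:
  assumes "\<And>\<phi>. \<phi> \<in> \<Gamma> \<Longrightarrow> sentence \<phi>" "consistent \<Gamma>"
  shows "\<exists>\<Delta>. \<Gamma> \<subseteq> \<Delta> \<and> henkin \<Delta>"
proof -
  let ?P = "\<lambda>\<Gamma>. bounded_vars \<Gamma> \<and> consistent \<Gamma>"
  obtain F where F: "\<And>\<Gamma> \<phi>. ?P \<Gamma> \<Longrightarrow> \<Gamma> \<subseteq> F \<Gamma> \<phi> \<and> ?P (F \<Gamma> \<phi>) \<and> decides (F \<Gamma> \<phi>) \<phi>"
    using decides_extension by metis
  \<comment> \<open>Stage n + 1 decides the formula with code n.\<close>
  define G where "G = rec_nat \<Gamma> (\<lambda>n \<Delta>. F \<Delta> (from_nat n))"
  have G_simps: "G 0 = \<Gamma>" "G (Suc n) = F (G n) (from_nat n)" for n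
    by (simp_all add: G_def)
  have "?P \<Gamma>"
    using assms unfolding bounded_vars_def sentence_def by blast
  then have P: "?P (G n)" for n
    by (induction n) (simp_all add: G_simps F)
  have mono: "m \<le> n \<Longrightarrow> G m \<subseteq> G n" for m n
    by (rule lift_Suc_mono_le[of G]) (simp_all add: G_simps F[OF P])
  have "decides (\<Union>n. G n) \<phi>" for \<phi>
  proof -
    have "decides (G (Suc (to_nat \<phi>))) \<phi>"
      using F[OF P, of "to_nat \<phi>" \<phi>] by (simp add: G_simps)
    then show ?thesis by (rule decides_mono) blast
  qed
  moreover have "consistent (\<Union>n. G n)"
    unfolding consistent_def
  proof
    assume "(\<Union>n. G n) \<turnstile> Bot"
    then obtain \<Delta> where \<Delta>: "\<Delta> \<subseteq> (\<Union>n. G n)" "finite \<Delta>" "\<Delta> \<turnstile> Bot"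
      using provable_finite by blast
    have "\<exists>n. \<Delta> \<subseteq> G n"
      using \<Delta>(2,1)
    proof (induction \<Delta>)
      case (insert \<phi> \<Delta>)
      then obtain m n where "\<phi> \<in> G m" "\<Delta> \<subseteq> G n" by auto
      then have "insert \<phi> \<Delta> \<subseteq> G (max m n)"
        using mono[of m "max m n"] mono[of n "max m n"] by auto
      then show ?case by blast
    qed simp
    then show False using \<Delta>(3) P provable_weaken unfolding consistent_def by blast
  qed
  moreover have "\<Gamma> \<subseteq> (\<Union>n. G n)" using G_simps(1) by blast
  ultimately show ?thesis unfolding henkin_def by blast
qed

lemma henkin_closed:
  assumes "henkin \<Gamma>" "\<Gamma> \<turnstile> \<phi>" shows "\<phi> \<in> \<Gamma>"
proof (rule ccontr)
  assume "\<phi> \<notin> \<Gamma>"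
  then have "\<Gamma> \<turnstile> Neg \<phi>" using assms(1) by (auto simp: henkin_def decides_def intro: provable.Assm)
  then show False
    using assms by (metis Neg_def consistent_def henkin_def provable.ImpE)
qed

lemma henkin_Bot: "henkin \<Gamma> \<Longrightarrow> Bot \<notin> \<Gamma>"
  by (meson consistent_def henkin_def provable.Assm)

lemma henkin_Neg: "henkin \<Gamma> \<Longrightarrow> Neg \<phi> \<in> \<Gamma> \<longleftrightarrow> \<phi> \<notin> \<Gamma>"
  by (metis Neg_def decides_def henkin_Bot henkin_closed henkin_def provable.Assm provable.ImpE)

lemma henkin_Imp:
  assumes "henkin \<Gamma>"
  shows "Imp \<phi> \<psi> \<in> \<Gamma> \<longleftrightarrow> (\<phi> \<in> \<Gamma> \<longrightarrow> \<psi> \<in> \<Gamma>)"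
proof
  show "Imp \<phi> \<psi> \<in> \<Gamma> \<Longrightarrow> \<phi> \<in> \<Gamma> \<longrightarrow> \<psi> \<in> \<Gamma>"
    by (meson assms henkin_closed provable.Assm provable.ImpE)
next
  assume r: "\<phi> \<in> \<Gamma> \<longrightarrow> \<psi> \<in> \<Gamma>"
  show "Imp \<phi> \<psi> \<in> \<Gamma>"
  proof (cases "\<psi> \<in> \<Gamma>")
    case True
    then show ?thesis by (meson assms henkin_closed insertI2 provable.Assm provable.ImpI)
  next
    case False
    then have "Imp \<phi> Bot \<in> \<Gamma>" using r henkin_Neg[OF assms] by (simp add: Neg_def)
    then have "insert (Neg \<psi>) (insert \<phi> \<Gamma>) \<turnstile> Bot"
      by (meson insertI1 insertI2 provable.Assm provable.ImpE)
    then show ?thesis by (meson assms henkin_closed provable.Contr provable.ImpI)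
  qed
qed

lemma henkin_AllN:
  assumes "henkin \<Gamma>"
  shows "AllN \<phi> \<in> \<Gamma> \<longleftrightarrow> (\<forall>t. instN t \<phi> \<in> \<Gamma>)"
proof
  show "AllN \<phi> \<in> \<Gamma> \<Longrightarrow> \<forall>t. instN t \<phi> \<in> \<Gamma>"
    by (meson assms henkin_closed provable.Assm provable.AllNE)
  show "\<forall>t. instN t \<phi> \<in> \<Gamma> \<Longrightarrow> AllN \<phi> \<in> \<Gamma>"
    using assms henkin_Neg[OF assms] unfolding henkin_def decides_def by blast
qed

lemma henkin_AllS:
  assumes "henkin \<Gamma>"
  shows "AllS \<phi> \<in> \<Gamma> \<longleftrightarrow> (\<forall>X. instS X \<phi> \<in> \<Gamma>)"
proof
  show "AllS \<phi> \<in> \<Gamma> \<Longrightarrow> \<forall>X. instS X \<phi> \<in> \<Gamma>"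
    by (meson assms henkin_closed provable.Assm provable.AllSE)
  show "\<forall>X. instS X \<phi> \<in> \<Gamma> \<Longrightarrow> AllS \<phi> \<in> \<Gamma>"
    using assms henkin_Neg[OF assms] unfolding henkin_def decides_def by blast
qed

lemma henkin_EqSubst:
  assumes "henkin \<Gamma>" "Eq s t \<in> \<Gamma>" "instN s \<phi> \<in> \<Gamma>" shows "instN t \<phi> \<in> \<Gamma>"
  by (meson assms henkin_closed provable.Assm provable.EqSubst)

section \<open>Semantics\<close>

primrec eval :: "(nat \<Rightarrow> 'a) \<Rightarrow> tm \<Rightarrow> 'a::{zero,one,plus,times}" where
  "eval e (Var n) = e n"
| "eval e Zero = 0"
| "eval e One = 1"
| "eval e (Plus s t) = eval e s + eval e t"
| "eval e (Times s t) = eval e s * eval e t"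

text \<open>Set quantifiers range over the members of \<open>S\<close> (Henkin semantics).\<close>

primrec sat ::
  "'a::{zero,one,plus,times,ord} set set \<Rightarrow> (nat \<Rightarrow> 'a) \<Rightarrow> (nat \<Rightarrow> 'a set) \<Rightarrow> fm \<Rightarrow> bool" where
  "sat S e s (Eq t u) \<longleftrightarrow> eval e t = eval e u"
| "sat S e s (Less t u) \<longleftrightarrow> eval e t < eval e u"
| "sat S e s (Mem t X) \<longleftrightarrow> eval e t \<in> s X"
| "sat S e s Bot \<longleftrightarrow> False"
| "sat S e s (Imp \<phi> \<psi>) \<longleftrightarrow> (sat S e s \<phi> \<longrightarrow> sat S e s \<psi>)"
| "sat S e s (AllN \<phi>) \<longleftrightarrow> (\<forall>x. sat S (case_nat x e) s \<phi>)"
| "sat S e s (AllS \<phi>) \<longleftrightarrow> (\<forall>X\<in>S. sat S e (case_nat X s) \<phi>)"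

lemma sat_Neg [simp]: "sat S e s (Neg \<phi>) \<longleftrightarrow> \<not> sat S e s \<phi>"
  and sat_And [simp]: "sat S e s (And \<phi> \<psi>) \<longleftrightarrow> sat S e s \<phi> \<and> sat S e s \<psi>"
  and sat_Or [simp]: "sat S e s (Or \<phi> \<psi>) \<longleftrightarrow> sat S e s \<phi> \<or> sat S e s \<psi>"
  and sat_Iff [simp]: "sat S e s (Iff \<phi> \<psi>) \<longleftrightarrow> (sat S e s \<phi> \<longleftrightarrow> sat S e s \<psi>)"
  and sat_ExN [simp]: "sat S e s (ExN \<phi>) \<longleftrightarrow> (\<exists>x. sat S (case_nat x e) s \<phi>)"
  and sat_ExS [simp]: "sat S e s (ExS \<phi>) \<longleftrightarrow> (\<exists>X\<in>S. sat S e (case_nat X s) \<phi>)"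
  by (auto simp: Neg_def And_def Or_def Iff_def ExN_def ExS_def)

lemma eval_subst: "eval e (subst_tm \<sigma> t) = eval (\<lambda>n. eval e (\<sigma> n)) t"
  by (induction t) auto

lemma eval_shift [simp]: "eval (case_nat x e) (shift_tm t) = eval e t"
  by (simp add: shift_tm_def eval_subst)

lemma sat_subst: "sat S e s (subst \<sigma> \<rho> \<phi>) = sat S (\<lambda>n. eval e (\<sigma> n)) (\<lambda>X. s (\<rho> X)) \<phi>"
proof (induction \<phi> arbitrary: e s \<sigma> \<rho>)
  case (AllN \<phi>)
  have "(\<lambda>n. eval (case_nat x e) (liftN \<sigma> n)) = case_nat x (\<lambda>n. eval e (\<sigma> n))" for x
    by (rule ext) (simp split: nat.split)
  then show ?case by (simp add: AllN.IH)
next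
  case (AllS \<phi>)
  have "(\<lambda>n. case_nat X s (liftS \<rho> n)) = case_nat X (\<lambda>n. s (\<rho> n))" for X
    by (rule ext) (simp split: nat.split)
  then show ?case by (simp add: AllS.IH)
qed (simp_all add: eval_subst)

lemma sat_instN: "sat S e s (instN t \<phi>) = sat S (case_nat (eval e t) e) s \<phi>"
proof -
  have "(\<lambda>n. eval e (case_nat t Var n)) = case_nat (eval e t) e"
    by (rule ext) (simp split: nat.split)
  then show ?thesis by (simp add: instN_def sat_subst)
qed

lemma sat_instS: "sat S e s (instS X \<phi>) = sat S e (case_nat (s X) s) \<phi>"
proof -
  have "(\<lambda>n. s (case_nat X (\<lambda>Y. Y) n)) = case_nat (s X) s"
    by (rule ext) (simp split: nat.split)
  then show ?thesis by (simp add: instS_def sat_subst)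
qed

lemma sat_shiftN [simp]: "sat S (case_nat x e) s (shiftN \<phi>) = sat S e s \<phi>"
  and sat_shiftS [simp]: "sat S e (case_nat X s) (shiftS \<phi>) = sat S e s \<phi>"
  by (simp_all add: shiftN_def shiftS_def sat_subst)

text \<open>The assignment of sets has to stay inside \<open>S\<close>, since \<open>AllSE\<close>
  instantiates a quantifier over \<open>S\<close> at the value of a set variable.\<close>

lemma soundness:
  "\<Gamma> \<turnstile> \<phi> \<Longrightarrow> range s \<subseteq> S \<Longrightarrow> (\<And>\<gamma>. \<gamma> \<in> \<Gamma> \<Longrightarrow> sat S e s \<gamma>) \<Longrightarrow> sat S e s \<phi>"
proof (induction arbitrary: e s rule: provable.induct)
  case (ImpI \<phi> \<Gamma> \<psi>)
  then show ?case by (simp add: Ball_def) blast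
next
  case (Contr \<phi> \<Gamma>)
  show ?case
  proof (rule ccontr)
    assume "\<not> sat S e s \<phi>"
    then have "sat S e s Bot" using Contr.prems by (intro Contr.IH) auto
    then show False by simp
  qed
next
  case (AllNI \<Gamma> \<phi>)
  have "sat S (case_nat x e) s \<phi>" for x
    using AllNI.prems by (intro AllNI.IH) auto
  then show ?case by simp
next
  case (AllSI \<Gamma> \<phi>)
  have "sat S e (case_nat X s) \<phi>" if "X \<in> S" for X
    using AllSI.prems that by (intro AllSI.IH) (auto simp: image_subset_iff split: nat.split)
  then show ?case by simp
next
  case (AllNE \<Gamma> \<phi> t)
  then show ?case by (simp add: sat_instN)
next
  case (AllSE \<Gamma> \<phi> X)
  then have "\<forall>X\<in>S. sat S e (case_nat X s) \<phi>" by simp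
  moreover have "s X \<in> S" using AllSE.prems(1) by auto
  ultimately show ?case by (simp add: sat_instS)
next
  case (EqSubst \<Gamma> s' t \<phi>)
  then show ?case by (metis sat.simps(1) sat_instN)
qed auto

lemma case_nat_eta: "case_nat (e 0) (\<lambda>n. e (Suc n)) = e"
  by (rule ext) (simp split: nat.split)

section \<open>Validity and universal closures\<close>

definition valid :: "'a::{zero,one,plus,times,ord} set set \<Rightarrow> fm \<Rightarrow> bool" where
  "valid S \<phi> \<longleftrightarrow> (\<forall>e s. range s \<subseteq> S \<longrightarrow> sat S e s \<phi>)"

lemma valid_AllN: "valid S (AllN \<phi>) \<longleftrightarrow> valid S \<phi>"
  unfolding valid_def by simp (metis case_nat_eta)

lemma valid_AllS: "valid S (AllS \<phi>) \<longleftrightarrow> valid S \<phi>"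
proof
  assume l: "valid S (AllS \<phi>)"
  show "valid S \<phi>"
    unfolding valid_def
  proof (intro allI impI)
    fix e and s :: "nat \<Rightarrow> _"
    assume "range s \<subseteq> S"
    then have "range (\<lambda>n. s (Suc n)) \<subseteq> S" "s 0 \<in> S" by auto
    then have "sat S e (case_nat (s 0) (\<lambda>n. s (Suc n))) \<phi>"
      using l unfolding valid_def by simp
    then show "sat S e s \<phi>" by (simp add: case_nat_eta)
  qed
next
  assume r: "valid S \<phi>"
  have "sat S e (case_nat X s) \<phi>" if "range s \<subseteq> S" "X \<in> S" for e s X
  proof -
    have "range (case_nat X s) \<subseteq> S" using that by (auto simp: image_subset_iff split: nat.split)
    then show ?thesis using r unfolding valid_def by blast
  qed
  then show "valid S (AllS \<phi>)" unfolding valid_def by simp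
qed

lemma valid_closure: "valid S ((AllN ^^ m) ((AllS ^^ n) \<phi>)) \<longleftrightarrow> valid S \<phi>"
proof -
  have "valid S ((AllN ^^ m) \<psi>) \<longleftrightarrow> valid S \<psi>" for \<psi>
    by (induction m) (simp_all add: valid_AllN)
  moreover have "valid S ((AllS ^^ n) \<phi>) \<longleftrightarrow> valid S \<phi>"
    by (induction n) (simp_all add: valid_AllS)
  ultimately show ?thesis by simp
qed

text \<open>The schemes contribute closed formulas only. At least one closure of each instance is
  therefore an axiom, and its validity gives that of the open instance.\<close>

lemma universal_closure_exists: "\<exists>m n. (AllN ^^ m) ((AllS ^^ n) \<phi>) \<in> universal_closures \<phi>"
proof -
  obtain m n where mn: "closed_fm m n \<phi>" using closed_fm_bound by blast
  have "closed_fm m (n - j) ((AllS ^^ j) \<phi>)" for j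
  proof (induction j)
    case (Suc j)
    then show ?case by (auto intro: closed_fm_mono)
  qed (simp add: mn)
  from this[of n] have AllS: "closed_fm m 0 ((AllS ^^ n) \<phi>)" by simp
  have "closed_fm (m - i) 0 ((AllN ^^ i) ((AllS ^^ n) \<phi>))" for i
  proof (induction i)
    case (Suc i)
    then show ?case by (auto intro: closed_fm_mono)
  qed (simp add: AllS)
  from this[of m] show ?thesis
    unfolding universal_closures_def sentence_def by auto
qed

lemmas form_unfold =
  nt_zero_def nt_one_def nt_plus_def nt_times_def at_eq_def at_less_def at_mem_def
  form_neg_def form_conj_def form_disj_def form_imp_def form_iff_def
  all_num_def ex_num_def all_set_def ex_set_def

lemma closed_derived [simp]:
  "closed_fm m n (Neg \<phi>) \<longleftrightarrow> closed_fm m n \<phi>"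
  "closed_fm m n (And \<phi> \<psi>) \<longleftrightarrow> closed_fm m n \<phi> \<and> closed_fm m n \<psi>"
  "closed_fm m n (Or \<phi> \<psi>) \<longleftrightarrow> closed_fm m n \<phi> \<and> closed_fm m n \<psi>"
  "closed_fm m n (Iff \<phi> \<psi>) \<longleftrightarrow> closed_fm m n \<phi> \<and> closed_fm m n \<psi>"
  "closed_fm m n (ExN \<phi>) \<longleftrightarrow> closed_fm (Suc m) n \<phi>"
  "closed_fm m n (ExS \<phi>) \<longleftrightarrow> closed_fm m (Suc n) \<phi>"
  by (auto simp: Neg_def And_def Or_def Iff_def ExN_def ExS_def)

lemma sentence_RCA0: "\<phi> \<in> RCA0 \<Longrightarrow> sentence \<phi>"
  unfolding RCA0_def basic_axioms_def universal_closures_def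
  by (auto simp: form_unfold sentence_def)

lemma valid_RCA0_nat: "\<phi> \<in> RCA0 \<Longrightarrow> valid (UNIV :: nat set set) \<phi>"
proof -
  have ind: "valid (UNIV :: nat set set) (induction_axiom \<phi>)" for \<phi>
    unfolding valid_def induction_axiom_def
  proof (clarsimp simp: sat_instN sat_subst)
    fix e :: "nat \<Rightarrow> nat" and s x
    assume 0: "sat UNIV (case_nat 0 e) s \<phi>"
      and step: "\<forall>x. sat UNIV (case_nat x e) s \<phi> \<longrightarrow>
        sat UNIV (\<lambda>n. eval (case_nat x e) (case_nat (Plus (Var 0) One) (\<lambda>n. Var (Suc n)) n)) s \<phi>"
    have eq: "(\<lambda>n. eval (case_nat x e) (case_nat (Plus (Var 0) One) (\<lambda>n. Var (Suc n)) n))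
        = case_nat (Suc x) e" for x
      by (rule ext) (simp split: nat.split)
    show "sat UNIV (case_nat x e) s \<phi>"
      using 0 step by (induction x) (simp_all add: eq)
  qed
  have compr: "valid (UNIV :: nat set set) (comprehension_axiom \<phi> \<psi>)" for \<phi> \<psi>
    unfolding valid_def comprehension_axiom_def
    by (auto intro!: exI[of _ "{x. sat UNIV (case_nat x _) _ \<phi>}"])
  have basic: "valid (UNIV :: nat set set) (p 0 0)" if "p \<in> basic_axioms" for p
    using that unfolding basic_axioms_def valid_def by (auto simp: form_unfold)
  show "\<phi> \<in> RCA0 \<Longrightarrow> valid (UNIV :: nat set set) \<phi>"
    unfolding RCA0_def universal_closures_def
    by (auto simp: basic ind compr valid_closure)
qed

text \<open>Needed for \<open>Th\<close> to exist also in the case that the goal is provable;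
  consistency comes from the standard numbers with all their subsets.\<close>

lemma consistent_RCA0: "consistent RCA0"
proof -
  have "\<not> sat (UNIV :: nat set set) (\<lambda>_. 0) (\<lambda>_. {}) Bot" by simp
  then show ?thesis
    unfolding consistent_def using soundness[of RCA0 Bot "\<lambda>_. {}" UNIV "\<lambda>_. 0"] valid_RCA0_nat
    unfolding valid_def by blast
qed

section \<open>A Henkin model of \<open>RCA\<^sub>0\<close>\<close>

definition goal_fm :: fm where "goal_fm = Imp AHT SRT2"

lemma sentence_goal: "sentence goal_fm"
  unfolding goal_fm_def AHT_def SRT2_def AHT_k_def SRT2_k_def stable_def in_AS_def enumerates_def
    apartness_def is_mu_def is_lambda_def binary_expansion_def is_sum_def is_pow2_def
    infinite_set_def pairs_def below_def nats_def val_def is_fun_def pair_def ex1_num_def leq_def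
    sentence_def form_unfold
  by simp

text \<open>
  The model is fixed once and for all, so that its domain can be made a type: it refutes the goal if
  the goal is unprovable, and is an arbitrary model of \<open>RCA\<^sub>0\<close> otherwise.
\<close>

definition Th :: "fm set" where
  "Th = (SOME T. RCA0 \<subseteq> T \<and> henkin T \<and> (\<not> RCA0 \<turnstile> goal_fm \<longrightarrow> Neg goal_fm \<in> T))"

lemma Th: "RCA0 \<subseteq> Th" "henkin Th" "\<not> RCA0 \<turnstile> goal_fm \<Longrightarrow> Neg goal_fm \<in> Th"
proof -
  have "\<exists>T. RCA0 \<subseteq> T \<and> henkin T \<and> (\<not> RCA0 \<turnstile> goal_fm \<longrightarrow> Neg goal_fm \<in> T)"
  proof (cases "RCA0 \<turnstile> goal_fm")
    case True
    then show ?thesis using henkin_extension[OF sentence_RCA0 consistent_RCA0] by blast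
  next
    case False
    then have "consistent (insert (Neg goal_fm) RCA0)" by (rule consistent_insert_Neg)
    moreover have "sentence (Neg goal_fm)" using sentence_goal by (simp add: sentence_def)
    ultimately show ?thesis
      using henkin_extension[of "insert (Neg goal_fm) RCA0"] sentence_RCA0 by blast
  qed
  from someI_ex[OF this, folded Th_def]
  show "RCA0 \<subseteq> Th" "henkin Th" "\<not> RCA0 \<turnstile> goal_fm \<Longrightarrow> Neg goal_fm \<in> Th" by auto
qed

lemmas Th_closed = henkin_closed[OF Th(2)]
lemmas Th_EqSubst = henkin_EqSubst[OF Th(2)]

lemma subst_tm_case_shift [simp]: "subst_tm (case_nat t Var) (shift_tm s) = s"
  by (simp add: subst_tm_inst_shift)

lemma Th_refl: "Eq t t \<in> Th" by (rule Th_closed) (rule provable.EqRefl)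

text \<open>Here and in the congruence lemmas below, \<open>EqSubst\<close> is applied to a formula
  in which variable 0 marks the place to be rewritten and all other terms are shifted out of its
  way.\<close>

lemma Th_sym: "Eq s t \<in> Th \<Longrightarrow> Eq t s \<in> Th"
  using Th_EqSubst[of s t "Eq (Var 0) (shift_tm s)"] Th_refl by (simp add: instN_def)

lemma Th_trans: "Eq s t \<in> Th \<Longrightarrow> Eq t u \<in> Th \<Longrightarrow> Eq s u \<in> Th"
  using Th_EqSubst[of t u "Eq (shift_tm s) (Var 0)"] by (simp add: instN_def)

lemma Th_Plus: "Eq s s' \<in> Th \<Longrightarrow> Eq t t' \<in> Th \<Longrightarrow> Eq (Plus s t) (Plus s' t') \<in> Th"
  using Th_EqSubst[of s s' "Eq (Plus (shift_tm s) (shift_tm t)) (Plus (Var 0) (shift_tm t))"]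
    Th_EqSubst[of t t' "Eq (Plus (shift_tm s) (shift_tm t)) (Plus (shift_tm s') (Var 0))"] Th_refl
  by (simp add: instN_def)

lemma Th_Times: "Eq s s' \<in> Th \<Longrightarrow> Eq t t' \<in> Th \<Longrightarrow> Eq (Times s t) (Times s' t') \<in> Th"
  using Th_EqSubst[of s s' "Eq (Times (shift_tm s) (shift_tm t)) (Times (Var 0) (shift_tm t))"]
    Th_EqSubst[of t t' "Eq (Times (shift_tm s) (shift_tm t)) (Times (shift_tm s') (Var 0))"] Th_refl
  by (simp add: instN_def)

lemma Th_Less_imp: "Eq s s' \<in> Th \<Longrightarrow> Eq t t' \<in> Th \<Longrightarrow> Less s t \<in> Th \<Longrightarrow> Less s' t' \<in> Th"
  using Th_EqSubst[of s s' "Less (Var 0) (shift_tm t)"] Th_EqSubst[of t t' "Less (shift_tm s') (Var 0)"]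
  by (simp add: instN_def)

lemma Th_Less: "Eq s s' \<in> Th \<Longrightarrow> Eq t t' \<in> Th \<Longrightarrow> Less s t \<in> Th \<longleftrightarrow> Less s' t' \<in> Th"
  by (meson Th_Less_imp Th_sym)

lemma Th_Mem_imp: "Eq s t \<in> Th \<Longrightarrow> Mem s X \<in> Th \<Longrightarrow> Mem t X \<in> Th"
  using Th_EqSubst[of s t "Mem (Var 0) X"] by (simp add: instN_def)

lemma Th_Mem: "Eq s t \<in> Th \<Longrightarrow> Mem s X \<in> Th \<longleftrightarrow> Mem t X \<in> Th"
  by (meson Th_Mem_imp Th_sym)

definition tm_eq :: "tm \<Rightarrow> tm \<Rightarrow> bool" where "tm_eq s t \<longleftrightarrow> Eq s t \<in> Th"

quotient_type number = tm / tm_eq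
  by (rule equivpI) (auto simp: reflp_def symp_def transp_def tm_eq_def
      intro: Th_refl Th_sym Th_trans)

instantiation number :: "{zero,one,plus,times,ord}"
begin

lift_definition zero_number :: number is Zero .
lift_definition one_number :: number is One .
lift_definition plus_number :: "number \<Rightarrow> number \<Rightarrow> number" is Plus
  by (simp add: tm_eq_def Th_Plus)
lift_definition times_number :: "number \<Rightarrow> number \<Rightarrow> number" is Times
  by (simp add: tm_eq_def Th_Times)
lift_definition less_number :: "number \<Rightarrow> number \<Rightarrow> bool" is "\<lambda>s t. Less s t \<in> Th"
  by (simp add: tm_eq_def Th_Less)
definition less_eq_number :: "number \<Rightarrow> number \<Rightarrow> bool" where
  "less_eq_number x y \<longleftrightarrow> x < y \<or> x = y"

instance ..

end

lift_definition member :: "nat \<Rightarrow> number \<Rightarrow> bool" is "\<lambda>X t. Mem t X \<in> Th"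
  by (simp add: tm_eq_def Th_Mem)

definition set_of :: "nat \<Rightarrow> number set" where "set_of X = Collect (member X)"

abbreviation sets :: "number set set" where "sets \<equiv> range set_of"

lemma eval_Th: "eval (\<lambda>n. abs_number (\<sigma> n)) t = abs_number (subst_tm \<sigma> t)"
  by (induction t) (simp_all add: zero_number.abs_eq one_number.abs_eq plus_number.abs_eq
      times_number.abs_eq)

lemma all_number: "(\<forall>x. P x) \<longleftrightarrow> (\<forall>t. P (abs_number t))"
  by (auto intro: number.abs_induct)

text \<open>The domain consists of classes of terms and the sets are named by set variables, so an
  assignment is the same thing as a substitution. Quantifying the induction over all substitutions
  lets the witness property of \<open>Th\<close> settle the quantifier cases.\<close>

lemma truth:
  "sat sets (\<lambda>n. abs_number (\<sigma> n)) (\<lambda>X. set_of (\<rho> X)) \<phi> \<longleftrightarrow> subst \<sigma> \<rho> \<phi> \<in> Th"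
proof (induction \<phi> arbitrary: \<sigma> \<rho>)
  case (Eq s t)
  then show ?case by (simp add: eval_Th number.abs_eq_iff tm_eq_def)
next
  case (Less s t)
  then show ?case by (simp add: eval_Th less_number.abs_eq)
next
  case (Mem t X)
  then show ?case by (simp add: eval_Th set_of_def member.abs_eq)
next
  case Bot
  then show ?case by (simp add: henkin_Bot Th(2))
next
  case (Imp \<phi> \<psi>)
  then show ?case by (simp add: henkin_Imp Th(2))
next
  case (AllN \<phi>)
  have eq: "case_nat (abs_number t) (\<lambda>n. abs_number (\<sigma> n)) = (\<lambda>n. abs_number (case_nat t \<sigma> n))" for t
    by (rule ext) (simp split: nat.split)
  have "sat sets (\<lambda>n. abs_number (\<sigma> n)) (\<lambda>X. set_of (\<rho> X)) (AllN \<phi>)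
    \<longleftrightarrow> (\<forall>t. sat sets (case_nat (abs_number t) (\<lambda>n. abs_number (\<sigma> n))) (\<lambda>X. set_of (\<rho> X)) \<phi>)"
    unfolding sat.simps(6) by (subst all_number) (rule refl)
  then show ?case by (simp add: eq AllN.IH henkin_AllN Th(2) instN_subst_liftN)
next
  case (AllS \<phi>)
  have eq: "case_nat (set_of X) (\<lambda>n. set_of (\<rho> n)) = (\<lambda>n. set_of (case_nat X \<rho> n))" for X
    by (rule ext) (simp split: nat.split)
  show ?case by (simp add: eq AllS.IH henkin_AllS Th(2) instS_subst_liftS)
qed

text \<open>Any assignment into the model comes from some substitution, and a substitution leaves a
  sentence unchanged.\<close>

lemma valid_Th:
  assumes "sentence \<phi>" shows "valid sets \<phi> \<longleftrightarrow> \<phi> \<in> Th"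
proof -
  have "sat sets e s \<phi> \<longleftrightarrow> \<phi> \<in> Th" if s: "range s \<subseteq> sets" for e s
  proof -
    have "\<exists>\<rho>. s = (\<lambda>X. set_of (\<rho> X))"
      using s by (auto simp: image_subset_iff image_iff fun_eq_iff intro: choice)
    then obtain \<rho> where s: "s = (\<lambda>X. set_of (\<rho> X))" by blast
    have "e = (\<lambda>n. abs_number (rep_number (e n)))"
      by (simp add: Quotient3_abs_rep[OF Quotient3_number])
    then have "sat sets e s \<phi> \<longleftrightarrow> subst (\<lambda>n. rep_number (e n)) \<rho> \<phi> \<in> Th"
      using truth s by metis
    also have "subst (\<lambda>n. rep_number (e n)) \<rho> \<phi> = subst Var (\<lambda>X. X) \<phi>"
      using assms unfolding sentence_def by (rule subst_cong) auto
    finally show ?thesis by simp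
  qed
  moreover have "range (\<lambda>_. set_of 0) \<subseteq> sets" by auto
  ultimately show ?thesis unfolding valid_def by blast
qed

lemma valid_RCA0: "\<phi> \<in> RCA0 \<Longrightarrow> valid sets \<phi>"
  using Th(1) sentence_RCA0 valid_Th by blast

lemma induction_axiom_valid: "Sigma1 \<phi> \<Longrightarrow> valid sets (induction_axiom \<phi>)"
  using universal_closure_exists[of "induction_axiom \<phi>"] valid_RCA0 valid_closure
  unfolding RCA0_def by (metis (mono_tags, lifting) UN_iff UnCI mem_Collect_eq)

lemma comprehension_axiom_valid:
  assumes "Sigma1 \<phi>" "Pi1 \<psi>" shows "valid sets (comprehension_axiom \<phi> \<psi>)"
proof -
  obtain m n where "(AllN ^^ m) ((AllS ^^ n) (comprehension_axiom \<phi> \<psi>))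
      \<in> universal_closures (comprehension_axiom \<phi> \<psi>)"
    using universal_closure_exists by blast
  then have "(AllN ^^ m) ((AllS ^^ n) (comprehension_axiom \<phi> \<psi>)) \<in> RCA0"
    using assms unfolding RCA0_def by blast
  then show ?thesis using valid_RCA0 valid_closure by blast
qed

lemma basic_axioms_number:
  fixes m n :: number
  shows "m + 1 \<noteq> 0" "m + 1 = n + 1 \<Longrightarrow> m = n" "m + 0 = m" "m + (n + 1) = (m + n) + 1"
    "m * 0 = 0" "m * (n + 1) = m * n + m" "\<not> m < 0" "m < n + 1 \<longleftrightarrow> m < n \<or> m = n"
proof -
  have sat_basic: "sat sets (\<lambda>_. 0) (\<lambda>_. set_of 0) (p 0 0)" if "p \<in> basic_axioms" for p
  proof -
    have "p 0 0 \<in> RCA0" using that unfolding RCA0_def by blast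
    then show ?thesis
      using valid_RCA0[of "p 0 0"] unfolding valid_def by (auto simp: image_subset_iff)
  qed
  have "\<forall>p \<in> basic_axioms. sat sets (\<lambda>_. 0) (\<lambda>_. set_of 0) (p 0 0)"
    by (intro ballI sat_basic)
  note * = this[unfolded basic_axioms_def form_unfold, simplified]
  show "m + 1 \<noteq> 0" "m + 1 = n + 1 \<Longrightarrow> m = n" "m + 0 = m" "m + (n + 1) = (m + n) + 1"
    "m * 0 = 0" "m * (n + 1) = m * n + m" "\<not> m < 0" "m < n + 1 \<longleftrightarrow> m < n \<or> m = n"
    using * by simp_all
qed

section \<open>Inside the model: definability, arithmetic and recursion\<close>

section \<open>Definability with parameters\<close>

text \<open>
  Predicates on environments \<open>e\<close> give names to number variables. Every element of the
  model is the value of a variable of odd index, so that arbitrary elements may occur as constants.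
  The predicates \<open>d0\<close>, \<open>s1\<close>, \<open>d1\<close> stand for \<open>\<Delta>\<^sub>0\<close>, \<open>\<Sigma>\<^sub>1\<close> and
  \<open>\<Delta>\<^sub>1\<close> definability, and \<open>dt\<close> for functions with a \<open>\<Delta>\<^sub>1\<close> graph.
\<close>

definition number_of :: "nat \<Rightarrow> number" where "number_of n = abs_number (from_nat n)"

lemma number_of_surj: "\<exists>n. number_of n = x"
proof -
  have "number_of (to_nat (rep_number x)) = x"
    by (simp add: number_of_def Quotient3_abs_rep[OF Quotient3_number])
  then show ?thesis by blast
qed

definition mix :: "(nat \<Rightarrow> number) \<Rightarrow> nat \<Rightarrow> number" where
  "mix e i = (if even i then e (i div 2) else number_of (i div 2))"

definition dterm :: "((nat \<Rightarrow> number) \<Rightarrow> number) \<Rightarrow> bool" where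
  "dterm t \<longleftrightarrow> (\<exists>u. \<forall>e. t e = eval (mix e) u)"

definition d0 :: "((nat \<Rightarrow> number) \<Rightarrow> bool) \<Rightarrow> bool" where
  "d0 Q \<longleftrightarrow> (\<exists>\<phi>. Delta0 \<phi> \<and> (\<forall>e. Q e \<longleftrightarrow> sat sets (mix e) set_of \<phi>))"

lemma dterm_var: "dterm (\<lambda>e. e n)"
  unfolding dterm_def by (rule exI[of _ "Var (2 * n)"]) (simp add: mix_def)

lemma dterm_const: "dterm (\<lambda>e. c)"
proof -
  obtain n where "number_of n = c" using number_of_surj by blast
  then show ?thesis unfolding dterm_def by (intro exI[of _ "Var (2 * n + 1)"]) (simp add: mix_def)
qed

lemma dterm_plus: "dterm s \<Longrightarrow> dterm t \<Longrightarrow> dterm (\<lambda>e. s e + t e)"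
  unfolding dterm_def by (metis eval.simps(4))

lemma dterm_times: "dterm s \<Longrightarrow> dterm t \<Longrightarrow> dterm (\<lambda>e. s e * t e)"
  unfolding dterm_def by (metis eval.simps(5))

lemmas dterm_intros = dterm_var dterm_const dterm_plus dterm_times

lemma d0_eq: "dterm s \<Longrightarrow> dterm t \<Longrightarrow> d0 (\<lambda>e. s e = t e)"
  unfolding dterm_def d0_def by (metis Delta0.intros(1) sat.simps(1))

lemma d0_less: "dterm s \<Longrightarrow> dterm t \<Longrightarrow> d0 (\<lambda>e. s e < t e)"
  unfolding dterm_def d0_def by (metis Delta0.intros(2) sat.simps(2))

lemma d0_mem:
  assumes "dterm t" "X \<in> sets" shows "d0 (\<lambda>e. t e \<in> X)"
proof -
  obtain u n where "\<forall>e. t e = eval (mix e) u" "X = set_of n"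
    using assms unfolding dterm_def by auto
  then show ?thesis
    unfolding d0_def by (intro exI[of _ "Mem u n"]) (simp add: Delta0.intros)
qed

lemma d0_imp:
  assumes "d0 P" "d0 Q" shows "d0 (\<lambda>e. P e \<longrightarrow> Q e)"
proof -
  obtain \<phi> \<psi> where "Delta0 \<phi>" "\<forall>e. P e \<longleftrightarrow> sat sets (mix e) set_of \<phi>"
    "Delta0 \<psi>" "\<forall>e. Q e \<longleftrightarrow> sat sets (mix e) set_of \<psi>"
    using assms unfolding d0_def by auto
  then show ?thesis
    unfolding d0_def by (intro exI[of _ "Imp \<phi> \<psi>"]) (simp add: Delta0.intros)
qed

lemma d0_not:
  assumes "d0 P" shows "d0 (\<lambda>e. \<not> P e)"
proof -
  obtain \<phi> where "Delta0 \<phi>" "\<forall>e. P e \<longleftrightarrow> sat sets (mix e) set_of \<phi>"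
    using assms unfolding d0_def by auto
  then show ?thesis
    unfolding d0_def by (intro exI[of _ "Neg \<phi>"]) (simp add: Neg_def Delta0.intros)
qed

lemma d0_disj: "d0 P \<Longrightarrow> d0 Q \<Longrightarrow> d0 (\<lambda>e. P e \<or> Q e)"
  using d0_imp[OF d0_not] by (simp add: imp_conv_disj)

lemma d0_conj: "d0 P \<Longrightarrow> d0 Q \<Longrightarrow> d0 (\<lambda>e. P e \<and> Q e)"
  using d0_not[OF d0_imp[OF _ d0_not]] by simp

lemma Delta0_subst: "Delta0 \<phi> \<Longrightarrow> Delta0 (subst \<sigma> \<rho> \<phi>)"
proof (induction arbitrary: \<sigma> rule: Delta0.induct)
  case (6 \<phi> t)
  then show ?case by (auto simp: subst_tm_liftN_shift intro: Delta0.intros)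
next
  case (7 \<phi> t)
  have "subst \<sigma> \<rho> (ExN (And (Less (Var 0) (shift_tm t)) \<phi>)) =
    ExN (And (Less (Var 0) (shift_tm (subst_tm \<sigma> t))) (subst (liftN \<sigma>) \<rho> \<phi>))"
    by (simp add: ExN_def And_def subst_tm_liftN_shift)
  then show ?case using 7 Delta0.intros(7) by simp
qed (auto intro: Delta0.intros)

lemma d0_subst:
  assumes "\<And>n. dterm (s n)" "d0 Q"
  shows "d0 (\<lambda>e. Q (\<lambda>n. s n e))"
proof -
  obtain u where u: "\<And>n e. s n e = eval (mix e) (u n)"
    using assms(1) unfolding dterm_def by metis
  obtain \<phi> where \<phi>: "Delta0 \<phi>" "\<And>e. Q e \<longleftrightarrow> sat sets (mix e) set_of \<phi>"
    using assms(2) unfolding d0_def by blast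
  let ?\<sigma> = "\<lambda>i. if even i then u (i div 2) else Var i"
  have "(\<lambda>i. eval (mix e) (?\<sigma> i)) = mix (\<lambda>n. s n e)" for e
    by (rule HOL.ext) (simp add: mix_def u)
  then have "Q (\<lambda>n. s n e) \<longleftrightarrow> sat sets (mix e) set_of (subst ?\<sigma> (\<lambda>X. X) \<phi>)" for e
    by (simp add: \<phi>(2) sat_subst)
  then show ?thesis unfolding d0_def using Delta0_subst[OF \<phi>(1)] by blast
qed

text \<open>Passes from \<open>mix (case_nat x e)\<close> to \<open>case_nat x (mix e)\<close>.\<close>

definition unmix :: "nat \<Rightarrow> tm" where
  "unmix i = Var (if i = 0 then 0 else if even i then i - 1 else i + 1)"

lemma eval_unmix: "(\<lambda>i. eval (case_nat x (mix e)) (unmix i)) = mix (case_nat x e)"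
proof
  fix i
  show "eval (case_nat x (mix e)) (unmix i) = mix (case_nat x e) i"
  proof (cases "even i")
    case True
    then obtain k where "i = 2 * k" by blast
    then show ?thesis by (cases k) (simp_all add: unmix_def mix_def)
  next
    case False
    then obtain k where "i = 2 * k + 1" by (blast elim: oddE)
    then show ?thesis by (simp add: unmix_def mix_def)
  qed
qed

lemma sat_unmix:
  "sat sets (case_nat x (mix e)) set_of (subst unmix (\<lambda>X. X) \<phi>) \<longleftrightarrow> sat sets (mix (case_nat x e)) set_of \<phi>"
  by (simp add: sat_subst eval_unmix)

lemma d0_ball:
  assumes "dterm t" "d0 (\<lambda>e. P (e 0) (\<lambda>n. e (Suc n)))"
  shows "d0 (\<lambda>e. \<forall>x < t e. P x e)"
proof -
  obtain u where u: "\<forall>e. t e = eval (mix e) u"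
    using assms(1) unfolding dterm_def by auto
  obtain \<phi> where \<phi>: "Delta0 \<phi>" "\<forall>e. P (e 0) (\<lambda>n. e (Suc n)) \<longleftrightarrow> sat sets (mix e) set_of \<phi>"
    using assms(2) unfolding d0_def by blast
  have "P x e \<longleftrightarrow> sat sets (mix (case_nat x e)) set_of \<phi>" for x e
    using \<phi>(2)[rule_format, of "case_nat x e"] by simp
  then have "(\<forall>x < t e. P x e) \<longleftrightarrow>
    sat sets (mix e) set_of (AllN (Imp (Less (Var 0) (shift_tm u)) (subst unmix (\<lambda>X. X) \<phi>)))" for e
    by (simp add: u sat_unmix)
  then show ?thesis unfolding d0_def using Delta0.intros(6)[OF Delta0_subst[OF \<phi>(1)]] by blast
qed

lemma d0_bex:
  assumes "dterm t" "d0 (\<lambda>e. P (e 0) (\<lambda>n. e (Suc n)))"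
  shows "d0 (\<lambda>e. \<exists>x < t e. P x e)"
  using d0_not[OF d0_ball[OF assms(1) d0_not[OF assms(2)]]] by simp

lemma d0_const: "d0 (\<lambda>e. c)"
  using d0_eq[OF dterm_var[of 0] dterm_var[of 0]] d0_not[OF d0_eq[OF dterm_var[of 0] dterm_var[of 0]]]
  by (cases c) simp_all

lemmas d0_intros = d0_const d0_eq d0_less d0_mem d0_not d0_imp d0_conj d0_disj d0_ball d0_bex dterm_intros

definition s1 :: "((nat \<Rightarrow> number) \<Rightarrow> bool) \<Rightarrow> bool" where
  "s1 Q \<longleftrightarrow> (\<exists>R. d0 (\<lambda>e. R (e 0) (\<lambda>n. e (Suc n))) \<and> (\<forall>e. Q e \<longleftrightarrow> (\<exists>x. R x e)))"

lemma s1_Sigma1: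
  assumes "s1 Q"
  shows "\<exists>\<theta>. Delta0 \<theta> \<and> (\<forall>e. Q e \<longleftrightarrow> sat sets (mix e) set_of (ExN \<theta>))"
proof -
  obtain R where R: "d0 (\<lambda>e. R (e 0) (\<lambda>n. e (Suc n)))" "\<forall>e. Q e \<longleftrightarrow> (\<exists>x. R x e)"
    using assms unfolding s1_def by blast
  obtain \<phi> where \<phi>: "Delta0 \<phi>" "\<forall>e. R (e 0) (\<lambda>n. e (Suc n)) \<longleftrightarrow> sat sets (mix e) set_of \<phi>"
    using R(1) unfolding d0_def by blast
  have "R x e \<longleftrightarrow> sat sets (mix (case_nat x e)) set_of \<phi>" for x e
    using \<phi>(2)[rule_format, of "case_nat x e"] by simp
  then have "Q e \<longleftrightarrow> sat sets (mix e) set_of (ExN (subst unmix (\<lambda>X. X) \<phi>))" for e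
    by (simp add: R(2) sat_unmix)
  then show ?thesis using Delta0_subst[OF \<phi>(1)] by blast
qed

text \<open>The schemes of induction and comprehension act on variable 0 over a fixed assignment
  \<open>E\<close> of the others. With a constant tail the interleaved environment depends on x at
  index 0 alone, hence has this shape.\<close>

lemma case_nat_mix: "\<exists>E. \<forall>x. case_nat x E = mix (case_nat x (\<lambda>_. 0))"
proof -
  have "case_nat x (\<lambda>i. mix (\<lambda>_. 0) (Suc i)) = mix (case_nat x (\<lambda>_. 0))" for x
  proof
    fix i show "case_nat x (\<lambda>i. mix (\<lambda>_. 0) (Suc i)) i = mix (case_nat x (\<lambda>_. 0)) i"
    proof (cases i)
      case (Suc j)
      have "case_nat y (\<lambda>_. 0) (i div 2) = (0::number)" if "even i" for y
        using that Suc by (auto elim!: evenE split: nat.split)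
      from this[of x] this[of 0] show ?thesis by (simp add: Suc mix_def)
    qed (simp add: mix_def)
  qed
  then show ?thesis by blast
qed

lemma s1_induct:
  assumes "s1 (\<lambda>e. P (e 0))" and "P 0" and "\<And>x. P x \<Longrightarrow> P (x + 1)"
  shows "P x"
proof -
  obtain \<theta> where \<theta>: "Delta0 \<theta>" "\<And>e. P (e 0) \<longleftrightarrow> sat sets (mix e) set_of (ExN \<theta>)"
    using s1_Sigma1[OF assms(1)] by blast
  let ?\<phi> = "ExN \<theta>"
  obtain E where E: "\<And>x. case_nat x E = mix (case_nat x (\<lambda>_. 0))" using case_nat_mix by blast
  have P: "sat sets (case_nat x E) set_of ?\<phi> \<longleftrightarrow> P x" for x
    using \<theta>(2)[of "case_nat x (\<lambda>_. 0)"] by (simp only: E nat.case)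
  have step: "(\<lambda>n. eval (case_nat x E) (case_nat (Plus (Var 0) One) (\<lambda>n. Var (Suc n)) n))
        = case_nat (x + 1) E" for x
    by (rule HOL.ext) (simp split: nat.split)
  have "sat sets E set_of (induction_axiom ?\<phi>)"
    using induction_axiom_valid[of ?\<phi>] \<theta>(1) unfolding valid_def Sigma1_def by blast
  then show ?thesis
    unfolding induction_axiom_def sat.simps(5,6) sat_And sat_instN sat_subst step P
    using assms(2,3) by (simp add: P)
qed

lemma s1_d0: "d0 Q \<Longrightarrow> s1 Q"
  unfolding s1_def by (rule exI[of _ "\<lambda>x. Q"]) (auto intro: d0_subst[where s="\<lambda>n e. e (Suc n)", OF dterm_var])

lemmas d0_induct = s1_induct[OF s1_d0]

section \<open>Arithmetic\<close>

lemma number_add_0_left: "0 + n = (n::number)"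
  by (rule d0_induct[where P="\<lambda>n. 0 + n = n"])
    (intro d0_intros, simp_all add: basic_axioms_number)

lemma number_add_1_left: "(m + 1) + n = (m + n) + (1::number)"
  by (rule d0_induct[where P="\<lambda>n. (m + 1) + n = (m + n) + 1"])
    (intro d0_intros, simp_all add: basic_axioms_number)

lemma number_add_commute: "m + n = n + (m::number)"
  by (rule d0_induct[where P="\<lambda>n. m + n = n + m"])
    (intro d0_intros, metis basic_axioms_number(3) number_add_0_left,
     metis basic_axioms_number(4) number_add_1_left)

lemma number_add_assoc: "(m + n) + k = m + (n + (k::number))"
  by (rule d0_induct[where P="\<lambda>k. (m + n) + k = m + (n + k)"])
    (intro d0_intros, simp_all add: basic_axioms_number)

instance number :: comm_monoid_add
  by standard (rule number_add_assoc number_add_commute number_add_0_left)+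

lemma number_mult_0_left: "0 * n = (0::number)"
  by (rule d0_induct[where P="\<lambda>n. 0 * n = 0"])
    (intro d0_intros, simp_all add: basic_axioms_number)

lemma number_mult_1_left: "(m + 1) * n = m * n + (n::number)"
  by (rule d0_induct[where P="\<lambda>n. (m + 1) * n = m * n + n"])
    (intro d0_intros, simp_all add: basic_axioms_number(5,6) ac_simps)

lemma number_mult_commute: "m * n = n * (m::number)"
  by (rule d0_induct[where P="\<lambda>n. m * n = n * m"])
    (intro d0_intros, metis basic_axioms_number(5) number_mult_0_left,
     metis basic_axioms_number(6) number_mult_1_left)

lemma number_mult_1: "1 * n = (n::number)"
  using number_mult_1_left[of 0 n] by (simp add: number_mult_0_left)

lemma number_mult_1_right: "n * 1 = (n::number)"
  by (metis number_mult_1 number_mult_commute)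

lemma number_distrib: "m * (n + k) = m * n + m * (k::number)"
  by (rule d0_induct[where P="\<lambda>k. m * (n + k) = m * n + m * k"])
    (intro d0_intros, simp_all add: basic_axioms_number(5,6) flip: add.assoc)

lemma number_mult_assoc: "(m * n) * k = m * (n * (k::number))"
  by (rule d0_induct[where P="\<lambda>k. (m * n) * k = m * (n * k)"])
    (intro d0_intros, simp_all add: basic_axioms_number(5,6) number_distrib number_mult_1_right)

instance number :: comm_semiring_1
proof
  fix a b c :: number
  show "(a + b) * c = a * c + b * c" by (metis number_distrib number_mult_commute)
  show "(0::number) \<noteq> 1" using basic_axioms_number(1)[of 0] by simp
qed (auto simp: number_mult_assoc number_mult_1 number_mult_0_left intro: number_mult_commute,
     metis number_mult_0_left number_mult_commute)

lemma number_less_plus: "m < m + (k + 1 :: number)"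
  by (rule d0_induct[where P="\<lambda>k. m < m + (k + 1)"])
    (intro d0_intros, simp_all add: basic_axioms_number(8) flip: add.assoc)

lemma number_less_imp_plus: "m < n \<Longrightarrow> \<exists>k. n = m + (k + 1 :: number)"
proof -
  \<comment> \<open>The existential quantifier is moved in front of the implication to put the claim
    into Sigma_1 form.\<close>
  have "\<exists>k. m < n \<longrightarrow> n = m + (k + 1)"
  proof (rule s1_induct[where P="\<lambda>n. \<exists>k. m < n \<longrightarrow> n = m + (k + 1)"])
    show "s1 (\<lambda>e. \<exists>k. m < e 0 \<longrightarrow> e 0 = m + (k + 1))"
      unfolding s1_def
      by (intro exI[of _ "\<lambda>k e. m < e 0 \<longrightarrow> e 0 = m + (k + 1)"] conjI d0_intros) simp
    show "\<exists>k. m < 0 \<longrightarrow> 0 = m + (k + 1)" by (simp add: basic_axioms_number(7))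
    fix n assume "\<exists>k. m < n \<longrightarrow> n = m + (k + 1)"
    then obtain k where "m < n \<longrightarrow> n = m + (k + 1)" by blast
    then show "\<exists>k. m < n + 1 \<longrightarrow> n + 1 = m + (k + 1)"
      by (metis add.assoc add_0 basic_axioms_number(8))
  qed
  then show "m < n \<Longrightarrow> \<exists>k. n = m + (k + 1)" by blast
qed

lemma number_less_iff: "m < n \<longleftrightarrow> (\<exists>k. n = m + (k + 1 :: number))"
  using number_less_imp_plus number_less_plus by blast

lemma number_add_cancel: "a + b = a + c \<longleftrightarrow> b = (c::number)"
proof -
  have "a + b = a + c \<longrightarrow> b = c"
    by (rule d0_induct[where P="\<lambda>a. a + b = a + c \<longrightarrow> b = c"])
      (intro d0_intros, auto simp: number_add_1_left dest: basic_axioms_number(2))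
  then show ?thesis by blast
qed

lemma number_cases: "n = 0 \<or> (\<exists>k. n = k + (1::number))"
proof -
  have "n = 0 \<or> 0 < n"
    by (rule d0_induct[where P="\<lambda>n. n = 0 \<or> 0 < n"])
      (intro d0_intros, auto simp: basic_axioms_number(8))
  then show ?thesis by (auto simp: number_less_iff)
qed

lemma number_irrefl: "\<not> n < (n::number)"
  by (metis add.right_neutral basic_axioms_number(1) number_add_cancel number_less_iff)

lemma number_trans: "a < b \<Longrightarrow> b < c \<Longrightarrow> a < (c::number)"
  unfolding number_less_iff by (metis add.assoc)

lemma number_linear: "m < n \<or> m = n \<or> n < (m::number)"
proof (rule d0_induct[where P="\<lambda>n. m < n \<or> m = n \<or> n < m"])
  show "m < 0 \<or> m = 0 \<or> 0 < m"
    using number_cases[of m] by (auto simp: number_less_iff)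
  fix n assume "m < n \<or> m = n \<or> n < m"
  then consider "m < n + 1" | k where "m = n + (k + 1)"
    by (auto simp: basic_axioms_number(8) number_less_iff[of n m])
  then show "m < n + 1 \<or> m = n + 1 \<or> n + 1 < m"
  proof cases
    case 2
    then show ?thesis using number_cases[of k] by (auto simp: number_less_iff ac_simps)
  qed simp
qed (intro d0_intros)

instance number :: linorder
proof
  fix x y z :: number
  show "x < y \<longleftrightarrow> x \<le> y \<and> \<not> y \<le> x"
    unfolding less_eq_number_def by (metis number_irrefl number_trans)
  show "x \<le> x" by (simp add: less_eq_number_def)
  show "x \<le> y \<Longrightarrow> y \<le> z \<Longrightarrow> x \<le> z"
    unfolding less_eq_number_def by (metis number_trans)
  show "x \<le> y \<Longrightarrow> y \<le> x \<Longrightarrow> x = y"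
    unfolding less_eq_number_def by (metis number_irrefl number_trans)
  show "x \<le> y \<or> y \<le> x"
    unfolding less_eq_number_def by (metis number_linear)
qed

lemma number_le_iff: "m \<le> n \<longleftrightarrow> (\<exists>k. n = m + (k::number))"
proof
  show "m \<le> n \<Longrightarrow> \<exists>k. n = m + k"
    unfolding less_eq_number_def number_less_iff by (metis add.right_neutral)
  show "\<exists>k. n = m + k \<Longrightarrow> m \<le> n"
    unfolding less_eq_number_def number_less_iff by (metis add.right_neutral number_cases)
qed

text \<open>Truncated subtraction is part of the class \<open>discrete_linordered_semidom\<close>;
  once the model is an instance, the general rules for ordered semirings apply to it.\<close>

instantiation number :: minus
begin
definition minus_number :: "number \<Rightarrow> number \<Rightarrow> number" where
  "minus_number a b = (if b \<le> a then (THE c. a = b + c) else 0)"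
instance ..
end

lemma number_diff_eq: "(b + c) - b = (c::number)"
  unfolding minus_number_def using number_le_iff by (auto simp: number_add_cancel)

lemma number_diff_diff: "(a - b) - c = a - (b + (c::number))"
proof (cases "b + c \<le> a")
  case True
  then obtain k where "a = b + (c + k)" unfolding number_le_iff by (auto simp: add.assoc)
  then show ?thesis by (metis add.assoc number_diff_eq)
next
  case False
  then have "a - (b + c) = 0" by (simp add: minus_number_def)
  moreover have "(a - b) - c = 0"
  proof (cases "b \<le> a")
    case True
    then obtain k where k: "a = b + k" unfolding number_le_iff by blast
    then have "\<not> c \<le> k" using False unfolding number_le_iff by (auto simp: add.assoc)
    then show ?thesis by (simp add: k number_diff_eq) (simp add: minus_number_def)
  next
    case False
    then have "a - b = 0" by (simp add: minus_number_def)
    moreover have "0 - c = 0"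
      using number_diff_eq[of 0 c] number_diff_eq[of c 0]
      by (auto simp: minus_number_def less_eq_number_def basic_axioms_number(7))
    ultimately show ?thesis by simp
  qed
  ultimately show ?thesis by simp
qed

lemma number_mult_strict_mono: "a < b \<Longrightarrow> 0 < c \<Longrightarrow> c * a < c * (b::number)"
proof -
  assume "a < b" "0 < c"
  then obtain k l where "b = a + (k + 1)" "c = l + 1" unfolding number_less_iff by auto
  then have "c * b = c * a + ((c * k + l) + 1)" by (simp add: algebra_simps)
  then show "c * a < c * b" unfolding number_less_iff by blast
qed

lemma number_diff_distrib: "a * (b - c) = a * b - a * (c::number)"
proof (cases "c \<le> b")
  case True
  then show ?thesis unfolding number_le_iff by (auto simp: number_diff_eq number_distrib)
next
  case False
  show ?thesis
  proof (cases "a = 0")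
    case True
    then show ?thesis using number_diff_eq[of 0 0] by simp
  next
    case a: False
    have "b < c" using False by simp
    then have "a * b < a * c"
      using a number_cases[of a] by (intro number_mult_strict_mono) (auto simp: number_less_iff)
    then have "\<not> a * c \<le> a * b" by simp
    then show ?thesis using False by (simp add: minus_number_def)
  qed
qed

instance number :: discrete_linordered_semidom
proof
  fix a b c :: number
  show "a + b - a = b" by (rule number_diff_eq)
  show "a - b - c = a - (b + c)" by (rule number_diff_diff)
  show "a * (b - c) = a * b - a * c" by (rule number_diff_distrib)
  show "a \<le> b \<Longrightarrow> c + a \<le> c + b"
    unfolding number_le_iff by (metis add.assoc)
  show "a < b \<Longrightarrow> 0 < c \<Longrightarrow> c * a < c * b" by (rule number_mult_strict_mono)
  show "(0::number) < 1" using number_less_plus[of 0 0] by simp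
  show "b \<le> a \<Longrightarrow> a - b + b = a"
    unfolding number_le_iff by (metis number_diff_eq add.commute)
  show "a < b \<longleftrightarrow> a + 1 \<le> b"
    unfolding number_le_iff number_less_iff by (simp add: ac_simps)
  show "a * b \<noteq> 0" if nz: "a \<noteq> 0" "b \<noteq> 0"
  proof -
    obtain x y where "a = x + 1" "b = y + 1" using nz number_cases[of a] number_cases[of b] by blast
    then have "a * b = (x * y + x + y) + 1" by (simp add: algebra_simps)
    then show ?thesis by (metis basic_axioms_number(1))
  qed
qed

lemma number_less_Suc: "m < n + 1 \<longleftrightarrow> m \<le> (n::number)"
  by (rule less_eq_iff_succ_less[symmetric])

lemma number_Suc_le: "m + 1 \<le> n \<longleftrightarrow> m < (n::number)"
  by (rule less_iff_succ_less_eq[symmetric])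

lemma number_zero_le [simp]: "0 \<le> (n::number)"
  using basic_axioms_number(7) linorder_not_less by blast

lemma number_not_less_zero [simp]: "\<not> n < (0::number)"
  by (rule basic_axioms_number(7))

lemma number_less_one [simp]: "n < 1 \<longleftrightarrow> n = (0::number)"
  using number_less_Suc[of n 0] by (auto intro: antisym)

section \<open>Computable predicates and functions\<close>

abbreviation tail :: "(nat \<Rightarrow> number) \<Rightarrow> nat \<Rightarrow> number" where "tail e \<equiv> \<lambda>n. e (Suc n)"

lemma dterm_tail: "dterm t \<Longrightarrow> dterm (\<lambda>e. t (tail e))"
proof -
  assume "dterm t"
  then obtain u where u: "\<And>e. t e = eval (mix e) u" unfolding dterm_def by blast
  let ?\<sigma> = "\<lambda>i. if even i then Var (i + 2) else Var i"
  have "(\<lambda>i. eval (mix e) (?\<sigma> i)) = mix (tail e)" for e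
    by (rule HOL.ext) (simp add: mix_def)
  then have "t (tail e) = eval (mix e) (subst_tm ?\<sigma> u)" for e
    by (simp add: u eval_subst)
  then show ?thesis unfolding dterm_def by blast
qed

lemma d0_reindex:
  assumes "d0 (\<lambda>e. R (e 0) (tail e))" "dterm t" "\<And>n. dterm (s n)"
  shows "d0 (\<lambda>e. R (t e) (\<lambda>n. s n e))"
proof -
  have "d0 (\<lambda>e. R (case_nat t s 0 e) (\<lambda>n. case_nat t s (Suc n) e))"
    by (rule d0_subst[OF _ assms(1)]) (simp add: assms split: nat.split)
  then show ?thesis by simp
qed

lemma s1I: "d0 (\<lambda>e. R (e 0) (tail e)) \<Longrightarrow> (\<And>e. Q e \<longleftrightarrow> (\<exists>x. R x e)) \<Longrightarrow> s1 Q"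
  unfolding s1_def by blast

lemma s1E:
  assumes "s1 Q"
  obtains R where "d0 (\<lambda>e. R (e 0) (tail e))" "\<And>e. Q e \<longleftrightarrow> (\<exists>x. R x e)"
  using assms unfolding s1_def by blast

lemma s1_subst:
  assumes "s1 Q" "\<And>n. dterm (s n)"
  shows "s1 (\<lambda>e. Q (\<lambda>n. s n e))"
proof -
  obtain R where R: "d0 (\<lambda>e. R (e 0) (tail e))" "\<And>e. Q e \<longleftrightarrow> (\<exists>x. R x e)"
    using assms(1) by (rule s1E) blast
  have "d0 (\<lambda>e. R (e 0) (\<lambda>n. s n (tail e)))"
    by (intro d0_reindex[OF R(1), of "\<lambda>e. e 0" "\<lambda>n e. s n (tail e)"] dterm_var dterm_tail assms)
  then show ?thesis by (rule s1I) (simp add: R(2))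
qed

lemma ex_less_max: "\<exists>b. x < b \<and> y < (b::number)"
  by (rule exI[of _ "max x y + 1"]) (simp add: number_less_Suc)

text \<open>Two unbounded witnesses are replaced by one number b exceeding both, below which they
  are sought by bounded quantifiers. \<open>s1_ex\<close> merges consecutive existential quantifiers
  in the same way.\<close>

lemma s1_conj:
  assumes "s1 P" "s1 Q" shows "s1 (\<lambda>e. P e \<and> Q e)"
proof -
  obtain R where R: "d0 (\<lambda>e. R (e 0) (tail e))" "\<And>e. P e \<longleftrightarrow> (\<exists>x. R x e)"
    using assms(1) by (rule s1E) blast
  obtain R' where R': "d0 (\<lambda>e. R' (e 0) (tail e))" "\<And>e. Q e \<longleftrightarrow> (\<exists>x. R' x e)"
    using assms(2) by (rule s1E) blast
  show ?thesis
  proof (rule s1I[where R="\<lambda>b e. (\<exists>x<b. R x e) \<and> (\<exists>x<b. R' x e)"])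
    show "d0 (\<lambda>e. (\<exists>x<e 0. R x (tail e)) \<and> (\<exists>x<e 0. R' x (tail e)))"
      by (intro d0_intros d0_reindex[OF R(1)] d0_reindex[OF R'(1)])
    show "P e \<and> Q e \<longleftrightarrow> (\<exists>b. (\<exists>x<b. R x e) \<and> (\<exists>x<b. R' x e))" for e
      unfolding R R' using ex_less_max by blast
  qed
qed

lemma s1_disj:
  assumes "s1 P" "s1 Q" shows "s1 (\<lambda>e. P e \<or> Q e)"
proof -
  obtain R where R: "d0 (\<lambda>e. R (e 0) (tail e))" "\<And>e. P e \<longleftrightarrow> (\<exists>x. R x e)"
    using assms(1) by (rule s1E) blast
  obtain R' where R': "d0 (\<lambda>e. R' (e 0) (tail e))" "\<And>e. Q e \<longleftrightarrow> (\<exists>x. R' x e)"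
    using assms(2) by (rule s1E) blast
  show ?thesis
  proof (rule s1I[where R="\<lambda>b e. R b e \<or> R' b e"])
    show "d0 (\<lambda>e. R (e 0) (tail e) \<or> R' (e 0) (tail e))"
      by (intro d0_disj R R')
  qed (auto simp: R R')
qed

lemma s1_ex:
  assumes "s1 (\<lambda>e. P (e 0) (tail e))" shows "s1 (\<lambda>e. \<exists>y. P y e)"
proof -
  obtain R where R: "d0 (\<lambda>e. R (e 0) (tail e))" "\<And>e. P (e 0) (tail e) \<longleftrightarrow> (\<exists>x. R x e)"
    using assms by (rule s1E) blast
  have P: "P y e \<longleftrightarrow> (\<exists>x. R x (case_nat y e))" for y e
    using R(2)[of "case_nat y e"] by simp
  show ?thesis
  proof (rule s1I[where R="\<lambda>b e. \<exists>y<b. \<exists>x<b. R x (case_nat y e)"])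
    have "d0 (\<lambda>e. R (e 0) (\<lambda>n. case_nat (\<lambda>e. e (Suc 0)) (\<lambda>n e. e (Suc (Suc (Suc n)))) n e))"
      by (rule d0_reindex[OF R(1)]) (auto intro: dterm_var split: nat.split)
    moreover have "(\<lambda>n. case_nat (\<lambda>e. e (Suc 0)) (\<lambda>n e. e (Suc (Suc (Suc n)))) n e)
        = case_nat (e (Suc 0)) (\<lambda>n. e (Suc (Suc (Suc n))))" for e :: "nat \<Rightarrow> number"
      by (rule HOL.ext) (simp split: nat.split)
    ultimately have "d0 (\<lambda>e. R (e 0) (case_nat (e (Suc 0)) (\<lambda>n. e (Suc (Suc (Suc n))))))"
      by simp
    then show "d0 (\<lambda>e. \<exists>y<e 0. \<exists>x<e 0. R x (case_nat y (tail e)))"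
      by (intro d0_bex dterm_var)
    show "(\<exists>y. P y e) \<longleftrightarrow> (\<exists>b. \<exists>y<b. \<exists>x<b. R x (case_nat y e))" for e
      unfolding P using ex_less_max by blast
  qed
qed

text \<open>This is the \<open>\<Sigma>\<^sub>1\<close> collection principle.\<close>

lemma s1_ball_dterm:
  assumes t: "dterm t" and "s1 (\<lambda>e. P (e 0) (tail e))" shows "s1 (\<lambda>e. \<forall>x<t e. P x e)"
proof -
  obtain R where R: "d0 (\<lambda>e. R (e 0) (tail e))" "\<And>e. P (e 0) (tail e) \<longleftrightarrow> (\<exists>x. R x e)"
    using assms(2) by (rule s1E) blast
  have P: "P y e \<longleftrightarrow> (\<exists>x. R x (case_nat y e))" for y e
    using R(2)[of "case_nat y e"] by simp
  have R': "d0 (\<lambda>e. R (e 0) (case_nat (e (Suc 0)) (\<lambda>n. s n e)))" if "\<And>n. dterm (s n)" for s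
  proof -
    have "d0 (\<lambda>e. R (e 0) (\<lambda>n. case_nat (\<lambda>e. e (Suc 0)) s n e))"
      by (rule d0_reindex[OF R(1)]) (auto intro: dterm_var that split: nat.split)
    moreover have "(\<lambda>n. case_nat (\<lambda>e. e (Suc 0)) s n e) = case_nat (e (Suc 0)) (\<lambda>n. s n e)" for e
      by (rule HOL.ext) (simp split: nat.split)
    ultimately show ?thesis by simp
  qed
  show ?thesis
  proof (rule s1I[where R="\<lambda>b e. \<forall>x<t e. \<exists>y<b. R y (case_nat x e)"])
    show "d0 (\<lambda>e. \<forall>x<t (tail e). \<exists>y<e 0. R y (case_nat x (tail e)))"
      by (intro d0_ball d0_bex dterm_var dterm_tail t R')
    show "(\<forall>x<t e. P x e) \<longleftrightarrow> (\<exists>b. \<forall>x<t e. \<exists>y<b. R y (case_nat x e))" for e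
    proof
      assume all: "\<forall>x<t e. P x e"
      define c where "c = t e"
      \<comment> \<open>The guard \<open>x < c\<close> makes the claim meaningful for every m, so
        that the induction on m can run unrestricted and is then read off at m = c.\<close>
      have "\<exists>b. \<forall>x<m. x < c \<longrightarrow> (\<exists>y<b. R y (case_nat x e))" for m
      proof (rule s1_induct[where P="\<lambda>m. \<exists>b. \<forall>x<m. x < c \<longrightarrow> (\<exists>y<b. R y (case_nat x e))"])
        show "s1 (\<lambda>e'. \<exists>b. \<forall>x<e' 0. x < c \<longrightarrow> (\<exists>y<b. R y (case_nat x e)))"
          by (rule s1I[where R="\<lambda>b e'. \<forall>x<e' 0. x < c \<longrightarrow> (\<exists>y<b. R y (case_nat x e))"])
            (intro d0_intros R', simp)
        show "\<exists>b. \<forall>x<0. x < c \<longrightarrow> (\<exists>y<b. R y (case_nat x e))" by simp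
        fix m assume "\<exists>b. \<forall>x<m. x < c \<longrightarrow> (\<exists>y<b. R y (case_nat x e))"
        then obtain b where b: "\<forall>x<m. x < c \<longrightarrow> (\<exists>y<b. R y (case_nat x e))" by blast
        obtain y where y: "m < c \<longrightarrow> R y (case_nat m e)" using all P c_def by blast
        have "\<forall>x<m + 1. x < c \<longrightarrow> (\<exists>z<max b (y + 1). R z (case_nat x e))"
          using b y by (auto simp: number_less_Suc less_max_iff_disj dest!: le_imp_less_or_eq)
        then show "\<exists>b. \<forall>x<m + 1. x < c \<longrightarrow> (\<exists>y<b. R y (case_nat x e))" by blast
      qed
      from this[of c] show "\<exists>b. \<forall>x<t e. \<exists>y<b. R y (case_nat x e)" by (auto simp: c_def)
    qed (auto simp: P)
  qed
qed

definition d1 :: "((nat \<Rightarrow> number) \<Rightarrow> bool) \<Rightarrow> bool" where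
  "d1 Q \<longleftrightarrow> s1 Q \<and> s1 (\<lambda>e. \<not> Q e)"

definition dt :: "((nat \<Rightarrow> number) \<Rightarrow> number) \<Rightarrow> bool" where
  "dt t \<longleftrightarrow> d1 (\<lambda>e. t (tail e) = e 0)"

lemma d1_d0: "d0 Q \<Longrightarrow> d1 Q"
  by (simp add: d1_def s1_d0 d0_not)

lemma dt_dterm: "dterm t \<Longrightarrow> dt t"
  unfolding dt_def by (intro d1_d0 d0_eq dterm_tail dterm_var)

lemma d1_reindex: "d1 Q \<Longrightarrow> d1 (\<lambda>e. Q (\<lambda>n. e (r n)))"
  unfolding d1_def
  using s1_subst[of Q "\<lambda>n e. e (r n)"] s1_subst[of "\<lambda>e. \<not> Q e" "\<lambda>n e. e (r n)"] dterm_var by blast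

lemma d1_const: "d1 (\<lambda>e. c)"
  by (intro d1_d0 d0_const)

lemma d1_not: "d1 P \<Longrightarrow> d1 (\<lambda>e. \<not> P e)"
  by (simp add: d1_def)

lemma d1_conj: "d1 P \<Longrightarrow> d1 Q \<Longrightarrow> d1 (\<lambda>e. P e \<and> Q e)"
  unfolding d1_def de_Morgan_conj by (elim conjE, intro conjI s1_conj s1_disj)

lemma d1_disj: "d1 P \<Longrightarrow> d1 Q \<Longrightarrow> d1 (\<lambda>e. P e \<or> Q e)"
  unfolding d1_def de_Morgan_disj by (elim conjE, intro conjI s1_conj s1_disj)

lemma d1_imp: "d1 P \<Longrightarrow> d1 Q \<Longrightarrow> d1 (\<lambda>e. P e \<longrightarrow> Q e)"
  unfolding imp_conv_disj by (rule d1_disj[OF d1_not])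

text \<open>The value v of the function exists and is unique, so both the predicate at that value
  and its negation can be expressed as "for some v equal to the value, ...", which is
  Sigma_1.\<close>

lemma d1_subst:
  assumes "d1 (\<lambda>e. P (e 0) (tail e))" "dt t"
  shows "d1 (\<lambda>e. P (t e) e)"
proof -
  have s1: "s1 (\<lambda>e. t (tail e) = e 0)" "s1 (\<lambda>e. P (e 0) (tail e))" "s1 (\<lambda>e. \<not> P (e 0) (tail e))"
    using assms by (simp_all add: d1_def dt_def)
  have "s1 (\<lambda>e. \<exists>v. t e = v \<and> P v e)" by (intro s1_ex s1_conj s1)
  moreover have "s1 (\<lambda>e. \<exists>v. t e = v \<and> \<not> P v e)" by (intro s1_ex s1_conj s1)
  ultimately show ?thesis by (simp add: d1_def)
qed

lemma dt_reindex:
  assumes "dt t" shows "dt (\<lambda>e. t (\<lambda>n. e (r n)))"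
  using d1_reindex[OF assms[unfolded dt_def], of "case_nat 0 (\<lambda>n. Suc (r n))"]
  unfolding dt_def by simp

lemma dt_tail: "dt t \<Longrightarrow> dt (\<lambda>e. t (tail e))"
  by (rule dt_reindex)

lemma dt_subst:
  assumes "dt (\<lambda>e. f (e 0) (tail e))" "dt t"
  shows "dt (\<lambda>e. f (t e) e)"
  unfolding dt_def
proof (rule d1_subst[where P="\<lambda>v e. f v (tail e) = e 0" and t="\<lambda>e. t (tail e)"])
  show "d1 (\<lambda>e. f (e 0) (tail (tail e)) = tail e 0)"
    using d1_reindex[OF assms(1)[unfolded dt_def], of "case_nat (Suc 0) (case_nat 0 (\<lambda>n. Suc (Suc n)))"]
    by simp
qed (intro dt_tail assms)

lemma dt_var: "dt (\<lambda>e. e n)" by (intro dt_dterm dterm_var)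
lemma dt_const: "dt (\<lambda>e. c)" by (intro dt_dterm dterm_const)

lemma dt_fn1: "dt (\<lambda>e. f (e 0)) \<Longrightarrow> dt t \<Longrightarrow> dt (\<lambda>e. f (t e))"
  by (rule dt_subst)

lemma dt_fn2:
  assumes "dt (\<lambda>e. f (e 0) (e 1))" "dt s" "dt t"
  shows "dt (\<lambda>e. f (s e) (t e))"
proof (rule dt_subst[where f="\<lambda>v e. f v (t e)"])
  show "dt (\<lambda>e. f (e 0) (t (tail e)))"
  proof (rule dt_subst[where f="\<lambda>v e. f (e 0) v"])
    show "dt (\<lambda>e. f (tail e 0) (e 0))"
      using dt_reindex[OF assms(1), of "case_nat 1 (\<lambda>_. 0)"] by simp
  qed (intro dt_tail assms)
qed fact

lemma d1_rel2:
  assumes "d1 (\<lambda>e. P (e 0) (e 1))" "dt s" "dt t"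
  shows "d1 (\<lambda>e. P (s e) (t e))"
proof (rule d1_subst[where P="\<lambda>v e. P v (t e)"])
  show "d1 (\<lambda>e. P (e 0) (t (tail e)))"
  proof (rule d1_subst[where P="\<lambda>v e. P (e 0) v"])
    show "d1 (\<lambda>e. P (tail e 0) (e 0))"
      using d1_reindex[OF assms(1), of "case_nat 1 (\<lambda>_. 0)"] by simp
  qed (intro dt_tail assms)
qed fact

lemma dt_plus: "dt s \<Longrightarrow> dt t \<Longrightarrow> dt (\<lambda>e. s e + t e)"
  by (rule dt_fn2[where f="(+)"]) (intro dt_dterm dterm_intros)

lemma dt_times: "dt s \<Longrightarrow> dt t \<Longrightarrow> dt (\<lambda>e. s e * t e)"
  by (rule dt_fn2[where f="(*)"]) (intro dt_dterm dterm_intros)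

lemma d1_eq: "dt s \<Longrightarrow> dt t \<Longrightarrow> d1 (\<lambda>e. s e = t e)"
  by (rule d1_rel2[where P="(=)"]) (intro d1_d0 d0_intros)

lemma d1_less: "dt s \<Longrightarrow> dt t \<Longrightarrow> d1 (\<lambda>e. s e < t e)"
  by (rule d1_rel2[where P="(<)"]) (intro d1_d0 d0_intros)

lemma d1_le: "dt s \<Longrightarrow> dt t \<Longrightarrow> d1 (\<lambda>e. s e \<le> t e)"
  using d1_less[of s "\<lambda>e. t e + 1"] by (simp add: number_less_Suc dt_plus dt_const)

lemma d1_mem: "X \<in> sets \<Longrightarrow> dt t \<Longrightarrow> d1 (\<lambda>e. t e \<in> X)"
  by (rule d1_subst[where P="\<lambda>v e. v \<in> X"]) (intro d1_d0 d0_intros)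

lemma d1_ball:
  assumes "dt t" "d1 (\<lambda>e. P (e 0) (tail e))"
  shows "d1 (\<lambda>e. \<forall>x<t e. P x e)"
proof (rule d1_subst[where P="\<lambda>v e. \<forall>x<v. P x e"])
  have P: "d1 (\<lambda>e. P (e 0) (tail (tail e)))"
    using d1_reindex[OF assms(2), of "case_nat 0 (\<lambda>n. Suc (Suc n))"] by simp
  have "s1 (\<lambda>e. \<forall>x<e 0. P x (tail e))"
    using P unfolding d1_def by (intro s1_ball_dterm dterm_var) simp
  moreover have "s1 (\<lambda>e. \<exists>x. x < e 0 \<and> \<not> P x (tail e))"
    using P unfolding d1_def
    by (elim conjE, intro s1_ex s1_conj) (rule s1_d0, intro d0_intros)
  ultimately show "d1 (\<lambda>e. \<forall>x<e 0. P x (tail e))" by (simp add: d1_def)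
qed fact

lemma d1_bex: "dt t \<Longrightarrow> d1 (\<lambda>e. P (e 0) (tail e)) \<Longrightarrow> d1 (\<lambda>e. \<exists>x<t e. P x e)"
  using d1_not[OF d1_ball[of t "\<lambda>x e. \<not> P x e"]] d1_not by simp

lemma d1_ball_le: "dt t \<Longrightarrow> d1 (\<lambda>e. P (e 0) (tail e)) \<Longrightarrow> d1 (\<lambda>e. \<forall>x\<le>t e. P x e)"
  using d1_ball[of "\<lambda>e. t e + 1" P] by (simp add: number_less_Suc dt_plus dt_const)

lemma d1_bex_le: "dt t \<Longrightarrow> d1 (\<lambda>e. P (e 0) (tail e)) \<Longrightarrow> d1 (\<lambda>e. \<exists>x\<le>t e. P x e)"
  using d1_bex[of "\<lambda>e. t e + 1" P] by (simp add: number_less_Suc dt_plus dt_const)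

lemma d1_dvd: "dt s \<Longrightarrow> dt t \<Longrightarrow> d1 (\<lambda>e. s e dvd t e)"
proof -
  assume "dt s" "dt t"
  have "x dvd y \<longleftrightarrow> (\<exists>z\<le>y. y = x * z)" for x y :: number
  proof
    assume "x dvd y"
    then obtain z where z: "y = x * z" by blast
    show "\<exists>z\<le>y. y = x * z"
    proof (cases "x = 0")
      case True
      then show ?thesis using z by auto
    next
      case False
      then have "1 * z \<le> x * z"
        by (intro mult_right_mono) (auto simp: not_less[symmetric])
      then show ?thesis using z by auto
    qed
  qed auto
  moreover have "d1 (\<lambda>e. \<exists>z\<le>t e. t e = s e * z)"
    using \<open>dt s\<close> \<open>dt t\<close> by (intro d1_bex_le d1_eq dt_times dt_tail dt_var)
  ultimately show ?thesis by simp
qed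

lemma dt_if: "d1 P \<Longrightarrow> dt s \<Longrightarrow> dt t \<Longrightarrow> dt (\<lambda>e. if P e then s e else t e)"
proof -
  assume P: "d1 P" and s: "dt s" and t: "dt t"
  have "d1 (\<lambda>e. P (tail e) \<and> s (tail e) = e 0 \<or> \<not> P (tail e) \<and> t (tail e) = e 0)"
    using s t unfolding dt_def by (intro d1_conj d1_disj d1_not d1_reindex[OF P])
  then show ?thesis unfolding dt_def by (rule back_subst[of d1]) auto
qed

text \<open>The Pi_1 formula demanded by the axiom is obtained by negating a Sigma_1 definition of
  the complement.\<close>

lemma set_comprehension:
  assumes "d1 (\<lambda>e. P (e 0))" shows "{x. P x} \<in> sets"
proof -
  obtain \<theta> where \<theta>: "Delta0 \<theta>" "\<And>e. P (e 0) \<longleftrightarrow> sat sets (mix e) set_of (ExN \<theta>)"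
    using s1_Sigma1 assms unfolding d1_def by blast
  obtain \<theta>' where \<theta>': "Delta0 \<theta>'" "\<And>e. \<not> P (e 0) \<longleftrightarrow> sat sets (mix e) set_of (ExN \<theta>')"
    using s1_Sigma1[of "\<lambda>e. \<not> P (e 0)"] assms unfolding d1_def by blast
  define \<phi> \<psi> where "\<phi> = ExN \<theta>" and "\<psi> = AllN (Imp \<theta>' Bot)"
  obtain E where E: "\<And>x. case_nat x E = mix (case_nat x (\<lambda>_. 0))" using case_nat_mix by blast
  have P: "sat sets (case_nat x E) set_of \<phi> \<longleftrightarrow> P x" for x
    using \<theta>(2)[of "case_nat x (\<lambda>_. 0)"] by (simp only: E nat.case \<phi>_def)
  have P': "sat sets (case_nat x E) set_of \<psi> \<longleftrightarrow> P x" for x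
    using \<theta>'(2)[of "case_nat x (\<lambda>_. 0)"] by (simp only: E nat.case \<psi>_def) auto
  have "Delta0 (Imp \<theta>' Bot)" using \<theta>'(1) by (intro Delta0.intros)
  then have "Sigma1 \<phi>" "Pi1 \<psi>"
    using \<theta>(1) unfolding Sigma1_def Pi1_def \<phi>_def \<psi>_def by blast+
  then have "valid sets (comprehension_axiom \<phi> \<psi>)" by (rule comprehension_axiom_valid)
  then have "sat sets E set_of (comprehension_axiom \<phi> \<psi>)" by (simp add: valid_def)
  then have "\<exists>X\<in>sets. \<forall>x. x \<in> X \<longleftrightarrow> P x"
    unfolding comprehension_axiom_def sat.simps(5,6) sat_Iff sat_ExS sat_shiftS P P' by simp
  then obtain X where "X \<in> sets" "\<forall>x. x \<in> X \<longleftrightarrow> P x" by blast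
  moreover from this have "{x. P x} = X" by blast
  ultimately show ?thesis by simp
qed

lemmas d1_induct = s1_induct[OF d1_def[THEN iffD1, THEN conjunct1]]

text \<open>The order of the model need not be a well-order, so \<open>LEAST\<close> is under
  control for definable predicates only. If there were no least element, induction on y would show
  that nothing below y satisfies \<open>P\<close>.\<close>

lemma d1_least:
  assumes "d1 (\<lambda>e. P (e 0))" "P x"
  shows "P (LEAST x. P x)" "y < (LEAST x. P x) \<Longrightarrow> \<not> P y"
proof -
  have "\<exists>y. P y \<and> (\<forall>z<y. \<not> P z)"
  proof (rule ccontr)
    assume no: "\<not> (\<exists>y. P y \<and> (\<forall>z<y. \<not> P z))"
    have "\<forall>z<y. \<not> P z" for y
    proof (rule d1_induct[where P="\<lambda>y. \<forall>z<y. \<not> P z"])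
      have "d1 (\<lambda>e. \<not> P (e 0))" by (intro d1_not assms)
      then show "d1 (\<lambda>e. \<forall>z<e 0. \<not> P z)" by (intro d1_ball dt_var)
      fix y assume "\<forall>z<y. \<not> P z"
      then show "\<forall>z<y + 1. \<not> P z" using no by (auto simp: number_less_Suc dest: le_imp_less_or_eq)
    qed simp
    then show False using assms(2) less_add_one by blast
  qed
  then obtain y where y: "P y" "\<forall>z<y. \<not> P z" by blast
  then have "(LEAST x. P x) = y" by (intro Least_equality) (auto simp: not_less[symmetric])
  with y show "P (LEAST x. P x)" "y < (LEAST x. P x) \<Longrightarrow> \<not> P y" for y by auto
qed

text \<open>Freezes the remaining variables at the values \<open>e'\<close>, which are then
  parameters; \<open>dt_least\<close> needs this to apply \<open>d1_least\<close> at a fixed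
  environment.\<close>

lemma d1_fix: "d1 (\<lambda>e. P (e 0) (tail e)) \<Longrightarrow> d1 (\<lambda>e. P (e 0) e')"
proof -
  let ?s = "case_nat (\<lambda>e. e 0) (\<lambda>n e. e' n)"
  have "s1 (\<lambda>e. Q (e 0) e')" if "s1 (\<lambda>e. Q (e 0) (tail e))" for Q
  proof -
    have "s1 (\<lambda>e. Q (?s 0 e) (\<lambda>n. ?s (Suc n) e))"
      using that by (rule s1_subst) (auto intro: dterm_intros split: nat.split)
    then show ?thesis by simp
  qed
  note * = this
  show "d1 (\<lambda>e. P (e 0) (tail e)) \<Longrightarrow> d1 (\<lambda>e. P (e 0) e')"
    unfolding d1_def using *[of P] *[of "\<lambda>x e. \<not> P x e"] by simp
qed

text \<open>The graph says that v satisfies \<open>P\<close> and that no smaller number does, which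
  costs a bounded quantifier only.\<close>

lemma dt_least:
  assumes "d1 (\<lambda>e. P (e 0) (tail e))" "\<And>e. \<exists>x. P x e"
  shows "dt (\<lambda>e. LEAST x. P x e)"
proof -
  have eq: "(LEAST x. P x e) = v \<longleftrightarrow> P v e \<and> (\<forall>x<v. \<not> P x e)" for v e
  proof
    obtain x where "P x e" using assms(2) by blast
    then have "P (LEAST x. P x e) e" "\<And>y. y < (LEAST x. P x e) \<Longrightarrow> \<not> P y e"
      using d1_least[OF d1_fix[OF assms(1)]] by blast+
    then show "(LEAST x. P x e) = v \<Longrightarrow> P v e \<and> (\<forall>x<v. \<not> P x e)" by blast
  next
    show "P v e \<and> (\<forall>x<v. \<not> P x e) \<Longrightarrow> (LEAST x. P x e) = v"
      by (intro Least_equality) (auto simp: not_less[symmetric])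
  qed
  have "d1 (\<lambda>e. P (e 0) (tail (tail e)))"
    using d1_reindex[OF assms(1), of "case_nat 0 (\<lambda>n. Suc (Suc n))"] by simp
  then have "d1 (\<lambda>e. P (e 0) (tail e) \<and> (\<forall>x<e 0. \<not> P x (tail e)))"
    by (intro d1_conj assms d1_ball d1_not dt_var)
  then show ?thesis unfolding dt_def eq .
qed

lemmas dt_intros = dt_var dt_const dt_plus dt_times dt_if
lemmas d1_intros = d1_const d1_eq d1_less d1_le d1_mem d1_dvd d1_not d1_conj d1_disj d1_imp
  d1_ball d1_bex d1_ball_le d1_bex_le

section \<open>Coding finite sets and primitive recursion\<close>

lemma s1_d1: "d1 Q \<Longrightarrow> s1 Q"
  by (simp add: d1_def)

lemma s1_imp: "d1 P \<Longrightarrow> s1 Q \<Longrightarrow> s1 (\<lambda>e. P e \<longrightarrow> Q e)"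
  unfolding imp_conv_disj by (intro s1_disj) (simp_all add: d1_def)

lemma number_gt_zero [simp]: "0 < n \<longleftrightarrow> n \<noteq> (0::number)"
  using number_zero_le[of n] by (auto simp: less_le)

lemma number_dvd_imp_le: "x dvd y \<Longrightarrow> y \<noteq> 0 \<Longrightarrow> x \<le> (y::number)"
proof (elim dvdE)
  fix k assume "y = x * k" "y \<noteq> 0"
  then have "1 \<le> k" using number_less_one[of k] by (auto simp: not_less[symmetric])
  then have "x * 1 \<le> x * k" by (intro mult_left_mono) simp_all
  then show "x \<le> y" using \<open>y = x * k\<close> by simp
qed

lemma common_multiple: "\<exists>b. b \<noteq> 0 \<and> (\<forall>j<n. j + 1 dvd (b::number))"
proof (rule s1_induct[where P="\<lambda>n. \<exists>b. b \<noteq> 0 \<and> (\<forall>j<n. j + 1 dvd b)"])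
  show "s1 (\<lambda>e. \<exists>b. b \<noteq> 0 \<and> (\<forall>j<e 0. j + 1 dvd b))"
    by (intro s1_ex s1_d1 d1_intros dt_intros)
  show "\<exists>b. b \<noteq> 0 \<and> (\<forall>j<0. j + 1 dvd (b::number))" by (rule exI[of _ 1]) simp
  fix n :: number
  assume "\<exists>b. b \<noteq> 0 \<and> (\<forall>j<n. j + 1 dvd b)"
  then obtain b where b: "b \<noteq> 0" "\<forall>j<n. j + 1 dvd b" by blast
  have "b * (n + 1) \<noteq> 0" using b(1) basic_axioms_number(1) by simp
  moreover have "\<forall>j<n + 1. j + 1 dvd b * (n + 1)"
    using b(2) by (auto simp: number_less_Suc le_less)
  ultimately show "\<exists>b. b \<noteq> 0 \<and> (\<forall>j<n + 1. j + 1 dvd b)" by blast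
qed

text \<open>Coprimality in the form of a Bezout identity without subtraction; this form is visibly
  closed under products.\<close>

definition invertible_mod :: "number \<Rightarrow> number \<Rightarrow> bool" where
  "invertible_mod x q \<longleftrightarrow> (\<exists>u v. u * x = v * q + 1)"

lemma invertible_mod_one: "invertible_mod 1 q"
  unfolding invertible_mod_def by (rule exI[of _ 1], rule exI[of _ 0]) simp

lemma invertible_mod_mult:
  "invertible_mod x q \<Longrightarrow> invertible_mod y q \<Longrightarrow> invertible_mod (x * y) q"
proof -
  assume "invertible_mod x q" "invertible_mod y q"
  then obtain u v u' v' where *: "u * x = v * q + 1" "u' * y = v' * q + 1"
    unfolding invertible_mod_def by blast
  have "(u * u') * (x * y) = (u * x) * (u' * y)" by (simp add: ac_simps)
  also have "\<dots> = (v * v' * q + v + v') * q + 1" unfolding * by (simp add: algebra_simps)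
  finally show ?thesis unfolding invertible_mod_def by blast
qed

text \<open>The moduli of Goedel's beta function.\<close>

definition modulus :: "number \<Rightarrow> number \<Rightarrow> number" where
  "modulus b x = (x + 1) * b + 1"

text \<open>Put c = (j + 1) * b, so that the modulus at j is c + 1; modulo it c is -1 and c * c is
  1. The two moduli differ by (d + 1) * b with d < n, so b = (d + 1) * k for some k. Multiplying the
  difference by u = k * (j + 1) * (j + 1) gives c * c, that is 1, so u inverts the modulus at i up
  to sign.\<close>

lemma modulus_invertible:
  assumes b: "b \<noteq> 0" "\<forall>j<n. j + 1 dvd b" and "i < n" "j < n" "i \<noteq> j"
  shows "invertible_mod (modulus b i) (modulus b j)"
proof -
  define c where "c = (j + 1) * b"
  have "c \<noteq> 0" using b(1) basic_axioms_number(1) by (simp add: c_def)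
  then obtain c' where c': "c = c' + 1" using number_cases by blast
  have q: "modulus b j = c + 1" by (simp add: modulus_def c_def)
  have sq: "c * c = c' * (c + 1) + 1" unfolding c' by (simp add: algebra_simps)
  from \<open>i \<noteq> j\<close> consider "j < i" | "i < j" by fastforce
  then show ?thesis
  proof cases
    case 1
    then obtain d where d: "i = j + (d + 1)" unfolding number_less_iff by blast
    have "d + 1 \<le> i" unfolding d by simp
    then have "d < n" using \<open>i < n\<close> by (simp add: number_Suc_le)
    then obtain k where k: "b = (d + 1) * k" using b(2) by (auto elim: dvdE)
    define u where "u = k * ((j + 1) * (j + 1))"
    have "u * ((d + 1) * b) = ((d + 1) * k) * b * ((j + 1) * (j + 1))" by (simp add: u_def ac_simps)
    also have "\<dots> = c * c" unfolding k[symmetric] c_def by (simp add: ac_simps)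
    finally have u: "u * ((d + 1) * b) = c * c" .
    have "modulus b i = (c + 1) + (d + 1) * b" by (simp add: modulus_def c_def d algebra_simps)
    then have "u * modulus b i = u * (c + 1) + u * ((d + 1) * b)"
      by (simp add: distrib_left)
    also have "\<dots> = (u + c') * (c + 1) + 1" unfolding u sq by (simp add: algebra_simps)
    finally show ?thesis unfolding invertible_mod_def q by blast
  next
    case 2
    then obtain d where d: "j = i + (d + 1)" unfolding number_less_iff by blast
    have "d + 1 \<le> j" unfolding d by simp
    then have "d < n" using \<open>j < n\<close> by (simp add: number_Suc_le)
    then obtain k where k: "b = (d + 1) * k" using b(2) by (auto elim: dvdE)
    define u where "u = k * ((j + 1) * (j + 1))"
    have "u * ((d + 1) * b) = ((d + 1) * k) * b * ((j + 1) * (j + 1))" by (simp add: u_def ac_simps)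
    also have "\<dots> = c * c" unfolding k[symmetric] c_def by (simp add: ac_simps)
    finally have u: "u * ((d + 1) * b) = c * c" .
    define m where "m = modulus b i"
    have m: "m = (i + 1) * b + 1" by (simp add: m_def modulus_def)
    have "c + 1 = m + (d + 1) * b" by (simp add: m_def modulus_def c_def d algebra_simps)
    then have "u * (c + 1) = u * m + c * c" using u by (metis distrib_left)
    then have *: "u * c * m + c * c * c = u * c * (c + 1)"
      by (metis distrib_right mult.assoc mult.commute)
    \<comment> \<open>The modulus at i is now the smaller one, so u inverts it with the wrong sign
      and u * c with the right one. As w * (c + 1) = c^3 + 1, adding this multiple of the modulus to
      the factor u * c absorbs the negative term c^3.\<close>
    define w where "w = c' * c + 1"
    have w: "w * (c + 1) = c * c * c + 1" unfolding w_def c' by (simp add: algebra_simps)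
    have "(u * c + w * (c + 1)) * m = (u * c * m + (w * (c + 1))) + w * (c + 1) * ((i + 1) * b)"
      by (simp add: m algebra_simps)
    also have "u * c * m + w * (c + 1) = u * c * (c + 1) + 1"
      unfolding w by (simp add: * flip: add.assoc)
    also have "u * c * (c + 1) + 1 + w * (c + 1) * ((i + 1) * b) =
        (u * c + w * ((i + 1) * b)) * (c + 1) + 1"
      by (simp add: algebra_simps)
    finally show ?thesis unfolding invertible_mod_def q m_def by blast
  qed
qed

text \<open>The code a is the product of the moduli belonging to the elements of X below n.
  Divisibility recognizes these elements; for the others, a stays invertible modulo their moduli,
  which rules divisibility out. Plain products suffice, without Chinese remaindering.\<close>

lemma finite_code:
  assumes X: "d1 (\<lambda>e. X (e 0))"
  shows "\<exists>a b. \<forall>x<n. X x \<longleftrightarrow> modulus b x dvd a"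
proof -
  obtain b where b: "b \<noteq> 0" "\<forall>j<n. j + 1 dvd b" using common_multiple by blast
  have mod_rule: "dt s \<Longrightarrow> dt (\<lambda>e. modulus b (s e))" for s
    unfolding modulus_def by (intro dt_intros)
  have X_rule: "dt s \<Longrightarrow> d1 (\<lambda>e. X (s e))" for s
    by (rule d1_subst[where P="\<lambda>x e. X x"]) (rule X)
  let ?P = "\<lambda>m a. (\<forall>x<m. x < n \<longrightarrow> X x \<longrightarrow> modulus b x dvd a) \<and>
    (\<forall>x<n. (m \<le> x \<or> \<not> X x) \<longrightarrow> invertible_mod a (modulus b x))"
  have "\<exists>a. ?P m a" for m
  proof (rule s1_induct[where P="\<lambda>m. \<exists>a. ?P m a"])
    \<comment> \<open>Invertibility puts existential quantifiers under a bounded universal one, so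
      this is Sigma_1 by collection.\<close>
    show "s1 (\<lambda>e. \<exists>a. ?P (e 0) a)"
      unfolding invertible_mod_def
      by (intro s1_ex s1_conj s1_ball_dterm dterm_intros s1_imp s1_ex;
          intro s1_d1 d1_intros X_rule dt_intros mod_rule)
    show "\<exists>a. ?P 0 a"
      by (rule exI[of _ 1]) (simp add: invertible_mod_one)
    fix m assume "\<exists>a. ?P m a"
    then obtain a where a: "?P m a" by blast
    show "\<exists>a. ?P (m + 1) a"
    proof (cases "m < n \<and> X m")
      case True
      have "?P (m + 1) (a * modulus b m)"
      proof (intro conjI allI impI)
        fix x assume "x < m + 1" "x < n" "X x"
        then show "modulus b x dvd a * modulus b m"
          using a by (auto simp: number_less_Suc le_less)
      next
        fix x assume x: "x < n" "m + 1 \<le> x \<or> \<not> X x"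
        then have "m \<noteq> x" using True by (auto simp: number_Suc_le)
        moreover have "m \<le> x \<or> \<not> X x" using x by (auto simp: number_Suc_le)
        ultimately show "invertible_mod (a * modulus b m) (modulus b x)"
          using a x True by (intro invertible_mod_mult modulus_invertible[OF b]) auto
      qed
      then show ?thesis by blast
    next
      case False
      then have "x < m" if "x < m + 1" "x < n" "X x" for x
        using that by (auto simp: number_less_Suc le_less)
      moreover have "m \<le> x" if "m + 1 \<le> x" for x using that by (simp add: number_Suc_le)
      ultimately have "?P (m + 1) a" using a by blast
      then show ?thesis by blast
    qed
  qed
  then obtain a where a: "?P n a" by blast
  have "X x \<longleftrightarrow> modulus b x dvd a" if x: "x < n" for x
  proof
    show "X x \<Longrightarrow> modulus b x dvd a" using a x by blast
    assume dvd: "modulus b x dvd a"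
    show "X x"
    proof (rule ccontr)
      assume "\<not> X x"
      then obtain u v where "u * a = v * modulus b x + 1"
        using a x unfolding invertible_mod_def by blast
      moreover have "modulus b x dvd u * a" using dvd by simp
      ultimately have "modulus b x dvd 1" by (simp add: dvd_add_right_iff)
      then have "modulus b x \<le> 1" by (intro number_dvd_imp_le) simp_all
      then have "(x + 1) * b \<le> 0" by (simp add: modulus_def)
      then show False using b(1) basic_axioms_number(1) by (metis antisym mult_eq_0_iff number_zero_le)
    qed
  qed
  then show ?thesis by blast
qed

text \<open>The value of the term \<open>pair\<close> in the model.\<close>

definition pr :: "number \<Rightarrow> number \<Rightarrow> number" where
  "pr x y = (x + y) * (x + y) + x"

text \<open>\<open>pr x y\<close> lies below the square of every number larger than x + y. A code
  therefore determines the sum x + y first, and then x.\<close>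

lemma pr_sum_mono: "x + y < x' + y' \<Longrightarrow> pr x y < pr x' y'"
proof -
  assume "x + y < x' + y'"
  then obtain k where k: "x' + y' = (x + y) + (k + 1)" unfolding number_less_iff by blast
  have "(x' + y') * (x' + y') = pr x y + ((x + y + y + k * (x + y + x + y) + k * k + k + k) + 1)"
    unfolding k pr_def by (simp add: algebra_simps)
  then have "pr x y < (x' + y') * (x' + y')" unfolding number_less_iff by blast
  also have "\<dots> \<le> pr x' y'" by (simp add: pr_def)
  finally show ?thesis .
qed

lemma pr_inj [simp]: "pr x y = pr x' y' \<longleftrightarrow> x = x' \<and> y = y'"
proof
  assume eq: "pr x y = pr x' y'"
  then have "x + y = x' + y'"
    using pr_sum_mono[of x y x' y'] pr_sum_mono[of x' y' x y] by (metis less_irrefl linorder_neqE)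
  then show "x = x' \<and> y = y'" using eq by (auto simp: pr_def)
qed simp

lemma le_square: "(n::number) \<le> n * n"
  using number_dvd_imp_le[of n "n * n"] by (cases "n = 0") auto

text \<open>Makes quantifiers over the components of a code bounded, which keeps definitions
  Delta_1.\<close>

lemma pr_ge: "x \<le> pr x y" "y \<le> pr x y"
proof -
  show "x \<le> pr x y" by (simp add: pr_def)
  have "y \<le> x + y" by simp
  also have "\<dots> \<le> (x + y) * (x + y)" by (rule le_square)
  also have "\<dots> \<le> pr x y" by (simp add: pr_def)
  finally show "y \<le> pr x y" .
qed

lemma dt_pr: "dt s \<Longrightarrow> dt t \<Longrightarrow> dt (\<lambda>e. pr (s e) (t e))"
  unfolding pr_def by (intro dt_intros)

text \<open>For a total single-valued relation, failing to have the value v means having some other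
  value, so the complement of the graph is Sigma_1 as well.\<close>

lemma dt_s1_graph:
  assumes "s1 (\<lambda>e. G (e 0) (e 1))" "\<And>x. \<exists>!y. G x y"
  shows "dt (\<lambda>e. THE y. G (e 0) y)"
proof -
  have G: "s1 (\<lambda>e. G (e i) (e j))" for i j
    using s1_subst[OF assms(1), of "case_nat (\<lambda>e. e i) (\<lambda>_ e. e j)"]
    by (simp add: dterm_var split: nat.split)
  have eq: "(THE y. G x y) = v \<longleftrightarrow> G x v" for x v
    using assms(2) by (metis the1_equality)
  have neq: "\<not> G x v \<longleftrightarrow> (\<exists>w. w \<noteq> v \<and> G x w)" for x v
    using assms(2) by metis
  have "s1 (\<lambda>e. \<exists>w. w \<noteq> e 0 \<and> G (e (Suc 0)) w)"
    by (intro s1_ex s1_conj G s1_d1 d1_intros dt_intros)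
  then show ?thesis unfolding dt_def d1_def eq neq using G by simp
qed

text \<open>The graph \<open>G\<close> asks for a coded finite set of pairs that contains (i, y) and
  in which every pair is justified by a predecessor in the set. Two such sets agree at every index,
  by induction on a bounded statement; existence is a Sigma_1 statement, and its inductive step adds
  one pair to the set.\<close>

lemma primitive_recursion:
  assumes F: "dt (\<lambda>e. F (e 0) (e 1))"
  shows "\<exists>g. dt (\<lambda>e. g (e 0)) \<and> g 0 = a0 \<and> (\<forall>i. g (i + 1) = F i (g i))"
proof -
  \<comment> \<open>\<open>D a b n\<close>: each coded pair is the initial one or follows by \<open>F\<close> from another coded pair.\<close>
  define D where "D a b n \<longleftrightarrow> (\<forall>w<n. modulus b w dvd a \<longrightarrow> w = pr 0 a0 \<or>
    (\<exists>i\<le>w. \<exists>z<n. pr i z < n \<and> modulus b (pr i z) dvd a \<and> w = pr (i + 1) (F i z)))" for a b n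
  define E where "E a b n i y \<longleftrightarrow> pr i y < n \<and> modulus b (pr i y) dvd a" for a b n i y
  define G where "G i y \<longleftrightarrow> (\<exists>a b n. D a b n \<and> E a b n i y)" for i y
  note F_rule = dt_fn2[OF F]
  have mod_rule: "dt s \<Longrightarrow> dt t \<Longrightarrow> dt (\<lambda>e. modulus (s e) (t e))" for s t
    unfolding modulus_def by (intro dt_intros)
  note rules = s1_d1 d1_intros dt_intros F_rule mod_rule dt_pr
  have G_s1: "s1 (\<lambda>e. G (e i) (e j))" for i j
    unfolding G_def D_def E_def
    by (intro s1_ex; intro rules)
  have unique: "y = y'" if der: "D a b n" "D a' b' n'" and "E a b n i y" "E a' b' n' i y'" for a b n a' b' n' i y y'
  proof -
    have inv: "(i = 0 \<and> y = a0) \<or> (\<exists>i' z. i = i' + 1 \<and> y = F i' z \<and> E a b n i' z)"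
      if "D a b n" "E a b n i y" for a b n i y
      using that unfolding D_def E_def by fastforce
    have "\<forall>y<n. \<forall>y'<n'. E a b n i y \<longrightarrow> E a' b' n' i y' \<longrightarrow> y = y'"
    proof (rule d1_induct[where P="\<lambda>i. \<forall>y<n. \<forall>y'<n'. E a b n i y \<longrightarrow> E a' b' n' i y' \<longrightarrow> y = y'"])
      show "d1 (\<lambda>e. \<forall>y<n. \<forall>y'<n'. E a b n (e 0) y \<longrightarrow> E a' b' n' (e 0) y' \<longrightarrow> y = y')"
        unfolding E_def by (intro d1_intros dt_intros mod_rule dt_pr)
      show "\<forall>y<n. \<forall>y'<n'. E a b n 0 y \<longrightarrow> E a' b' n' 0 y' \<longrightarrow> y = y'"
        using inv[OF der(1), of 0] inv[OF der(2), of 0] basic_axioms_number(1) by metis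
      fix i assume IH: "\<forall>y<n. \<forall>y'<n'. E a b n i y \<longrightarrow> E a' b' n' i y' \<longrightarrow> y = y'"
      show "\<forall>y<n. \<forall>y'<n'. E a b n (i + 1) y \<longrightarrow> E a' b' n' (i + 1) y' \<longrightarrow> y = y'"
      proof (intro allI impI)
        fix y y' assume "E a b n (i + 1) y" "E a' b' n' (i + 1) y'"
        then obtain z z' where z: "y = F i z" "E a b n i z" "y' = F i z'" "E a' b' n' i z'"
          using inv[OF der(1), of "i + 1" y] inv[OF der(2), of "i + 1" y'] basic_axioms_number(1)
          by auto
        have "z < n" "z' < n'" using z pr_ge(2) unfolding E_def by (meson order_le_less_trans)+
        then show "y = y'" using z IH by blast
      qed
    qed
    moreover have "y < n" "y' < n'" using that pr_ge(2) unfolding E_def by (meson order_le_less_trans)+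
    ultimately show ?thesis using that by blast
  qed
  have G0: "G 0 a0"
  proof -
    have "d1 (\<lambda>e. e 0 = pr 0 a0)" by (intro d1_intros dt_intros)
    then obtain a b where ab: "\<forall>x<pr 0 a0 + 1. x = pr 0 a0 \<longleftrightarrow> modulus b x dvd a"
      using finite_code[of "\<lambda>x. x = pr 0 a0" "pr 0 a0 + 1"] by blast
    then have "D a b (pr 0 a0 + 1)" "E a b (pr 0 a0 + 1) 0 a0"
      using less_add_one[of "pr 0 a0"] unfolding D_def E_def by blast+
    then show ?thesis unfolding G_def by blast
  qed
  have GS: "G (i + 1) (F i y)" if Gi: "G i y" for i y
  proof -
    obtain a b n where D: "D a b n" and E: "E a b n i y" using Gi unfolding G_def by blast
    let ?p = "pr (i + 1) (F i y)"
    \<comment> \<open>Adding a pair requires a fresh code: with the larger bound n' the moduli may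
      change, and \<open>finite_code\<close> is applied to the enlarged set.\<close>
    let ?X = "\<lambda>w. (w < n \<and> modulus b w dvd a) \<or> w = ?p"
    define n' where "n' = max n (?p + 1)"
    have "d1 (\<lambda>e. ?X (e 0))" by (intro d1_intros dt_intros mod_rule)
    then obtain a' b' where ab: "\<forall>x<n'. ?X x \<longleftrightarrow> modulus b' x dvd a'"
      using finite_code[of ?X n'] by blast
    have n': "n \<le> n'" "?p < n'" by (auto simp: n'_def less_max_iff_disj less_add_one)
    have old: "pr j z < n' \<and> modulus b' (pr j z) dvd a' \<and> z < n'"
      if "E a b n j z" for j z
    proof -
      have "pr j z < n" "modulus b (pr j z) dvd a" using that by (auto simp: E_def)
      moreover have "z < n'" using pr_ge(2)[of z j] calculation(1) n'(1) by (meson order_le_less_trans order_less_le_trans)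
      ultimately show ?thesis using ab n'(1) by (meson order_less_le_trans)
    qed
    have "D a' b' n'"
      unfolding D_def
    proof (intro allI impI)
      fix w assume "w < n'" "modulus b' w dvd a'"
      then have "?X w" using ab by blast
      then consider "w = pr 0 a0" | j z where "j \<le> w" "E a b n j z" "w = pr (j + 1) (F j z)"
      proof
        assume "w < n \<and> modulus b w dvd a"
        then show thesis using D that unfolding D_def E_def by blast
      next
        assume w: "w = ?p"
        have "i \<le> i + 1" by simp
        then have "i \<le> w" unfolding w using pr_ge(1) order_trans by blast
        then show thesis using that(2) E w by blast
      qed
      then show "w = pr 0 a0 \<or> (\<exists>i\<le>w. \<exists>z<n'. pr i z < n' \<and> modulus b' (pr i z) dvd a' \<and> w = pr (i + 1) (F i z))"
        using old by cases blast+
    qed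
    moreover have "E a' b' n' (i + 1) (F i y)" using ab n'(2) unfolding E_def by blast
    ultimately show ?thesis unfolding G_def by blast
  qed
  have "\<exists>y. G i y" for i
  proof (rule s1_induct[where P="\<lambda>i. \<exists>y. G i y"])
    show "s1 (\<lambda>e. \<exists>y. G (e 0) y)" by (intro s1_ex G_s1)
  qed (use G0 GS in blast)+
  then have ex1: "\<exists>!y. G i y" for i using unique unfolding G_def by blast
  define g where "g i = (THE y. G i y)" for i
  have g: "G i y \<Longrightarrow> g i = y" for i y using ex1 unfolding g_def by (metis the1_equality)
  have "dt (\<lambda>e. g (e 0))" unfolding g_def using dt_s1_graph[OF G_s1 ex1] .
  moreover have "g 0 = a0" using g G0 by blast
  moreover have "g (i + 1) = F i (g i)" for i using g GS ex1 by metis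
  ultimately show ?thesis by blast
qed

section \<open>Inside the model: from AHT to SRT^2\<close>

section \<open>The principles in the model\<close>

text \<open>From here to \<open>SRT2_model\<close> the object formulas are copied clause by clause,
  including \<open>x = x\<close> for \<open>nats\<close>, so that \<open>sat_SRT2\<close> and
  \<open>sat_AHT\<close> hold by unfolding.\<close>

definition function_graph :: "number set \<Rightarrow> (number \<Rightarrow> bool) \<Rightarrow> (number \<Rightarrow> bool) \<Rightarrow> bool" where
  "function_graph F A B \<longleftrightarrow> (\<forall>w. w \<in> F \<longrightarrow> (\<exists>x y. w = pr x y \<and> A x \<and> B y)) \<and>
    (\<forall>x. A x \<longrightarrow> (\<exists>y. pr x y \<in> F \<and> (\<forall>z. pr x z \<in> F \<longrightarrow> z = y)))"

definition pow2_rel :: "number \<Rightarrow> number \<Rightarrow> bool" where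
  "pow2_rel x y \<longleftrightarrow> (\<exists>P\<in>sets. function_graph P (\<lambda>x. x = x) (\<lambda>x. x = x) \<and> pr 0 1 \<in> P \<and>
    (\<forall>i z. pr i z \<in> P \<longrightarrow> pr (i + 1) (z + z) \<in> P) \<and> pr x y \<in> P)"

definition sum_rel :: "number set \<Rightarrow> number \<Rightarrow> number \<Rightarrow> number \<Rightarrow> bool" where
  "sum_rel g i j y \<longleftrightarrow> i \<le> j \<and>
    (\<exists>S\<in>sets. function_graph S (\<lambda>x. x = x) (\<lambda>x. x = x) \<and> pr i 0 \<in> S \<and>
      (\<forall>l u v. i \<le> l \<and> l < j \<and> pr l u \<in> S \<and> pr l v \<in> g \<longrightarrow> pr (l + 1) (u + v) \<in> S) \<and>
      pr j y \<in> S)"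

definition expansion_rel :: "number \<Rightarrow> number \<Rightarrow> number set \<Rightarrow> bool" where
  "expansion_rel n p t \<longleftrightarrow> function_graph t (\<lambda>x. x = x) (\<lambda>x. x = x) \<and>
    (\<forall>i j a b. i < j \<and> j < p \<and> pr i a \<in> t \<and> pr j b \<in> t \<longrightarrow> a < b) \<and>
    (\<exists>g\<in>sets. function_graph g (\<lambda>x. x = x) (\<lambda>x. x = x) \<and>
      (\<forall>i a b. i < p \<and> pr i a \<in> t \<and> pr i b \<in> g \<longrightarrow> pow2_rel a b) \<and> sum_rel g 0 p n)"

definition lambda_rel :: "number \<Rightarrow> number \<Rightarrow> bool" where
  "lambda_rel n a \<longleftrightarrow> (\<exists>p. \<exists>t\<in>sets. expansion_rel n (p + 1) t \<and> pr 0 a \<in> t)"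

definition mu_rel :: "number \<Rightarrow> number \<Rightarrow> bool" where
  "mu_rel n b \<longleftrightarrow> (\<exists>p. \<exists>t\<in>sets. expansion_rel n (p + 1) t \<and> pr p b \<in> t)"

definition apart :: "number set \<Rightarrow> bool" where
  "apart H \<longleftrightarrow> (\<forall>x x'. x \<in> H \<and> x' \<in> H \<and> x < x' \<longrightarrow> (\<exists>b a. mu_rel x b \<and> lambda_rel x' a \<and> b < a))"

definition enum_rel :: "number set \<Rightarrow> number set \<Rightarrow> bool" where
  "enum_rel h H \<longleftrightarrow> function_graph h (\<lambda>x. x = x) (\<lambda>x. x = x) \<and>
    (\<forall>i j a b. i < j \<and> pr i a \<in> h \<and> pr j b \<in> h \<longrightarrow> a < b) \<and>
    (\<forall>x. x \<in> H \<longleftrightarrow> (\<exists>i. pr i x \<in> h))"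

definition AS_rel :: "number \<Rightarrow> number set \<Rightarrow> bool" where
  "AS_rel y H \<longleftrightarrow> (\<exists>h\<in>sets. enum_rel h H \<and> (\<exists>i j. i \<le> j \<and> sum_rel h i (j + 1) y))"

definition AHT_model :: bool where
  "AHT_model \<longleftrightarrow> (\<forall>k. \<forall>c\<in>sets. function_graph c (\<lambda>x. x = x) (\<lambda>x. x < k) \<longrightarrow>
    (\<exists>H\<in>sets. (\<forall>m. \<exists>n. m < n \<and> n \<in> H) \<and> (\<forall>x. x \<in> H \<longrightarrow> 0 < x) \<and> apart H \<and>
      (\<exists>d. d < k \<and> (\<forall>y. AS_rel y H \<longrightarrow> pr y d \<in> c))))"

definition SRT2_model :: bool where
  "SRT2_model \<longleftrightarrow> (\<forall>k. \<forall>f\<in>sets. function_graph f (\<lambda>w. \<exists>x y. x < y \<and> w = pr x y) (\<lambda>x. x < k) \<and>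
    (\<forall>x. \<exists>d. d < k \<and> (\<exists>t. x < t \<and> (\<forall>s. t \<le> s \<longrightarrow> pr (pr x s) d \<in> f))) \<longrightarrow>
    (\<exists>J\<in>sets. (\<forall>m. \<exists>n. m < n \<and> n \<in> J) \<and>
      (\<exists>d. d < k \<and> (\<forall>x y. x \<in> J \<and> y \<in> J \<and> x < y \<longrightarrow> pr (pr x y) d \<in> f))))"

lemmas sat_all = sat.simps eval.simps sat_Neg sat_And sat_Or sat_Iff sat_ExN sat_ExS

lemmas principle_unfold = AHT_def SRT2_def AHT_k_def SRT2_k_def stable_def in_AS_def enumerates_def
    apartness_def is_mu_def is_lambda_def binary_expansion_def is_sum_def is_pow2_def
    infinite_set_def pairs_def below_def nats_def val_def is_fun_def pair_def ex1_num_def leq_def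

lemma sat_SRT2: "sat sets e s SRT2 \<longleftrightarrow> SRT2_model"
  unfolding principle_unfold form_unfold SRT2_model_def function_graph_def pr_def le_less
  by (simp only: sat_all nat.case diff_Suc_Suc diff_0_eq_0 diff_zero)

lemma sat_AHT: "sat sets e s AHT \<longleftrightarrow> AHT_model"
  unfolding principle_unfold form_unfold AHT_model_def AS_rel_def enum_rel_def apart_def mu_rel_def
    lambda_rel_def expansion_rel_def sum_rel_def pow2_rel_def function_graph_def pr_def le_less
  by (simp only: sat_all nat.case diff_Suc_Suc diff_0_eq_0 diff_zero)

section \<open>Functions of the model\<close>

definition graph :: "(number \<Rightarrow> number) \<Rightarrow> number set" where
  "graph f = {w. \<exists>x. w = pr x (f x)}"

lemma mem_graph [simp]: "pr x y \<in> graph f \<longleftrightarrow> y = f x"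
  by (auto simp: graph_def)

lemma graph_in_sets:
  assumes f: "dt (\<lambda>e. f (e 0))" shows "graph f \<in> sets"
proof -
  have "graph f = {w. \<exists>x\<le>w. w = pr x (f x)}"
    unfolding graph_def using pr_ge(1) by auto
  also have "\<dots> \<in> sets"
    by (rule set_comprehension) (intro d1_intros dt_intros dt_pr dt_fn1[OF f])
  finally show ?thesis .
qed

lemma function_graph_graph: "(\<And>x. B (f x)) \<Longrightarrow> function_graph (graph f) (\<lambda>x. x = x) B"
  by (auto simp: function_graph_def graph_def)

lemma ex1_iff_THE: "\<exists>!y. P y \<Longrightarrow> P v \<longleftrightarrow> v = (THE y. P y)"
  using theI'[of P] the1_equality[of P v] by auto

text \<open>Replaces a set that codes a function by a function to which the closure rules for
  \<open>dt\<close> apply; \<open>graph_in_sets\<close> leads back.\<close>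

lemma function_graphE:
  assumes "function_graph F (\<lambda>x. x = x) B" "F \<in> sets"
  obtains f where "dt (\<lambda>e. f (e 0))" "\<And>x y. pr x y \<in> F \<longleftrightarrow> y = f x"
proof -
  have ex1: "\<exists>!y. pr x y \<in> F" for x using assms(1) unfolding function_graph_def by blast
  have "s1 (\<lambda>e. pr (e 0) (e 1) \<in> F)"
    using assms(2) by (intro s1_d1 d1_mem dt_pr dt_var)
  then have "dt (\<lambda>e. THE y. pr (e 0) y \<in> F)" using ex1 by (rule dt_s1_graph)
  moreover have "pr x y \<in> F \<longleftrightarrow> y = (THE y. pr x y \<in> F)" for x y
    using ex1[of x] by (rule ex1_iff_THE)
  ultimately show thesis by (rule that)
qed

lemma increasing_less:
  assumes f: "dt (\<lambda>e. f (e 0))" and step: "\<And>i. f i < f (i + 1 :: number)" and "i < j"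
  shows "f i < (f j :: number)"
proof -
  have "\<forall>i<j. f i < f j"
  proof (rule d1_induct[where P="\<lambda>j. \<forall>i<j. f i < f j"])
    show "d1 (\<lambda>e. \<forall>i<e 0. f i < f (e 0))"
      by (intro d1_intros dt_intros dt_fn1[OF f])
    fix j assume IH: "\<forall>i<j. f i < f j"
    show "\<forall>i<j + 1. f i < f (j + 1)"
      using IH step[of j] by (auto simp: number_less_Suc le_less intro: less_trans)
  qed simp
  then show ?thesis using \<open>i < j\<close> by blast
qed

lemma increasing_ge:
  assumes f: "dt (\<lambda>e. f (e 0))" and step: "\<And>i. f i < f (i + 1 :: number)"
  shows "i \<le> (f i :: number)"
proof (rule d1_induct[where P="\<lambda>i. i \<le> f i"])
  show "d1 (\<lambda>e. e 0 \<le> f (e 0))" by (intro d1_intros dt_intros dt_fn1[OF f])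
  fix i assume "i \<le> f i"
  then have "i < f (i + 1)" using step[of i] by (rule le_less_trans)
  then show "i + 1 \<le> f (i + 1)" by (simp add: number_Suc_le)
qed simp

text \<open>A range is only Sigma_1 in general. Here i <= f i bounds the search for a
  preimage.\<close>

lemma range_in_sets:
  assumes f: "dt (\<lambda>e. f (e 0))" and step: "\<And>i. f i < f (i + 1 :: number)"
  shows "range f \<in> sets"
proof -
  have "range f = {x. \<exists>i\<le>x. x = f i}"
    using increasing_ge[OF assms] by auto
  also have "\<dots> \<in> sets"
    by (rule set_comprehension) (intro d1_intros dt_intros dt_fn1[OF f])
  finally show ?thesis .
qed

section \<open>Powers of two and binary expansions\<close>

definition pow2 :: "number \<Rightarrow> number" where
  "pow2 = (SOME g. dt (\<lambda>e. g (e 0)) \<and> g 0 = 1 \<and> (\<forall>i. g (i + 1) = g i + g i))"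

lemma pow2: "dt (\<lambda>e. pow2 (e 0))" "pow2 0 = 1" "pow2 (i + 1) = pow2 i + pow2 i"
proof -
  have "dt (\<lambda>e. e 1 + e 1)" by (intro dt_intros)
  from someI_ex[OF primitive_recursion[of "\<lambda>i x. x + x", OF this, of 1], folded pow2_def]
  show "dt (\<lambda>e. pow2 (e 0))" "pow2 0 = 1" "pow2 (i + 1) = pow2 i + pow2 i" by auto
qed

lemmas dt_pow2 = dt_fn1[OF pow2(1)]

lemma pow2_add: "pow2 (x + y) = pow2 x * pow2 y"
proof (rule d1_induct[where P="\<lambda>y. pow2 (x + y) = pow2 x * pow2 y"])
  show "d1 (\<lambda>e. pow2 (x + e 0) = pow2 x * pow2 (e 0))" by (intro d1_intros dt_intros dt_pow2)
  fix y assume "pow2 (x + y) = pow2 x * pow2 y"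
  then show "pow2 (x + (y + 1)) = pow2 x * pow2 (y + 1)"
    by (simp add: pow2(3) distrib_left flip: add.assoc)
qed (simp add: pow2)

lemma pow2_nonzero [simp]: "pow2 x \<noteq> 0"
proof (rule d1_induct[where P="\<lambda>x. pow2 x \<noteq> 0"])
  show "d1 (\<lambda>e. pow2 (e 0) \<noteq> 0)" by (intro d1_intros dt_intros dt_pow2)
  fix x assume "pow2 x \<noteq> 0"
  then show "pow2 (x + 1) \<noteq> 0" by (simp add: pow2(3) add_nonneg_eq_0_iff)
qed (simp add: pow2)

lemma pow2_step: "pow2 x < pow2 (x + 1)"
  by (simp add: pow2(3))

lemma pow2_less: "x < y \<Longrightarrow> pow2 x < pow2 y"
  using increasing_less[OF pow2(1) pow2_step] .

lemma pow2_le: "x \<le> y \<Longrightarrow> pow2 x \<le> pow2 y"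
  using pow2_less by (auto simp: le_less)

lemma pow2_less_cancel: "pow2 x < pow2 y \<Longrightarrow> x < y"
  using pow2_le[of y x] by (auto simp: not_less[symmetric])

lemma pow2_dvd: "x \<le> y \<Longrightarrow> pow2 x dvd pow2 y"
  unfolding number_le_iff by (auto simp: pow2_add)

lemma less_pow2_Suc: "n < pow2 (n + 1)"
  using increasing_ge[OF pow2(1) pow2_step, of "n + 1"] by (simp add: number_Suc_le)

text \<open>\<open>mu\<close> and \<open>lam\<close> are found by search and not from an expansion,
  so they are total and definable before any expansion is known to exist. The disjunct
  \<open>n = 0\<close> makes the search for \<open>lam\<close> succeed at 0.\<close>

definition mu :: "number \<Rightarrow> number" where "mu n = (LEAST m. n < pow2 (m + 1))"
definition lam :: "number \<Rightarrow> number" where "lam n = (LEAST l. n = 0 \<or> \<not> pow2 (l + 1) dvd n)"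

lemma dt_mu_var: "dt (\<lambda>e. mu (e 0))"
proof -
  have "d1 (\<lambda>e. tail e 0 < pow2 (e 0 + 1))" by (intro d1_intros dt_intros dt_pow2)
  then show ?thesis
    unfolding mu_def by (rule dt_least) (use less_pow2_Suc in blast)
qed

lemmas dt_mu = dt_fn1[OF dt_mu_var]

lemma not_pow2_dvd: "n \<noteq> 0 \<Longrightarrow> \<not> pow2 (n + 1) dvd n"
  using less_pow2_Suc[of n] number_dvd_imp_le by (meson leD)

lemma dt_lam_var: "dt (\<lambda>e. lam (e 0))"
proof -
  have "d1 (\<lambda>e. tail e 0 = 0 \<or> \<not> pow2 (e 0 + 1) dvd tail e 0)"
    by (intro d1_intros dt_intros dt_pow2)
  then show ?thesis
    unfolding lam_def by (rule dt_least) (use not_pow2_dvd in blast)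
qed

lemmas dt_lam = dt_fn1[OF dt_lam_var]

lemma mu_bounds:
  assumes "n \<noteq> 0" shows "pow2 (mu n) \<le> n" "n < pow2 (mu n + 1)"
proof -
  have d1: "d1 (\<lambda>e. n < pow2 (e 0 + 1))" by (intro d1_intros dt_intros dt_pow2)
  note least = d1_least[where P="\<lambda>m. n < pow2 (m + 1)", OF d1 less_pow2_Suc, folded mu_def]
  show "n < pow2 (mu n + 1)" by (rule least(1))
  show "pow2 (mu n) \<le> n"
  proof (cases "mu n = 0")
    case True
    then show ?thesis using assms number_less_one[of n] by (auto simp: pow2 not_less[symmetric])
  next
    case False
    then obtain m where m: "mu n = m + 1" using number_cases by blast
    then have "\<not> n < pow2 (m + 1)" by (intro least(2)) (simp add: less_add_one)
    then show ?thesis by (simp add: m)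
  qed
qed

lemma mu_eqI:
  assumes "pow2 m \<le> n" "n < pow2 (m + 1)" shows "mu n = m"
proof -
  have "n \<noteq> 0" using assms(1) pow2_nonzero[of m] by (metis antisym number_zero_le)
  then have "pow2 (mu n) \<le> n" "n < pow2 (mu n + 1)" by (rule mu_bounds)+
  then have "mu n < m + 1" "m < mu n + 1"
    using assms by (blast intro: pow2_less_cancel le_less_trans)+
  then show ?thesis by (simp add: number_less_Suc)
qed

lemma lam_dvd:
  assumes "n \<noteq> 0" shows "pow2 (lam n) dvd n" "\<not> pow2 (lam n + 1) dvd n"
proof -
  have d1: "d1 (\<lambda>e. n = 0 \<or> \<not> pow2 (e 0 + 1) dvd n)" by (intro d1_intros dt_intros dt_pow2)
  have "n = 0 \<or> \<not> pow2 (n + 1) dvd n" using not_pow2_dvd by blast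
  note least = d1_least[where P="\<lambda>l. n = 0 \<or> \<not> pow2 (l + 1) dvd n", OF d1 this, folded lam_def]
  show "\<not> pow2 (lam n + 1) dvd n" using least(1) assms by blast
  show "pow2 (lam n) dvd n"
  proof (cases "lam n = 0")
    case True
    then show ?thesis by (simp add: pow2)
  next
    case False
    then obtain l where l: "lam n = l + 1" using number_cases by blast
    then have "\<not> (n = 0 \<or> \<not> pow2 (l + 1) dvd n)" by (intro least(2)) (simp add: less_add_one)
    then show ?thesis by (simp add: l)
  qed
qed

lemma le_lam:
  assumes "n \<noteq> 0" "pow2 l dvd n" shows "l \<le> lam n"
proof (rule ccontr)
  assume "\<not> l \<le> lam n"
  then have "lam n + 1 \<le> l" by (simp add: number_Suc_le)
  then show False using pow2_dvd assms lam_dvd(2) dvd_trans by blast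
qed

lemma lam_eqI:
  assumes "n \<noteq> 0" "pow2 l dvd n" "\<not> pow2 (l + 1) dvd n" shows "lam n = l"
proof (rule antisym)
  show "l \<le> lam n" using assms(1,2) by (rule le_lam)
  show "lam n \<le> l"
  proof (rule ccontr)
    assume "\<not> lam n \<le> l"
    then have "l + 1 \<le> lam n" by (simp add: number_Suc_le)
    then show False using pow2_dvd assms lam_dvd(1) dvd_trans by blast
  qed
qed

lemma lam_le_mu: "n \<noteq> 0 \<Longrightarrow> lam n \<le> mu n"
proof -
  assume n: "n \<noteq> 0"
  then have "pow2 (lam n) \<le> n" using lam_dvd(1) number_dvd_imp_le by blast
  also have "n < pow2 (mu n + 1)" using n by (rule mu_bounds)
  finally show ?thesis using pow2_less_cancel number_less_Suc by blast
qed

lemma pow2_rel_eq: "pow2_rel x y \<Longrightarrow> y = pow2 x"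
proof -
  assume "pow2_rel x y"
  then obtain P where P: "P \<in> sets" "function_graph P (\<lambda>x. x = x) (\<lambda>x. x = x)" "pr 0 1 \<in> P"
    "\<forall>i z. pr i z \<in> P \<longrightarrow> pr (i + 1) (z + z) \<in> P" "pr x y \<in> P"
    unfolding pow2_rel_def by blast
  obtain f where f: "dt (\<lambda>e. f (e 0))" "\<And>x y. pr x y \<in> P \<longleftrightarrow> y = f x"
    using P(2,1) by (rule function_graphE) blast
  have "f x = pow2 x"
  proof (rule d1_induct[where P="\<lambda>x. f x = pow2 x"])
    show "d1 (\<lambda>e. f (e 0) = pow2 (e 0))" by (intro d1_intros dt_intros dt_pow2 dt_fn1[OF f(1)])
    show "f 0 = pow2 0" using P(3) f(2) by (simp add: pow2)
    show "f (x + 1) = pow2 (x + 1)" if "f x = pow2 x" for x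
      using P(4)[rule_format, of x "f x"] that by (simp add: f(2) pow2(3))
  qed
  then show ?thesis using P(5) f(2) by simp
qed

text \<open>Only these two consequences of the existence of a binary expansion are needed: \<open>\<lambda>\<close> and
  \<open>\<mu>\<close> of sums can then be computed from \<open>lam\<close> and \<open>mu\<close>.\<close>

lemma expansion_bounds:
  assumes "expansion_rel n (p + 1) t" "t \<in> sets"
  shows "pr p b \<in> t \<Longrightarrow> n < pow2 (b + 1)" "pr 0 a \<in> t \<Longrightarrow> pow2 a dvd n"
proof -
  from assms(1) obtain g S where
    t: "function_graph t (\<lambda>x. x = x) (\<lambda>x. x = x)"
      "\<forall>i j a b. i < j \<and> j < p + 1 \<and> pr i a \<in> t \<and> pr j b \<in> t \<longrightarrow> a < b" and
    g: "g \<in> sets" "function_graph g (\<lambda>x. x = x) (\<lambda>x. x = x)"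
      "\<forall>i a b. i < p + 1 \<and> pr i a \<in> t \<and> pr i b \<in> g \<longrightarrow> pow2_rel a b" and
    S: "S \<in> sets" "function_graph S (\<lambda>x. x = x) (\<lambda>x. x = x)" "pr 0 0 \<in> S"
      "\<forall>l u v. 0 \<le> l \<and> l < p + 1 \<and> pr l u \<in> S \<and> pr l v \<in> g \<longrightarrow> pr (l + 1) (u + v) \<in> S"
      "pr (p + 1) n \<in> S"
    unfolding expansion_rel_def sum_rel_def by blast
  obtain \<tau> where \<tau>: "dt (\<lambda>e. \<tau> (e 0))" "\<And>x y. pr x y \<in> t \<longleftrightarrow> y = \<tau> x"
    using t(1) assms(2) by (rule function_graphE) blast
  obtain \<gamma> where \<gamma>: "dt (\<lambda>e. \<gamma> (e 0))" "\<And>x y. pr x y \<in> g \<longleftrightarrow> y = \<gamma> x"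
    using g(2,1) by (rule function_graphE) blast
  obtain \<sigma> where \<sigma>: "dt (\<lambda>e. \<sigma> (e 0))" "\<And>x y. pr x y \<in> S \<longleftrightarrow> y = \<sigma> x"
    using S(2,1) by (rule function_graphE) blast
  note rules = d1_intros dt_intros dt_pow2 dt_fn1[OF \<tau>(1)] dt_fn1[OF \<gamma>(1)] dt_fn1[OF \<sigma>(1)]
  have \<tau>_less: "\<tau> i < \<tau> j" if "i < j" "j \<le> p" for i j
    using t(2) that by (auto simp: \<tau>(2) number_less_Suc)
  have \<gamma>_eq: "\<gamma> i = pow2 (\<tau> i)" if "i \<le> p" for i
    using g(3) that pow2_rel_eq by (auto simp: \<tau>(2) \<gamma>(2) number_less_Suc)
  have \<sigma>_0: "\<sigma> 0 = 0" using S(3) by (simp add: \<sigma>(2))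
  have \<sigma>_Suc: "\<sigma> (l + 1) = \<sigma> l + pow2 (\<tau> l)" if "l \<le> p" for l
    using S(4)[rule_format, of l "\<sigma> l" "\<gamma> l"] that \<gamma>_eq[OF that]
    by (simp add: \<sigma>(2) \<gamma>(2) number_less_Suc)
  have n: "n = \<sigma> (p + 1)" using S(5) by (simp add: \<sigma>(2))
  \<comment> \<open>Distinct increasing exponents produce no carry: the sum so far is below the
    power at \<tau> l + 1, which is at most the next summand, and adding that summand at most
    doubles it.\<close>
  have "l \<le> p \<longrightarrow> \<sigma> (l + 1) < pow2 (\<tau> l + 1)" for l
  proof (rule d1_induct[where P="\<lambda>l. l \<le> p \<longrightarrow> \<sigma> (l + 1) < pow2 (\<tau> l + 1)"])
    show "d1 (\<lambda>e. e 0 \<le> p \<longrightarrow> \<sigma> (e 0 + 1) < pow2 (\<tau> (e 0) + 1))" by (intro rules)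
    show "0 \<le> p \<longrightarrow> \<sigma> (0 + 1) < pow2 (\<tau> 0 + 1)"
      using \<sigma>_Suc[of 0] pow2_step by (simp add: \<sigma>_0)
    fix l assume IH: "l \<le> p \<longrightarrow> \<sigma> (l + 1) < pow2 (\<tau> l + 1)"
    show "l + 1 \<le> p \<longrightarrow> \<sigma> (l + 1 + 1) < pow2 (\<tau> (l + 1) + 1)"
    proof
      assume l: "l + 1 \<le> p"
      then have "l < p" by (simp add: number_Suc_le)
      then have "\<sigma> (l + 1) < pow2 (\<tau> l + 1)" using IH by simp
      also have "\<tau> l + 1 \<le> \<tau> (l + 1)"
        using \<tau>_less[of l "l + 1"] l by (simp add: number_Suc_le less_add_one)
      then have "pow2 (\<tau> l + 1) \<le> pow2 (\<tau> (l + 1))" by (rule pow2_le)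
      finally show "\<sigma> (l + 1 + 1) < pow2 (\<tau> (l + 1) + 1)"
        unfolding \<sigma>_Suc[OF l] pow2(3)[of "\<tau> (l + 1)"] by (rule add_strict_right_mono)
    qed
  qed
  then show "pr p b \<in> t \<Longrightarrow> n < pow2 (b + 1)" by (simp add: n \<tau>(2))
  have "l \<le> p + 1 \<longrightarrow> pow2 (\<tau> 0) dvd \<sigma> l" for l
  proof (rule d1_induct[where P="\<lambda>l. l \<le> p + 1 \<longrightarrow> pow2 (\<tau> 0) dvd \<sigma> l"])
    show "d1 (\<lambda>e. e 0 \<le> p + 1 \<longrightarrow> pow2 (\<tau> 0) dvd \<sigma> (e 0))" by (intro rules)
    show "0 \<le> p + 1 \<longrightarrow> pow2 (\<tau> 0) dvd \<sigma> 0" by (simp add: \<sigma>_0)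
    fix l assume IH: "l \<le> p + 1 \<longrightarrow> pow2 (\<tau> 0) dvd \<sigma> l"
    show "l + 1 \<le> p + 1 \<longrightarrow> pow2 (\<tau> 0) dvd \<sigma> (l + 1)"
    proof
      assume "l + 1 \<le> p + 1"
      then have l: "l \<le> p" by simp
      then have "\<tau> 0 \<le> \<tau> l" using \<tau>_less[of 0 l] by (cases "l = 0") simp_all
      then have "pow2 (\<tau> 0) dvd pow2 (\<tau> l)" by (rule pow2_dvd)
      moreover have "pow2 (\<tau> 0) dvd \<sigma> l"
        using IH l number_less_Suc[of l p] by simp
      ultimately show "pow2 (\<tau> 0) dvd \<sigma> (l + 1)" by (simp add: \<sigma>_Suc[OF l])
    qed
  qed
  then show "pr 0 a \<in> t \<Longrightarrow> pow2 a dvd n" by (simp add: n \<tau>(2))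
qed

text \<open>One-sided bounds suffice: x < 2^(b + 1) gives mu x <= b, while 2^a divides x' and b <
  a.\<close>

lemma apart_dvd:
  assumes "apart H" "x \<in> H" "x' \<in> H" "x < x'" "x \<noteq> 0"
  shows "pow2 (mu x + 1) dvd x'"
proof -
  obtain a b where ab: "mu_rel x b" "lambda_rel x' a" "b < a"
    using assms unfolding apart_def by blast
  have "x < pow2 (b + 1)" using ab(1) expansion_bounds(1) unfolding mu_rel_def by blast
  then have "pow2 (mu x) < pow2 (b + 1)" using mu_bounds(1)[OF assms(5)] by (rule order_le_less_trans[rotated])
  then have "mu x \<le> b" using pow2_less_cancel number_less_Suc by blast
  then have "mu x + 1 \<le> a" using ab(3) by (simp add: number_Suc_le)
  then have "pow2 (mu x + 1) dvd pow2 a" by (rule pow2_dvd)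
  also have "pow2 a dvd x'" using ab(2) expansion_bounds(2) unfolding lambda_rel_def by blast
  finally show ?thesis .
qed

section \<open>Using the adjacent Hindman theorem\<close>

lemma enumeration:
  assumes H: "H \<in> sets" "\<And>m. \<exists>n. m < n \<and> n \<in> H"
  obtains h where "dt (\<lambda>e. h (e 0))" "\<And>i. h i < h (i + 1)" "range h = H"
proof -
  define nxt where "nxt u = (LEAST x. u < x \<and> x \<in> H)" for u
  have "d1 (\<lambda>e. tail e 0 < e 0 \<and> e 0 \<in> H)" by (intro d1_intros dt_intros H)
  then have nxt_dt: "dt (\<lambda>e. nxt (e 0))" unfolding nxt_def by (rule dt_least) (rule H)
  have nxt: "u < nxt u" "nxt u \<in> H" "u < x \<Longrightarrow> x \<in> H \<Longrightarrow> nxt u \<le> x" for u x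
  proof -
    obtain y where y: "u < y \<and> y \<in> H" using H(2) by blast
    have d1: "d1 (\<lambda>e. u < e 0 \<and> e 0 \<in> H)" by (intro d1_intros dt_intros H)
    note least = d1_least[where P="\<lambda>x. u < x \<and> x \<in> H", OF d1 y, folded nxt_def]
    show "u < nxt u" "nxt u \<in> H" using least(1) by auto
    show "u < x \<Longrightarrow> x \<in> H \<Longrightarrow> nxt u \<le> x" using least(2)[of x] by (auto simp: not_less[symmetric])
  qed
  define h0 where "h0 = (LEAST x. x \<in> H)"
  have h0: "h0 \<in> H" "x \<in> H \<Longrightarrow> h0 \<le> x" for x
  proof -
    obtain y where y: "y \<in> H" using H(2) by blast
    have d1: "d1 (\<lambda>e. e 0 \<in> H)" by (intro d1_intros dt_intros H)
    note least = d1_least[where P="\<lambda>x. x \<in> H", OF d1 y, folded h0_def]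
    show "h0 \<in> H" by (rule least(1))
    show "x \<in> H \<Longrightarrow> h0 \<le> x" using least(2)[of x] by (auto simp: not_less[symmetric])
  qed
  have "dt (\<lambda>e. nxt (e 1))" by (rule dt_fn1[OF nxt_dt dt_var])
  then obtain h where h: "dt (\<lambda>e. h (e 0))" "h 0 = h0" "\<And>i. h (i + 1) = nxt (h i)"
    using primitive_recursion[of "\<lambda>i. nxt" h0] by blast
  have step: "h i < h (i + 1)" for i using nxt(1) by (simp add: h(3))
  have "h i \<in> H" for i
    using number_cases[of i] by (auto simp: h(2,3) h0 nxt)
  moreover have "x \<in> range h" if x: "x \<in> H" for x
  proof -
    have "d1 (\<lambda>e. x \<le> h (e 0))" by (intro d1_intros dt_intros dt_fn1[OF h(1)])
    note least = d1_least[where P="\<lambda>i. x \<le> h i", OF this increasing_ge[OF h(1) step]]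
    define i where "i = (LEAST i. x \<le> h i)"
    have "h i \<le> x"
    proof (cases "i = 0")
      case True
      then show ?thesis using h0 x h(2) by simp
    next
      case False
      then obtain j where j: "i = j + 1" using number_cases by blast
      then have "\<not> x \<le> h j" using least(2)[of j, folded i_def] less_add_one by blast
      then show ?thesis using nxt(3) x by (simp add: j h(3) not_le)
    qed
    then have "x = h i" using least(1) unfolding i_def by (rule antisym[rotated])
    then show ?thesis by blast
  qed
  ultimately have "range h = H" by blast
  then show thesis using that h(1) step by blast
qed

lemma adjacent_sum:
  assumes h: "dt (\<lambda>e. h (e 0))" "\<And>i. h i < h (i + 1)" "range h = H"
  obtains S where "dt (\<lambda>e. S (e 0))" "S i = 0" "\<And>j. i \<le> j \<Longrightarrow> S (j + 1) = S j + h j"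
    "\<And>j. i \<le> j \<Longrightarrow> AS_rel (S (j + 1)) H"
proof -
  \<comment> \<open>The recursion starts at 0 but returns 0 up to index i, so the summation
    effectively begins at h i.\<close>
  have "dt (\<lambda>e. if i \<le> e 0 then e 1 + h (e 0) else 0)"
    by (intro d1_intros dt_intros dt_fn1[OF h(1)])
  from primitive_recursion[of "\<lambda>l u. if i \<le> l then u + h l else 0", OF this, of 0]
  obtain S where S: "dt (\<lambda>e. S (e 0))" "S 0 = 0" "\<And>l. S (l + 1) = (if i \<le> l then S l + h l else 0)"
    by blast
  have Si: "S i = 0"
    using number_cases[of i] less_add_one by (auto simp: S(2,3) leD)
  have "enum_rel (graph h) H"
    unfolding enum_rel_def
    using function_graph_graph[of "\<lambda>x. x = x" h] increasing_less[OF h(1,2)] h(3) by auto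
  moreover have "sum_rel (graph h) i (j + 1) (S (j + 1))" if "i \<le> j" for j
    unfolding sum_rel_def
    using graph_in_sets[OF S(1)] function_graph_graph[of "\<lambda>x. x = x" S] that Si
    by (intro conjI bexI[of _ "graph S"]) (auto simp: S(3) number_less_Suc add_increasing2)
  ultimately have "AS_rel (S (j + 1)) H" if "i \<le> j" for j
    unfolding AS_rel_def using graph_in_sets[OF h(1)] that by blast
  then show thesis using that S Si by simp
qed

text \<open>The form in which both uses of AHT are made. \<open>g\<close> is total and a i <= b i is
  not strict because the sum for i = j is a single element, and a power of two has equal
  \<open>lam\<close> and \<open>mu\<close>.\<close>

lemma adjacent_hindman:
  assumes AHT: AHT_model
    and g: "dt (\<lambda>e. g (e 0) (e 1))" "\<And>x y. g x y < k"
  obtains a b d where "d < k" "dt (\<lambda>e. a (e 0))" "dt (\<lambda>e. b (e 0))"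
    "\<And>i. a i \<le> b i" "\<And>i. b i < a (i + 1)" "\<And>i j. i \<le> j \<Longrightarrow> g (a i) (b j) = d"
proof -
  define c where "c n = g (lam n) (mu n)" for n
  have c: "dt (\<lambda>e. c (e 0))" unfolding c_def by (intro dt_fn2[OF g(1)] dt_lam dt_mu dt_var)
  have "function_graph (graph c) (\<lambda>x. x = x) (\<lambda>x. x < k)"
    by (rule function_graph_graph) (simp add: c_def g(2))
  then obtain H d where H: "H \<in> sets" "\<And>m. \<exists>n. m < n \<and> n \<in> H" "\<And>x. x \<in> H \<Longrightarrow> 0 < x" "apart H"
    and d: "d < k" "\<And>y. AS_rel y H \<Longrightarrow> pr y d \<in> graph c"
    using AHT graph_in_sets[OF c] unfolding AHT_model_def by meson
  obtain h where h: "dt (\<lambda>e. h (e 0))" "\<And>i. h i < h (i + 1)" "range h = H"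
    using H(1,2) by (rule enumeration) blast
  have h0: "h i \<noteq> 0" for i using H(3)[of "h i"] h(3) by auto
  have h_dvd: "pow2 (mu (h i) + 1) dvd h j" if "i < j" for i j
    using apart_dvd[OF H(4), of "h i" "h j"] h(3) h0 increasing_less[OF h(1,2) that] by blast
  have "lam (h i) \<le> mu (h i)" for i using h0 by (rule lam_le_mu)
  moreover have "mu (h i) < lam (h (i + 1))" for i
    using le_lam[OF h0 h_dvd[of i "i + 1", OF less_add_one]] unfolding number_Suc_le .
  moreover have "g (lam (h i)) (mu (h j)) = d" if ij: "i \<le> j" for i j
  proof -
    obtain S where S: "dt (\<lambda>e. S (e 0))" "S i = 0" "\<And>j. i \<le> j \<Longrightarrow> S (j + 1) = S j + h j"
      "\<And>j. i \<le> j \<Longrightarrow> AS_rel (S (j + 1)) H"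
      by (rule adjacent_sum[OF h, of i]) blast
    note rules = d1_intros dt_intros dt_pow2 dt_lam dt_mu dt_fn1[OF h(1)] dt_fn1[OF S(1)]
    \<comment> \<open>The first two bounds pin down \<open>mu\<close> of the sum as that of its last
      summand; the two divisibility clauses pin down \<open>lam\<close> as that of its
      first.\<close>
    let ?P = "\<lambda>j. h j \<le> S (j + 1) \<and> S (j + 1) < pow2 (mu (h j) + 1) \<and>
      pow2 (lam (h i)) dvd S (j + 1) \<and> \<not> pow2 (lam (h i) + 1) dvd S (j + 1)"
    have "?P (i + l)" for l
    proof (rule d1_induct[where P="\<lambda>l. ?P (i + l)"])
      show "d1 (\<lambda>e. ?P (i + e 0))" by (intro rules)
      have "S (i + 1) = h i" using S(2,3) by simp
      then show "?P (i + 0)" using mu_bounds(2)[OF h0] lam_dvd[OF h0] by simp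
    next
      fix l assume IH: "?P (i + l)"
      define m where "m = i + l"
      define E where "E = pow2 (mu (h m) + 1)"
      have m: "m < m + 1" "i < m + 1" "i \<le> m + 1"
        by (simp_all add: m_def number_less_Suc add_increasing2)
      have SS: "S (m + 1 + 1) = S (m + 1) + h (m + 1)" using S(3) m(3) by blast
      have Edvd: "E dvd h (m + 1)" unfolding E_def using m(1) by (rule h_dvd)
      have "mu (h m) + 1 \<le> mu (h (m + 1)) + 1"
        using le_lam[OF h0 Edvd[unfolded E_def]] lam_le_mu[OF h0, of "m + 1"]
        by (meson add_increasing2 number_zero_le order_trans)
      then have Edvd': "E dvd pow2 (mu (h (m + 1)) + 1)" unfolding E_def by (rule pow2_dvd)
      \<comment> \<open>No carry passes the top bit of the new summand: that summand and the power
        of two just above it are both multiples of E, so at least E separates them, whereas the sum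
        so far is below E.\<close>
      obtain q r where q: "h (m + 1) = E * q" and r: "pow2 (mu (h (m + 1)) + 1) = E * r"
        using Edvd Edvd' by (blast elim: dvdE)
      have "E * q < E * r" using mu_bounds(2)[OF h0, of "m + 1"] q r by simp
      then have "q < r" using mult_left_mono[of r q E] by (auto simp: not_less[symmetric])
      then have "q + 1 \<le> r" by (simp add: number_Suc_le)
      then have "E * (q + 1) \<le> E * r" by (rule mult_left_mono) simp
      moreover have "E * (q + 1) = E + h (m + 1)" using q by (simp add: distrib_left add.commute)
      ultimately have "E + h (m + 1) \<le> pow2 (mu (h (m + 1)) + 1)" using r by simp
      moreover have "S (m + 1) < E" using IH unfolding E_def m_def by blast
      ultimately have "S (m + 1) + h (m + 1) < pow2 (mu (h (m + 1)) + 1)"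
        by (meson add_strict_right_mono order_less_le_trans)
      \<comment> \<open>Later summands are divisible by a power of two beyond the lowest bit of h i,
        so that bit survives.\<close>
      moreover have "lam (h i) + 1 \<le> mu (h i) + 1" using lam_le_mu[OF h0] by simp
      then have "pow2 (lam (h i) + 1) dvd h (m + 1)"
        using pow2_dvd h_dvd[OF m(2)] dvd_trans by blast
      moreover have "pow2 (lam (h i)) dvd pow2 (lam (h i) + 1)" by (rule pow2_dvd) simp
      ultimately have "?P (m + 1)"
        using IH unfolding SS m_def[symmetric]
        by (auto simp: dvd_add_left_iff add_increasing intro: dvd_trans)
      then show "?P (i + (l + 1))" by (simp add: m_def add.assoc)
    qed
    moreover obtain l where "j = i + l" using ij unfolding number_le_iff by blast
    ultimately have P: "?P j" by blast
    have "S (j + 1) \<noteq> 0" using P h0[of j] by (metis antisym number_zero_le)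
    then have "lam (S (j + 1)) = lam (h i)" using P by (intro lam_eqI) auto
    moreover have "mu (S (j + 1)) = mu (h j)"
      using P mu_bounds(1)[OF h0] by (intro mu_eqI) (auto intro: order_trans)
    moreover have "c (S (j + 1)) = d" using d(2)[OF S(4)[OF ij]] by simp
    ultimately show ?thesis by (simp add: c_def)
  qed
  ultimately show thesis
    using that[OF d(1), of "\<lambda>i. lam (h i)" "\<lambda>i. mu (h i)"] dt_lam[OF h(1)] dt_mu[OF h(1)] by blast
qed

section \<open>Stable Ramsey theorem for pairs\<close>

lemma AHT_imp_SRT2:
  assumes AHT: AHT_model shows SRT2_model
  unfolding SRT2_model_def
proof (intro allI ballI impI, elim conjE)
  fix k f
  assume f: "f \<in> sets" and f_graph: "function_graph f (\<lambda>w. \<exists>x y. x < y \<and> w = pr x y) (\<lambda>x. x < k)"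
    and stable: "\<forall>x. \<exists>d. d < k \<and> (\<exists>t. x < t \<and> (\<forall>s. t \<le> s \<longrightarrow> pr (pr x s) d \<in> f))"
  have "k \<noteq> 0" using stable by (metis number_not_less_zero)
  \<comment> \<open>The colouring is extended by 0 to all codes that are not increasing pairs, since
    g(lam n, mu n) is also evaluated on the diagonal; 0 is a colour because k is nonzero. The
    bounded quantifiers keep the extension Delta_1.\<close>
  define G where "G w v \<longleftrightarrow> (if \<exists>x\<le>w. \<exists>y\<le>w. x < y \<and> w = pr x y then pr w v \<in> f else v = 0)" for w v
  have G_pair: "G (pr x y) v \<longleftrightarrow> (if x < y then pr (pr x y) v \<in> f else v = 0)" for x y v
    using pr_ge(1)[of x y] pr_ge(2)[of y x] unfolding G_def by auto
  have f_ex1: "\<exists>!v. pr (pr x y) v \<in> f" if "x < y" for x y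
    using f_graph that unfolding function_graph_def by blast
  have f_less: "v < k" if "pr (pr x y) v \<in> f" for x y v
    using f_graph that unfolding function_graph_def by (metis pr_inj)
  have ex1: "\<exists>!v. G w v" for w
  proof (cases "\<exists>x\<le>w. \<exists>y\<le>w. x < y \<and> w = pr x y")
    case True
    then have "\<exists>!v. pr w v \<in> f" using f_ex1 by blast
    then show ?thesis using True by (simp add: G_def)
  qed (auto simp: G_def)
  have "G w v \<longleftrightarrow> ((\<exists>x\<le>w. \<exists>y\<le>w. x < y \<and> w = pr x y) \<and> pr w v \<in> f) \<or>
      (\<not> (\<exists>x\<le>w. \<exists>y\<le>w. x < y \<and> w = pr x y) \<and> v = 0)" for w v
    unfolding G_def by (rule if_bool_eq_disj)
  then have "d1 (\<lambda>e. G (e 0) (e 1))"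
    by (simp only:) (intro d1_intros dt_intros dt_pr f)
  then have THE_dt: "dt (\<lambda>e. THE v. G (e 0) v)" using ex1 by (intro dt_s1_graph s1_d1)
  define g where "g x y = (THE v. G (pr x y) v)" for x y
  have g_dt: "dt (\<lambda>e. g (e 0) (e 1))"
    unfolding g_def by (rule dt_fn1[OF THE_dt]) (intro dt_pr dt_var)
  have g_eq: "g x y = v \<longleftrightarrow> G (pr x y) v" for x y v
    using ex1_iff_THE[OF ex1, of "pr x y" v] unfolding g_def by auto
  have g_f: "g x y = v \<longleftrightarrow> pr (pr x y) v \<in> f" if "x < y" for x y v
    using that by (simp add: g_eq G_pair)
  have g_less: "g x y < k" for x y
  proof (cases "x < y")
    case True
    then show ?thesis using g_f[of x y "g x y"] f_less by blast
  next
    case False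
    then have "g x y = 0" by (simp add: g_eq G_pair)
    then show ?thesis using \<open>k \<noteq> 0\<close> by simp
  qed
  obtain a b d where d: "d < k" and ab: "dt (\<lambda>e. a (e 0))" "dt (\<lambda>e. b (e 0))"
    "\<And>i. a i \<le> b i" "\<And>i. b i < a (i + 1)" and g_ab: "\<And>i j. i \<le> j \<Longrightarrow> g (a i) (b j) = d"
    by (rule adjacent_hindman[OF AHT, of g k, OF g_dt g_less]) blast
  have a_step: "a i < a (i + 1)" for i using ab(3,4) by (rule le_less_trans)
  have a_ge: "i \<le> a i" for i using ab(1) a_step by (rule increasing_ge)
  note a_in_sets = range_in_sets[OF ab(1) a_step]
  have limit: "\<exists>t. \<forall>s\<ge>t. g x s = d" if x_range: "x \<in> range a" for x
  proof -
    obtain i where x: "x = a i" using x_range by blast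
    obtain d' t where t: "x < t" "\<forall>s. t \<le> s \<longrightarrow> pr (pr x s) d' \<in> f" using stable by blast
    have g_t: "g x s = d'" if "t \<le> s" for s
      using t that by (simp add: g_f less_le_trans)
    \<comment> \<open>The index must satisfy i <= j, for the colour d, and t <= b j, for the limit
      colour; t <= j is enough for the latter as j <= a j <= b j.\<close>
    define j where "j = max i t"
    have "t \<le> b j" using a_ge[of j] ab(3)[of j] unfolding j_def by (meson max.boundedE order_trans)
    moreover have "g x (b j) = d" unfolding x by (rule g_ab) (simp add: j_def)
    ultimately have "d' = d" using g_t by blast
    then show ?thesis using g_t by blast
  qed
  text \<open>The limits are reached uniformly below \<open>n\<close>: otherwise colour \<open>u\<close> by the element
    \<open>x \<le> n\<close> witnessing the failure at a bound beyond \<open>u\<close>; a colour occurring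
    unboundedly often contradicts stability.\<close>
  have uniform: "\<exists>t. \<forall>x\<le>n. x \<in> range a \<longrightarrow> (\<forall>s\<ge>t. g x s = d)" for n
  proof (rule ccontr)
    assume no: "\<not> ?thesis"
    define bad where "bad s x \<longleftrightarrow> x \<le> n \<and> x \<in> range a \<and> g x s \<noteq> d" for s x
    have bad_d1: "dt u \<Longrightarrow> dt v \<Longrightarrow> d1 (\<lambda>e. bad (u e) (v e))" for u v
      unfolding bad_def by (intro d1_intros dt_intros dt_fn2[OF g_dt] a_in_sets)
    have ex_bad: "\<exists>s. t \<le> s \<and> (\<exists>x\<le>n. bad s x)" for t using no unfolding bad_def by blast
    define time where "time t = (LEAST s. t \<le> s \<and> (\<exists>x\<le>n. bad s x))" for t
    have "d1 (\<lambda>e. tail e 0 \<le> e 0 \<and> (\<exists>x\<le>n. bad (e 0) x))"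
      by (intro d1_intros dt_intros bad_d1)
    then have time_dt: "dt (\<lambda>e. time (e 0))"
      unfolding time_def by (rule dt_least) (rule ex_bad)
    have time: "t \<le> time t" "\<exists>x. bad (time t) x" for t
    proof -
      obtain s where s: "t \<le> s \<and> (\<exists>x\<le>n. bad s x)" using ex_bad by blast
      have d1: "d1 (\<lambda>e. t \<le> e 0 \<and> (\<exists>x\<le>n. bad (e 0) x))"
        by (intro d1_intros dt_intros bad_d1)
      note least = d1_least(1)[where P="\<lambda>s. t \<le> s \<and> (\<exists>x\<le>n. bad s x)", OF d1 s, folded time_def]
      show "t \<le> time t" "\<exists>x. bad (time t) x" using least by auto
    qed
    define col where "col t = (LEAST x. bad (time t) x)" for t
    have "d1 (\<lambda>e. bad (time (tail e 0)) (e 0))"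
      by (intro d1_intros dt_intros bad_d1 dt_fn1[OF time_dt])
    then have col_dt: "dt (\<lambda>e. col (e 0))"
      unfolding col_def by (rule dt_least) (rule time)
    have col: "bad (time t) (col t)" for t
    proof -
      obtain x where x: "bad (time t) x" using time by blast
      have d1: "d1 (\<lambda>e. bad (time t) (e 0))" by (intro d1_intros dt_intros bad_d1)
      show ?thesis using d1_least(1)[where P="bad (time t)", OF d1 x] by (simp add: col_def)
    qed
    \<comment> \<open>The n + 1 colours are the possible witnesses. The binary colouring passed to
      \<open>adjacent_hindman\<close> ignores its second argument, so only the unbounded sequence a'
      is of interest.\<close>
    have "col x < n + 1" for x using col[of x] by (simp add: bad_def number_less_Suc)
    then obtain a' b' x where a': "dt (\<lambda>e. a' (e 0))" "\<And>i. a' i \<le> b' i" "\<And>i. b' i < a' (i + 1)"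
      and col_a': "\<And>i j. i \<le> j \<Longrightarrow> col (a' i) = x"
      by (rule adjacent_hindman[OF AHT, of "\<lambda>u v. col u" "n + 1", OF col_dt]) blast
    have "x \<in> range a" using col[of "a' 0"] col_a'[of 0 0] by (simp add: bad_def)
    then obtain t where t: "\<forall>s\<ge>t. g x s = d" using limit by blast
    \<comment> \<open>At the number a' t the failure time lies beyond the point where the witness x
      has reached its limit, yet x still fails there.\<close>
    have "t \<le> a' t" using a'(1) le_less_trans[OF a'(2,3)] by (rule increasing_ge)
    then have "t \<le> time (a' t)" using time(1) order_trans by blast
    then have "g x (time (a' t)) = d" using t by blast
    then show False using col[of "a' t"] col_a'[of t t] by (simp add: bad_def)
  qed
  \<comment> \<open>The next element must have colour d with all members of \<open>range a\<close>
    up to x, not merely with those selected before. The choice then depends on x alone, so iterating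
    \<open>nxt\<close> by primitive recursion needs no record of the history; \<open>uniform\<close>
    shows that a next element exists.\<close>
  define good where "good x y \<longleftrightarrow> x < y \<and> y \<in> range a \<and> (\<forall>z\<le>x. z \<in> range a \<longrightarrow> g z y = d)" for x y
  have good_d1: "dt u \<Longrightarrow> dt v \<Longrightarrow> d1 (\<lambda>e. good (u e) (v e))" for u v
    unfolding good_def by (intro d1_intros dt_intros dt_fn2[OF g_dt] a_in_sets dt_tail)
  have good_ex: "\<exists>y. good x y" for x
  proof -
    obtain t where t: "\<forall>z\<le>x. z \<in> range a \<longrightarrow> (\<forall>s\<ge>t. g z s = d)" using uniform by blast
    have "x + 1 \<le> a (max t (x + 1))" "t \<le> a (max t (x + 1))"
      using a_ge[of "max t (x + 1)"] by (meson max.boundedE)+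
    then have "good x (a (max t (x + 1)))"
      using t by (auto simp: good_def number_Suc_le)
    then show ?thesis by blast
  qed
  define nxt where "nxt x = (LEAST y. good x y)" for x
  have "d1 (\<lambda>e. good (tail e 0) (e 0))" by (intro good_d1 dt_intros)
  then have nxt_dt: "dt (\<lambda>e. nxt (e 0))" unfolding nxt_def by (rule dt_least) (rule good_ex)
  have nxt: "good x (nxt x)" for x
  proof -
    obtain y where y: "good x y" using good_ex by blast
    have d1: "d1 (\<lambda>e. good x (e 0))" by (intro good_d1 dt_intros)
    show ?thesis using d1_least(1)[where P="good x", OF d1 y] by (simp add: nxt_def)
  qed
  have "dt (\<lambda>e. nxt (e 1))" by (rule dt_fn1[OF nxt_dt dt_var])
  then obtain h where h: "dt (\<lambda>e. h (e 0))" "h 0 = a 0" "\<And>i. h (i + 1) = nxt (h i)"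
    using primitive_recursion[of "\<lambda>i. nxt" "a 0"] by blast
  have h_step: "h i < h (i + 1)" for i using nxt[of "h i"] by (simp add: h(3) good_def)
  have h_a: "h i \<in> range a" for i
    using number_cases[of i] nxt by (auto simp: h(2,3) good_def)
  note h_less = increasing_less[OF h(1) h_step]
  have homogeneous: "g (h i) (h j) = d" if ij: "i < j" for i j
  proof -
    obtain l where l: "j = l + 1" using ij number_cases[of j] by auto
    then have "i \<le> l" using ij by (simp add: number_less_Suc)
    then have "h i \<le> h l" using h_less[of i l] by (auto simp: le_less)
    then show ?thesis using nxt[of "h l"] h_a[of i] by (simp add: l h(3) good_def)
  qed
  show "\<exists>J\<in>sets. (\<forall>m. \<exists>n. m < n \<and> n \<in> J) \<and>
      (\<exists>d. d < k \<and> (\<forall>x y. x \<in> J \<and> y \<in> J \<and> x < y \<longrightarrow> pr (pr x y) d \<in> f))"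
  proof (rule bexI[of _ "range h"], intro conjI)
    show "range h \<in> sets" by (rule range_in_sets[OF h(1) h_step])
    have "m < h (m + 1)" for m
      using increasing_ge[OF h(1) h_step, of "m + 1"] by (simp add: number_Suc_le)
    then show "\<forall>m. \<exists>n. m < n \<and> n \<in> range h" by blast
    have "pr (pr x y) d \<in> f" if xy: "x \<in> range h" "y \<in> range h" "x < y" for x y
    proof -
      obtain i j where ij: "x = h i" "y = h j" using xy by blast
      have "i < j"
      proof (rule ccontr)
        assume "\<not> i < j"
        then have "h j \<le> h i" using h_less[of j i] by (auto simp: not_less le_less)
        then show False using xy ij by simp
      qed
      then have "g x y = d" using homogeneous ij by simp
      then show ?thesis using g_f[OF xy(3), of d] by simp
    qed
    then show "\<exists>d. d < k \<and> (\<forall>x y. x \<in> range h \<and> y \<in> range h \<and> x < y \<longrightarrow> pr (pr x y) d \<in> f)"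
      using d by blast
  qed
qed

theorem mainTheorem7: "RCA0 \<turnstile> Imp AHT SRT2"
proof (rule ccontr)
  assume "\<not> RCA0 \<turnstile> Imp AHT SRT2"
  then have "Neg goal_fm \<in> Th" by (intro Th(3)) (simp add: goal_fm_def)
  then have "valid sets (Neg goal_fm)"
    using sentence_goal by (simp add: valid_Th sentence_def)
  then have "\<not> sat sets (\<lambda>_. 0) (\<lambda>_. set_of 0) goal_fm"
    unfolding valid_def by (auto simp: image_subset_iff)
  then show False
    using AHT_imp_SRT2 by (simp add: goal_fm_def sat_AHT sat_SRT2)
qed

end
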